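(* A nonabelian $8$-dimensional nice nilpotent Lie algebra admits a diagonal Ricci-flat metric if and only if it is equivalent to one of the following: (1) $(0,0,-e^{12},e^{13},e^{23},e^{14},e^{15}+e^{24},e^{26}+e^{34})$; (2) $(0,0,0,-e^{12},e^{14},e^{15}+e^{24},e^{16}+e^{25},e^{26}+e^{45})$; (3) $(0,0,0,e^{12},e^{13}+e^{24},e^{14},e^{25}+e^{34},e^{15}+e^{26})$; (4) $(0,0,0,(a-1)e^{12},ae^{13}+e^{24},e^{14}+e^{23},e^{15}+e^{26},e^{16}+e^{25}+e^{34})$ with $a>0$, $a\neq1$; (5) $(0,0,0,(a-1)e^{12},ae^{13}+e^{24},-e^{14}+e^{23},-e^{15}+e^{26},e^{16}+e^{25}+e^{34})$ with $a>0$, $a\neq1$; (6) $(0,0,0,0,e^{14}+e^{23},e^{13}+e^{24},e^{16}+e^{25},e^{15}+e^{26})$; (7) $(0,0,0,0,-e^{14}+e^{23},e^{13}+e^{24},-e^{16}+e^{25},e^{15}+e^{26})$; (8) $(0,0,0,0,(a-1)e^{12},ae^{13},e^{23},e^{17}+e^{26}+e^{35})$ with $a\in\mathbb{R}\setminus\{0,1\}$; (9) $(0,0,0,0,0,e^{12},e^{13},e^{27}+e^{36})$.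
   Context: A nice basis of a real Lie algebra is a basis $\{e_1,\dots,e_n\}$ with dual basis $\{e^i\}$ such that each $[e_i,e_j]$ is a multiple of some $e_h$ and each $e_i\lrcorner\,de^j$ is a multiple of some $e^h$, where $d$ is the Chevalley–Eilenberg differential. The notation $(\omega_1,\dots,\omega_n)$ denotes the Lie algebra with nice basis $e_1,\dots,e_n$ and $de^k=\omega_k$, $e^{ij}=e^i\wedge e^j$. Two nice Lie algebras are equivalent if there is a Lie algebra isomorphism mapping each basis element to a multiple of a basis element. A diagonal metric is a nondegenerate scalar product $\sum g_ie^i\otimes e^i$ in the nice basis (any signature); Ricci-flat means the Ricci tensor of the corresponding left-invariant pseudoriemannian metric vanishes. *)

theory Defs
  imports Complex_Main
begin

text \<open>A real Lie algebra of dimension n with a fixed basis e_1,...,e_n (indices 1..n)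
  is encoded by its structure constants c, where [e_i,e_j] = sum_k c i j k e_k.\<close>

definition supported :: "nat \<Rightarrow> (nat \<Rightarrow> nat \<Rightarrow> nat \<Rightarrow> real) \<Rightarrow> bool" where
  "supported n c \<longleftrightarrow> (\<forall>i j k. c i j k \<noteq> 0 \<longrightarrow> i \<in> {1..n} \<and> j \<in> {1..n} \<and> k \<in> {1..n})"

definition is_lie_algebra :: "nat \<Rightarrow> (nat \<Rightarrow> nat \<Rightarrow> nat \<Rightarrow> real) \<Rightarrow> bool" where
  "is_lie_algebra n c \<longleftrightarrow> supported n c
     \<and> (\<forall>i j k. c i j k = - c j i k)
     \<and> (\<forall>i j k m. (\<Sum>l\<in>{1..n}. c j k l * c i l m + c k i l * c j l m + c i j l * c k l m) = 0)"

definition br :: "nat \<Rightarrow> (nat \<Rightarrow> nat \<Rightarrow> nat \<Rightarrow> real) \<Rightarrow> (nat \<Rightarrow> real) \<Rightarrow> (nat \<Rightarrow> real) \<Rightarrow> (nat \<Rightarrow> real)" where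
  "br n c x y = (\<lambda>k. \<Sum>i\<in>{1..n}. \<Sum>j\<in>{1..n}. x i * y j * c i j k)"

definition nilpotent_la :: "nat \<Rightarrow> (nat \<Rightarrow> nat \<Rightarrow> nat \<Rightarrow> real) \<Rightarrow> bool" where
  "nilpotent_la n c \<longleftrightarrow> (\<exists>m. \<forall>xs y. length xs = m \<longrightarrow> foldr (br n c) xs y = (\<lambda>_. 0))"

definition abelian_la :: "nat \<Rightarrow> (nat \<Rightarrow> nat \<Rightarrow> nat \<Rightarrow> real) \<Rightarrow> bool" where
  "abelian_la n c \<longleftrightarrow> (\<forall>i\<in>{1..n}. \<forall>j\<in>{1..n}. \<forall>k\<in>{1..n}. c i j k = 0)"

text \<open>Chevalley--Eilenberg differential of dual basis elements:
  de^k(e_i,e_j) = - e^k([e_i,e_j]).\<close>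
definition dform :: "(nat \<Rightarrow> nat \<Rightarrow> nat \<Rightarrow> real) \<Rightarrow> nat \<Rightarrow> nat \<Rightarrow> nat \<Rightarrow> real" where
  "dform c k i j = - c i j k"

text \<open>Nice basis: each [e_i,e_j] is a multiple of some e_h and each
  e_i contracted into de^j (= sum_h de^j(e_i,e_h) e^h) is a multiple of some e^h.\<close>
definition nice_basis :: "nat \<Rightarrow> (nat \<Rightarrow> nat \<Rightarrow> nat \<Rightarrow> real) \<Rightarrow> bool" where
  "nice_basis n c \<longleftrightarrow>
     (\<forall>i\<in>{1..n}. \<forall>j\<in>{1..n}. \<exists>h\<in>{1..n}. \<forall>k\<in>{1..n}. k \<noteq> h \<longrightarrow> c i j k = 0)
   \<and> (\<forall>i\<in>{1..n}. \<forall>j\<in>{1..n}. \<exists>h\<in>{1..n}. \<forall>k\<in>{1..n}. k \<noteq> h \<longrightarrow> dform c j i k = 0)"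

definition nice_nilpotent :: "nat \<Rightarrow> (nat \<Rightarrow> nat \<Rightarrow> nat \<Rightarrow> real) \<Rightarrow> bool" where
  "nice_nilpotent n c \<longleftrightarrow> is_lie_algebra n c \<and> nilpotent_la n c \<and> nice_basis n c"

text \<open>Equivalence: a Lie algebra isomorphism e_i \<mapsto> lam i * e_(\<sigma> i) from c to c'.\<close>
definition nice_equiv :: "nat \<Rightarrow> (nat \<Rightarrow> nat \<Rightarrow> nat \<Rightarrow> real) \<Rightarrow> (nat \<Rightarrow> nat \<Rightarrow> nat \<Rightarrow> real) \<Rightarrow> bool" where
  "nice_equiv n c c' \<longleftrightarrow> (\<exists>\<sigma> lam. bij_betw \<sigma> {1..n} {1..n} \<and> (\<forall>i\<in>{1..n}. lam i \<noteq> (0::real))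
      \<and> (\<forall>i\<in>{1..n}. \<forall>j\<in>{1..n}. \<forall>k\<in>{1..n}.
            lam i * lam j * c' (\<sigma> i) (\<sigma> j) (\<sigma> k) = c i j k * lam k))"

text \<open>Levi-Civita connection of the left-invariant metric sum_i g i e^i \<otimes> e^i (Koszul formula):
  nabla_{e_i} e_j = sum_k Gamma i j k e_k.\<close>
definition christoffel :: "nat \<Rightarrow> (nat \<Rightarrow> nat \<Rightarrow> nat \<Rightarrow> real) \<Rightarrow> (nat \<Rightarrow> real) \<Rightarrow> nat \<Rightarrow> nat \<Rightarrow> nat \<Rightarrow> real" where
  "christoffel n c g i j k = (c i j k * g k - c j k i * g i + c k i j * g j) / (2 * g k)"

text \<open>R(e_i,e_j)e_l = nabla_i nabla_j e_l - nabla_j nabla_i e_l - nabla_{[e_i,e_j]} e_l = sum_s curv i j l s e_s.\<close>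
definition curv :: "nat \<Rightarrow> (nat \<Rightarrow> nat \<Rightarrow> nat \<Rightarrow> real) \<Rightarrow> (nat \<Rightarrow> real) \<Rightarrow> nat \<Rightarrow> nat \<Rightarrow> nat \<Rightarrow> nat \<Rightarrow> real" where
  "curv n c g i j l s = (\<Sum>m\<in>{1..n}.
       christoffel n c g j l m * christoffel n c g i m s
     - christoffel n c g i l m * christoffel n c g j m s
     - c i j m * christoffel n c g m l s)"

definition ricci :: "nat \<Rightarrow> (nat \<Rightarrow> nat \<Rightarrow> nat \<Rightarrow> real) \<Rightarrow> (nat \<Rightarrow> real) \<Rightarrow> nat \<Rightarrow> nat \<Rightarrow> real" where
  "ricci n c g j l = (\<Sum>i\<in>{1..n}. curv n c g i j l i)"

definition diag_metric :: "nat \<Rightarrow> (nat \<Rightarrow> real) \<Rightarrow> bool" where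
  "diag_metric n g \<longleftrightarrow> (\<forall>i\<in>{1..n}. g i \<noteq> 0)"

definition admits_diag_ricci_flat :: "nat \<Rightarrow> (nat \<Rightarrow> nat \<Rightarrow> nat \<Rightarrow> real) \<Rightarrow> bool" where
  "admits_diag_ricci_flat n c \<longleftrightarrow>
     (\<exists>g. diag_metric n g \<and> (\<forall>j\<in>{1..n}. \<forall>l\<in>{1..n}. ricci n c g j l = 0))"

text \<open>Structure constants from the notation (de^1,...,de^n): a list entry (a,p,q,r) with p<q
  means the term a e^{pq} in de^r; since de^r(e_p,e_q) = - c p q r, this gives c p q r = -a.\<close>
definition lie_of_d :: "(real \<times> nat \<times> nat \<times> nat) list \<Rightarrow> nat \<Rightarrow> nat \<Rightarrow> nat \<Rightarrow> real" where
  "lie_of_d ts i j k = (\<Sum>(a,p,q,r)\<leftarrow>ts.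
      (if p = i \<and> q = j \<and> r = k then - a else 0) + (if p = j \<and> q = i \<and> r = k then a else 0))"

definition L1 where "L1 = lie_of_d
  [(-1,1,2,3),(1,1,3,4),(1,2,3,5),(1,1,4,6),(1,1,5,7),(1,2,4,7),(1,2,6,8),(1,3,4,8)]"
definition L2 where "L2 = lie_of_d
  [(-1,1,2,4),(1,1,4,5),(1,1,5,6),(1,2,4,6),(1,1,6,7),(1,2,5,7),(1,2,6,8),(1,4,5,8)]"
definition L3 where "L3 = lie_of_d
  [(1,1,2,4),(1,1,3,5),(1,2,4,5),(1,1,4,6),(1,2,5,7),(1,3,4,7),(1,1,5,8),(1,2,6,8)]"
definition L4 :: "real \<Rightarrow> nat \<Rightarrow> nat \<Rightarrow> nat \<Rightarrow> real" where "L4 a = lie_of_d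
  [(a-1,1,2,4),(a,1,3,5),(1,2,4,5),(1,1,4,6),(1,2,3,6),(1,1,5,7),(1,2,6,7),(1,1,6,8),(1,2,5,8),(1,3,4,8)]"
definition L5 :: "real \<Rightarrow> nat \<Rightarrow> nat \<Rightarrow> nat \<Rightarrow> real" where "L5 a = lie_of_d
  [(a-1,1,2,4),(a,1,3,5),(1,2,4,5),(-1,1,4,6),(1,2,3,6),(-1,1,5,7),(1,2,6,7),(1,1,6,8),(1,2,5,8),(1,3,4,8)]"
definition L6 where "L6 = lie_of_d
  [(1,1,4,5),(1,2,3,5),(1,1,3,6),(1,2,4,6),(1,1,6,7),(1,2,5,7),(1,1,5,8),(1,2,6,8)]"
definition L7 where "L7 = lie_of_d
  [(-1,1,4,5),(1,2,3,5),(1,1,3,6),(1,2,4,6),(-1,1,6,7),(1,2,5,7),(1,1,5,8),(1,2,6,8)]"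
definition L8 :: "real \<Rightarrow> nat \<Rightarrow> nat \<Rightarrow> nat \<Rightarrow> real" where "L8 a = lie_of_d
  [(a-1,1,2,5),(a,1,3,6),(1,2,3,7),(1,1,7,8),(1,2,6,8),(1,3,5,8)]"
definition L9 where "L9 = lie_of_d
  [(1,1,2,6),(1,1,3,7),(1,2,7,8),(1,3,6,8)]"

end

theory Submission
  imports Defs "HOL-Combinatorics.Permutations" "HOL-Library.Code_Binary_Nat"
begin

text \<open>For a diagonal metric on a nice nilpotent Lie algebra the Ricci tensor is diagonal. Attach to each
  bracket \<open>[e_i, e_j] = c e_k\<close> the weight \<open>c^2 g_k / (g_i g_j)\<close>; the metric is Ricci-flat if and only if at
  every node the weights of the incoming brackets add up to those of the outgoing ones. So the set of
  nonzero brackets must carry a nowhere vanishing solution of a homogeneous linear system, and this leaves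
  few combinatorial types.

  Nilpotency orders the basis so that brackets point upwards, and the nice diagrams are enumerated up to
  isomorphism by adding one last node at a time: the brackets into the new node form a matching that the
  support of the Jacobi identities restricts further. In dimension 8 the linear system eliminates all but
  40 nonabelian diagrams. For 33 of them a two-term Jacobi identity, which yields an equation between
  products of weights, the positivity of a monomial in the weights, or an inconsistency of signs in the
  Jacobi identities gives a contradiction. The structure constants of the other seven can be
  rescaled to the nine listed families; the parameter \<open>a\<close> is a ratio of products of structure constants,
  and \<open>a > 0\<close> in (4) and (5) comes from the signs of the weights.\<close>

section \<open>Ricci curvature of nice Lie algebras\<close>

text \<open>The node equations can be used only in dimension 8: a later node may still attach
  brackets to earlier ones, so up to dimension 7 every diagram has to be kept. The enumeration sees
  supports only: a Jacobi identity says merely that a nonzero term needs a second one. The lists may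
  thus contain diagrams of no Lie algebra, which is harmless. A linear combination of the node
  equations that isolates one weight refutes a diagram, since weights of nonzero brackets cannot
  vanish. For the diagrams that resist, the weights are not independent: two monomials in them with
  the same metric factor have a positive ratio, and a two-term Jacobi identity makes that ratio 1.
  Such relations see structure constants through their squares; signs have to be taken from the
  Jacobi identities themselves. Signs also explain the pairs (4), (5) and (6), (7): each pair shares
  a diagram, and a diagonal rescaling multiplies a certain ratio of structure constants by a
  square.\<close>

definition nice_alg :: "nat \<Rightarrow> (nat \<Rightarrow> nat \<Rightarrow> nat \<Rightarrow> real) \<Rightarrow> bool" where
  "nice_alg n c \<longleftrightarrow> is_lie_algebra n c
     \<and> (\<forall>i j k k'. c i j k \<noteq> 0 \<longrightarrow> c i j k' \<noteq> 0 \<longrightarrow> k = k')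
     \<and> (\<forall>i j j' k. c i j k \<noteq> 0 \<longrightarrow> c i j' k \<noteq> 0 \<longrightarrow> j = j')"

lemma nice_algD:
  assumes "nice_alg n c"
  shows nice_alg_supported: "c i j k \<noteq> 0 \<Longrightarrow> i \<in> {1..n} \<and> j \<in> {1..n} \<and> k \<in> {1..n}"
    and nice_alg_antisym: "c i j k = - c j i k"
    and nice_alg_jacobi: "(\<Sum>l\<in>{1..n}. c j k l * c i l m + c k i l * c j l m + c i j l * c k l m) = 0"
    and nice_alg_target_unique: "c i j k \<noteq> 0 \<Longrightarrow> c i j k' \<noteq> 0 \<Longrightarrow> k = k'"
    and nice_alg_source_unique: "c i j k \<noteq> 0 \<Longrightarrow> c i j' k \<noteq> 0 \<Longrightarrow> j = j'"
  using assms unfolding nice_alg_def is_lie_algebra_def supported_def by blast+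

lemma nice_alg_imp_supported: "nice_alg n c \<Longrightarrow> supported n c"
  by (simp add: nice_alg_def is_lie_algebra_def)

lemma nice_nilpotent_imp_nice_alg:
  assumes "nice_nilpotent n c"
  shows "nice_alg n c"
proof -
  have lie: "is_lie_algebra n c" and nice: "nice_basis n c"
    using assms by (auto simp: nice_nilpotent_def)
  have supp: "c i j k \<noteq> 0 \<Longrightarrow> i \<in> {1..n} \<and> j \<in> {1..n} \<and> k \<in> {1..n}" for i j k
    using lie unfolding is_lie_algebra_def supported_def by blast
  have "k = k'" if "c i j k \<noteq> 0" "c i j k' \<noteq> 0" for i j k k'
    using nice supp[OF that(1)] supp[OF that(2)] that unfolding nice_basis_def by metis
  moreover have "j = j'" if "c i j k \<noteq> 0" "c i j' k \<noteq> 0" for i j j' k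
    using nice supp[OF that(1)] supp[OF that(2)] that unfolding nice_basis_def dform_def
    by (metis neg_equal_0_iff_equal)
  ultimately show ?thesis
    using lie unfolding nice_alg_def by blast
qed

definition sorted_alg :: "(nat \<Rightarrow> nat \<Rightarrow> nat \<Rightarrow> real) \<Rightarrow> bool" where
  "sorted_alg c \<longleftrightarrow> (\<forall>i j k. c i j k \<noteq> 0 \<longrightarrow> i < k \<and> j < k)"

text \<open>The form in which nilpotency enters the curvature computation: a rank that increases
  along brackets excludes cycles of brackets, whatever the order of the basis.\<close>

definition graded_by :: "(nat \<Rightarrow> nat) \<Rightarrow> (nat \<Rightarrow> nat \<Rightarrow> nat \<Rightarrow> real) \<Rightarrow> bool" where
  "graded_by r c \<longleftrightarrow> (\<forall>i j k. c i j k \<noteq> 0 \<longrightarrow> r i < r k \<and> r j < r k)"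

definition ricci_weight :: "(nat \<Rightarrow> nat \<Rightarrow> nat \<Rightarrow> real) \<Rightarrow> (nat \<Rightarrow> real) \<Rightarrow> nat \<Rightarrow> nat \<Rightarrow> nat \<Rightarrow> real" where
  "ricci_weight c g i j k = (c i j k)\<^sup>2 * g k / (g i * g j)"

text \<open>Up to the factor \<open>g v / 4\<close>, this is the Ricci curvature of the basis vector \<open>v\<close>: brackets into
  \<open>v\<close> contribute positively, brackets starting at \<open>v\<close> negatively (the Killing form vanishes).\<close>

definition balance :: "nat \<Rightarrow> (nat \<Rightarrow> nat \<Rightarrow> nat \<Rightarrow> real) \<Rightarrow> (nat \<Rightarrow> real) \<Rightarrow> nat \<Rightarrow> real" where
  "balance n c g v = (\<Sum>i\<in>{1..n}. \<Sum>m\<in>{1..n}. ricci_weight c g i m v - 2 * ricci_weight c g v i m)"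

definition balanced :: "nat \<Rightarrow> (nat \<Rightarrow> nat \<Rightarrow> nat \<Rightarrow> real) \<Rightarrow> (nat \<Rightarrow> real) \<Rightarrow> bool" where
  "balanced n c g \<longleftrightarrow> diag_metric n g \<and> (\<forall>v\<in>{1..n}. balance n c g v = 0)"

text \<open>Cross terms disappear for two reasons: some products of structure constants would close
  a cycle, against \<open>r\<close>, and others share two of their three slots, against
  niceness.\<close>

lemma ricci_nice:
  assumes c: "nice_alg n c" and r: "graded_by r c" and g: "diag_metric n g"
    and j: "j \<in> {1..n}" and l: "l \<in> {1..n}"
  shows "ricci n c g j l = (if j = l then g j / 4 * balance n c g j else 0)"
proof -
  have gr1: "c i j k \<noteq> 0 \<Longrightarrow> r i < r k" and gr2: "c i j k \<noteq> 0 \<Longrightarrow> r j < r k" for i j k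
    using r by (auto simp: graded_by_def)
  have anti: "c i j k = - c j i k" for i j k
    using nice_alg_antisym[OF c] .
  have gnz: "g i \<noteq> 0" if "i \<in> {1..n}" for i
    using g that by (auto simp: diag_metric_def)
  have loop: "c i m i = 0" "c m i i = 0" for i m
    using gr1[of i m i] gr2[of m i i] by auto
  have loop': "c i i m = 0" for i m
    using anti[of i i m] by linarith
  \<comment> \<open>The divergence of every basis vector vanishes, so the first sum in the trace of
    the curvature drops out.\<close>
  have tr: "christoffel n c g i m i = 0" for i m
    by (simp add: christoffel_def loop loop')
  define t where "t i m = - (christoffel n c g i l m * christoffel n c g j m i) - c i j m * christoffel n c g m l i" for i m
  have ric: "ricci n c g j l = (\<Sum>i\<in>{1..n}. \<Sum>m\<in>{1..n}. t i m)"
    unfolding ricci_def curv_def t_def by (simp add: tr)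
  have form: "t i m =
      - ((c i l m * g m - c l m i * g i + c m i l * g l) * (c j m i * g i - c m i j * g j + c i j m * g m)) / (4 * g i * g m)
      - c i j m * (- c l m i * g i + c i l m * g m - c m i l * g l) / (2 * g i)"
    if "i \<in> {1..n}" "m \<in> {1..n}" for i m
  proof -
    have "christoffel n c g m l i = (- c l m i * g i + c i l m * g m - c m i l * g l) / (2 * g i)"
      unfolding christoffel_def using anti[of m l i] anti[of l i m] anti[of i m l] by simp
    then show ?thesis
      unfolding t_def by (simp only: christoffel_def[of n c g i l m] christoffel_def[of n c g j m i])
        (simp add: ac_simps)
  qed
  show ?thesis
  proof (cases "j = l")
    case False
    \<comment> \<open>Off the diagonal, the products that survive form \<open>h i m - h m i\<close>;
      being antisymmetric in the summation indices they cancel in the double sum.\<close>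
    define h where "h i m = (c i l m * c m i j * g j + c m i l * c i j m * g l) / (4 * g i)" for i m
    have "t i m = h i m - h m i" if "i \<in> {1..n}" "m \<in> {1..n}" for i m
    proof -
      have z: "c i l m * c j m i = 0" "c l m i * c i j m = 0"
        using gr1[of i l m] gr2[of j m i] gr2[of l m i] gr1[of i j m]
        by (metis less_asym mult_eq_0_iff)+
      have z2: "c i l m * c i j m = 0" "c m i l * c m i j = 0"
        using nice_alg_source_unique[OF c, of i l m j] nice_alg_target_unique[OF c, of m i l j] False
        by auto
      have z3: "c l m i * c j m i = 0"
        using nice_alg_source_unique[OF c, of m l i j] anti[of l m i] anti[of j m i] False by auto
      have hm: "h m i = (c l m i * c m i j * g j + c m i l * c j m i * g l) / (4 * g m)"
        unfolding h_def using anti[of m l i] anti[of i m j] anti[of i m l] anti[of m j i] by simp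
      have "(c i l m * g m - c l m i * g i + c m i l * g l) * (c j m i * g i - c m i j * g j + c i j m * g m)
          = (c i l m * c j m i) * (g m * g i) + (c i l m * c i j m) * (g m * g m) - (c l m i * c j m i) * (g i * g i)
            - (c l m i * c i j m) * (g i * g m) - (c m i l * c m i j) * (g l * g j)
            - c i l m * c m i j * g m * g j + c l m i * c m i j * g i * g j
            + c m i l * c j m i * g l * g i + c m i l * c i j m * g l * g m"
        by (simp add: algebra_simps)
      also have "\<dots> = - c i l m * c m i j * g m * g j + c l m i * c m i j * g i * g j
            + c m i l * c j m i * g l * g i + c m i l * c i j m * g l * g m"
        by (simp add: z z2 z3)
      finally have e1: "(c i l m * g m - c l m i * g i + c m i l * g l) * (c j m i * g i - c m i j * g j + c i j m * g m) = \<dots>" .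
      have "c i j m * (- c l m i * g i + c i l m * g m - c m i l * g l)
        = - (c l m i * c i j m) * g i + (c i l m * c i j m) * g m - c m i l * c i j m * g l"
        by (simp add: algebra_simps)
      then have e2: "c i j m * (- c l m i * g i + c i l m * g m - c m i l * g l) = - c m i l * c i j m * g l"
        by (simp add: z z2)
      show ?thesis
        unfolding form[OF that] e1 e2 hm unfolding h_def using gnz[OF that(1)] gnz[OF that(2)]
        by (simp add: field_simps)
    qed
    then have "ricci n c g j l = (\<Sum>i\<in>{1..n}. \<Sum>m\<in>{1..n}. h i m - h m i)"
      unfolding ric by (intro sum.cong) auto
    also have "\<dots> = 0"
      using sum.swap[of h "{1..n}" "{1..n}"] by (simp add: sum_subtractf)
    finally show ?thesis using False by simp
  next
    case True
    let ?y = "ricci_weight c g"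
    have "t i m = g j * (- 3 / 4 * ?y j i m + 1 / 4 * ?y j m i + 1 / 4 * ?y i m j)"
      if "i \<in> {1..n}" "m \<in> {1..n}" for i m
    proof -
      \<comment> \<open>Each of these products would give a cycle of length two through
        \<open>j\<close>, \<open>m\<close> and \<open>i\<close>, so only squares remain.\<close>
      have z: "c i j m * c j m i = 0" "c i j m * c m i j = 0" "c j m i * c m i j = 0"
        using gr1[of i j m] gr2[of j m i] gr2[of i j m] gr1[of m i j] gr2[of m i j] gr1[of j m i]
        by (metis less_asym mult_eq_0_iff)+
      have "(c i j m * g m - c j m i * g i + c m i j * g j) * (c j m i * g i - c m i j * g j + c i j m * g m)
        = (c i j m)\<^sup>2 * (g m)\<^sup>2 - (c j m i)\<^sup>2 * (g i)\<^sup>2 - (c m i j)\<^sup>2 * (g j)\<^sup>2 + 2 * (c j m i * c m i j) * g i * g j"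
        by (simp add: algebra_simps power2_eq_square)
      then have e1: "(c i j m * g m - c j m i * g i + c m i j * g j) * (c j m i * g i - c m i j * g j + c i j m * g m)
        = (c i j m)\<^sup>2 * (g m)\<^sup>2 - (c j m i)\<^sup>2 * (g i)\<^sup>2 - (c m i j)\<^sup>2 * (g j)\<^sup>2"
        by (simp add: z)
      have "c i j m * (- c j m i * g i + c i j m * g m - c m i j * g j)
        = (c i j m)\<^sup>2 * g m - (c i j m * c j m i) * g i - (c i j m * c m i j) * g j"
        by (simp add: algebra_simps power2_eq_square)
      then have e2: "c i j m * (- c j m i * g i + c i j m * g m - c m i j * g j) = (c i j m)\<^sup>2 * g m"
        by (simp add: z)
      have a: "c j i m = - c i j m" "c i m j = - c m i j" using anti by blast+
      show ?thesis
        unfolding form[OF that] True[symmetric] e1 e2 unfolding ricci_weight_def a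
        using gnz[OF that(1)] gnz[OF that(2)] gnz[OF j]
        by (simp add: field_simps power2_eq_square)
    qed
    then have "ricci n c g j l = (\<Sum>i\<in>{1..n}. \<Sum>m\<in>{1..n}. g j * (- 3 / 4 * ?y j i m + 1 / 4 * ?y j m i + 1 / 4 * ?y i m j))"
      unfolding ric by (intro sum.cong) auto
    also have "\<dots> = g j * (- 3 / 4 * (\<Sum>i\<in>{1..n}. \<Sum>m\<in>{1..n}. ?y j i m) + 1 / 4 * (\<Sum>i\<in>{1..n}. \<Sum>m\<in>{1..n}. ?y j m i)
       + 1 / 4 * (\<Sum>i\<in>{1..n}. \<Sum>m\<in>{1..n}. ?y i m j))"
      by (simp only: sum.distrib sum_distrib_left[symmetric])
    also have "(\<Sum>i\<in>{1..n}. \<Sum>m\<in>{1..n}. ?y j m i) = (\<Sum>i\<in>{1..n}. \<Sum>m\<in>{1..n}. ?y j i m)"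
      by (rule sum.swap)
    also have "g j * (- 3 / 4 * (\<Sum>i\<in>{1..n}. \<Sum>m\<in>{1..n}. ?y j i m) + 1 / 4 * (\<Sum>i\<in>{1..n}. \<Sum>m\<in>{1..n}. ?y j i m)
       + 1 / 4 * (\<Sum>i\<in>{1..n}. \<Sum>m\<in>{1..n}. ?y i m j)) = g j / 4 * balance n c g j"
      unfolding balance_def by (simp add: sum_subtractf sum_distrib_left[symmetric] algebra_simps)
    finally show ?thesis using True by simp
  qed
qed

lemma admits_diag_ricci_flat_iff_balanced:
  assumes "nice_alg n c" "graded_by r c"
  shows "admits_diag_ricci_flat n c \<longleftrightarrow> (\<exists>g. balanced n c g)"
proof -
  have "(\<forall>j\<in>{1..n}. \<forall>l\<in>{1..n}. ricci n c g j l = 0) \<longleftrightarrow> (\<forall>v\<in>{1..n}. balance n c g v = 0)"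
    if "diag_metric n g" for g
    using ricci_nice[OF assms that] that by (auto simp: diag_metric_def split: if_splits)
  then show ?thesis
    unfolding admits_diag_ricci_flat_def balanced_def by blast
qed

section \<open>Equivalence and relabelling of nice Lie algebras\<close>

lemma nice_equiv_refl: "nice_equiv n c c"
  unfolding nice_equiv_def by (intro exI[of _ id] exI[of _ "\<lambda>_. 1"]) simp

lemma nice_equiv_sym:
  assumes "nice_equiv n c c'"
  shows "nice_equiv n c' c"
proof -
  obtain \<sigma> lam where \<sigma>: "bij_betw \<sigma> {1..n} {1..n}" and lam: "\<forall>i\<in>{1..n}. lam i \<noteq> (0::real)"
    and eq: "\<forall>i\<in>{1..n}. \<forall>j\<in>{1..n}. \<forall>k\<in>{1..n}. lam i * lam j * c' (\<sigma> i) (\<sigma> j) (\<sigma> k) = c i j k * lam k"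
    using assms unfolding nice_equiv_def by blast
  define \<tau> where "\<tau> = inv_into {1..n} \<sigma>"
  have \<tau>: "bij_betw \<tau> {1..n} {1..n}"
    unfolding \<tau>_def by (rule bij_betw_inv_into[OF \<sigma>])
  have in\<tau>: "\<tau> i \<in> {1..n}" and \<sigma>\<tau>: "\<sigma> (\<tau> i) = i" if "i \<in> {1..n}" for i
    using \<tau> \<sigma> that by (auto simp: \<tau>_def bij_betw_inv_into_right dest: bij_betwE)
  have "1 / lam (\<tau> i) * (1 / lam (\<tau> j)) * c (\<tau> i) (\<tau> j) (\<tau> k) = c' i j k * (1 / lam (\<tau> k))"
    if "i \<in> {1..n}" "j \<in> {1..n}" "k \<in> {1..n}" for i j k
    using eq[rule_format, OF in\<tau>[OF that(1)] in\<tau>[OF that(2)] in\<tau>[OF that(3)]]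
      lam in\<tau>[OF that(1)] in\<tau>[OF that(2)] in\<tau>[OF that(3)] \<sigma>\<tau> that
    by (simp add: field_simps)
  then show ?thesis
    unfolding nice_equiv_def using \<tau> lam in\<tau>
    by (intro exI[of _ \<tau>] exI[of _ "\<lambda>i. 1 / lam (\<tau> i)"]) auto
qed

lemma nice_equiv_trans:
  assumes "nice_equiv n c c'" "nice_equiv n c' c''"
  shows "nice_equiv n c c''"
proof -
  obtain \<sigma> lam where \<sigma>: "bij_betw \<sigma> {1..n} {1..n}" and lam: "\<forall>i\<in>{1..n}. lam i \<noteq> (0::real)"
    and eq: "\<forall>i\<in>{1..n}. \<forall>j\<in>{1..n}. \<forall>k\<in>{1..n}. lam i * lam j * c' (\<sigma> i) (\<sigma> j) (\<sigma> k) = c i j k * lam k"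
    using assms(1) unfolding nice_equiv_def by blast
  obtain \<tau> mu where \<tau>: "bij_betw \<tau> {1..n} {1..n}" and mu: "\<forall>i\<in>{1..n}. mu i \<noteq> (0::real)"
    and eq': "\<forall>i\<in>{1..n}. \<forall>j\<in>{1..n}. \<forall>k\<in>{1..n}. mu i * mu j * c'' (\<tau> i) (\<tau> j) (\<tau> k) = c' i j k * mu k"
    using assms(2) unfolding nice_equiv_def by blast
  have in\<sigma>: "\<sigma> i \<in> {1..n}" if "i \<in> {1..n}" for i
    using \<sigma> that by (blast dest: bij_betwE)
  have "(lam i * mu (\<sigma> i)) * (lam j * mu (\<sigma> j)) * c'' ((\<tau> \<circ> \<sigma>) i) ((\<tau> \<circ> \<sigma>) j) ((\<tau> \<circ> \<sigma>) k)
      = c i j k * (lam k * mu (\<sigma> k))"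
    if "i \<in> {1..n}" "j \<in> {1..n}" "k \<in> {1..n}" for i j k
  proof -
    have "(lam i * mu (\<sigma> i)) * (lam j * mu (\<sigma> j)) * c'' (\<tau> (\<sigma> i)) (\<tau> (\<sigma> j)) (\<tau> (\<sigma> k))
      = lam i * lam j * (mu (\<sigma> i) * mu (\<sigma> j) * c'' (\<tau> (\<sigma> i)) (\<tau> (\<sigma> j)) (\<tau> (\<sigma> k)))"
      by simp
    also have "\<dots> = lam i * lam j * c' (\<sigma> i) (\<sigma> j) (\<sigma> k) * mu (\<sigma> k)"
      using eq'[rule_format, OF in\<sigma>[OF that(1)] in\<sigma>[OF that(2)] in\<sigma>[OF that(3)]] by simp
    also have "\<dots> = c i j k * lam k * mu (\<sigma> k)"
      using eq that by simp
    finally show ?thesis by simp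
  qed
  then show ?thesis
    unfolding nice_equiv_def using bij_betw_trans[OF \<sigma> \<tau>] lam mu in\<sigma>
    by (intro exI[of _ "\<tau> \<circ> \<sigma>"] exI[of _ "\<lambda>i. lam i * mu (\<sigma> i)"]) auto
qed

lemma balanced_nice_equiv:
  assumes "nice_equiv n c c'" and "\<exists>g. balanced n c' g"
  shows "\<exists>g. balanced n c g"
proof -
  obtain \<sigma> lam where \<sigma>: "bij_betw \<sigma> {1..n} {1..n}" and lam: "\<forall>i\<in>{1..n}. lam i \<noteq> (0::real)"
    and eq: "\<forall>i\<in>{1..n}. \<forall>j\<in>{1..n}. \<forall>k\<in>{1..n}. lam i * lam j * c' (\<sigma> i) (\<sigma> j) (\<sigma> k) = c i j k * lam k"
    using assms unfolding nice_equiv_def by blast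
  obtain g where g: "balanced n c' g" using assms(2) by blast
  \<comment> \<open>The pullback of \<open>g\<close> under the isomorphism; the Ricci weights are
    invariant under it because the factors \<open>lam\<close> cancel.\<close>
  define h where "h i = (lam i)\<^sup>2 * g (\<sigma> i)" for i
  have in\<sigma>: "\<sigma> i \<in> {1..n}" if "i \<in> {1..n}" for i
    using \<sigma> that by (blast dest: bij_betwE)
  have gnz: "g i \<noteq> 0" if "i \<in> {1..n}" for i
    using g that by (auto simp: balanced_def diag_metric_def)
  have y: "ricci_weight c h i j k = ricci_weight c' g (\<sigma> i) (\<sigma> j) (\<sigma> k)"
    if "i \<in> {1..n}" "j \<in> {1..n}" "k \<in> {1..n}" for i j k
  proof -
    have "c i j k = lam i * lam j * c' (\<sigma> i) (\<sigma> j) (\<sigma> k) / lam k"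
      using eq lam that by (simp add: field_simps)
    show ?thesis
      unfolding ricci_weight_def h_def \<open>c i j k = _\<close>
      using gnz[OF in\<sigma>[OF that(1)]] gnz[OF in\<sigma>[OF that(2)]] lam that
      by (simp add: field_simps power2_eq_square)
  qed
  have "balance n c h v = balance n c' g (\<sigma> v)" if "v \<in> {1..n}" for v
  proof -
    have "balance n c h v = (\<Sum>i\<in>{1..n}. \<Sum>m\<in>{1..n}. ricci_weight c' g (\<sigma> i) (\<sigma> m) (\<sigma> v)
        - 2 * ricci_weight c' g (\<sigma> v) (\<sigma> i) (\<sigma> m))"
      unfolding balance_def using y that by (intro sum.cong refl) auto
    also have "\<dots> = (\<Sum>i\<in>{1..n}. \<Sum>m\<in>{1..n}. ricci_weight c' g (\<sigma> i) m (\<sigma> v)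
        - 2 * ricci_weight c' g (\<sigma> v) (\<sigma> i) m)"
      by (intro sum.cong refl sum.reindex_bij_betw[OF \<sigma>, of "\<lambda>m. ricci_weight c' g _ m (\<sigma> v) - 2 * ricci_weight c' g (\<sigma> v) _ m"])
    also have "\<dots> = balance n c' g (\<sigma> v)"
      unfolding balance_def by (rule sum.reindex_bij_betw[OF \<sigma>])
    finally show ?thesis .
  qed
  then have "balanced n c h"
    using g in\<sigma> lam gnz by (auto simp: balanced_def diag_metric_def h_def)
  then show ?thesis by blast
qed

definition relabel :: "(nat \<Rightarrow> nat) \<Rightarrow> (nat \<Rightarrow> nat \<Rightarrow> nat \<Rightarrow> real) \<Rightarrow> nat \<Rightarrow> nat \<Rightarrow> nat \<Rightarrow> real" where
  "relabel s c i j k = c (s i) (s j) (s k)"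

lemma nice_equiv_relabel:
  assumes s: "s permutes {1..n}"
  shows "nice_equiv n c (relabel s c)"
proof (rule nice_equiv_sym)
  show "nice_equiv n (relabel s c) c"
    unfolding nice_equiv_def relabel_def
    using permutes_imp_bij[OF s] by (intro exI[of _ s] exI[of _ "\<lambda>_. 1"]) simp
qed

lemma nice_alg_relabel:
  assumes c: "nice_alg n c" and s: "s permutes {1..n}"
  shows "nice_alg n (relabel s c)"
proof -
  let ?d = "relabel s c"
  have "i \<in> {1..n} \<and> j \<in> {1..n} \<and> k \<in> {1..n}" if "?d i j k \<noteq> 0" for i j k
    using nice_alg_supported[OF c that[unfolded relabel_def]] permutes_in_image[OF s] by blast
  moreover have "?d i j k = - ?d j i k" for i j k
    unfolding relabel_def by (rule nice_alg_antisym[OF c])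
  moreover have "(\<Sum>l\<in>{1..n}. ?d j k l * ?d i l m + ?d k i l * ?d j l m + ?d i j l * ?d k l m) = 0" for i j k m
    unfolding relabel_def
    using sum.reindex_bij_betw[OF permutes_imp_bij[OF s], of "\<lambda>l. c (s j) (s k) l * c (s i) l (s m)
        + c (s k) (s i) l * c (s j) l (s m) + c (s i) (s j) l * c (s k) l (s m)"]
      nice_alg_jacobi[OF c, of "s j" "s k" "s i" "s m"] by simp
  moreover have "k = k'" if "?d i j k \<noteq> 0" "?d i j k' \<noteq> 0" for i j k k'
    using nice_alg_target_unique[OF c] that permutes_inj[OF s] unfolding relabel_def by (metis injD)
  moreover have "j = j'" if "?d i j k \<noteq> 0" "?d i j' k \<noteq> 0" for i j j' k
    using nice_alg_source_unique[OF c] that permutes_inj[OF s] unfolding relabel_def by (metis injD)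
  ultimately show ?thesis
    unfolding nice_alg_def is_lie_algebra_def supported_def by blast
qed

section \<open>Ordering the basis\<close>

primrec has_chain :: "(nat \<Rightarrow> nat \<Rightarrow> nat \<Rightarrow> real) \<Rightarrow> nat \<Rightarrow> nat \<Rightarrow> bool" where
  "has_chain c 0 i = True"
| "has_chain c (Suc m) i = (\<exists>j k. c j i k \<noteq> 0 \<and> has_chain c m k)"

text \<open>Niceness prevents cancellation: bracketing with a basis vector sends a multiple of one
  basis vector to a multiple of a single other one. A chain of nonzero brackets is therefore a
  nonzero iterated bracket, which bounds its length in a nilpotent algebra.\<close>

lemma has_chain_imp_foldr_br:
  assumes c: "nice_alg n c" and "has_chain c m i" "i \<in> {1..n}" "a \<noteq> 0"
  shows "\<exists>xs. length xs = m \<and> foldr (br n c) xs (\<lambda>k. if k = i then a else 0) \<noteq> (\<lambda>_. 0)"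
  using assms(2-)
proof (induction m arbitrary: i a)
  case 0
  then show ?case by (auto simp: fun_eq_iff)
next
  case (Suc m)
  then obtain j k where jk: "c j i k \<noteq> 0" "has_chain c m k" by auto
  have dom: "j \<in> {1..n}" "k \<in> {1..n}"
    using nice_alg_supported[OF c jk(1)] by auto
  define e where "e = (\<lambda>l. if l = j then (1::real) else 0)"
  have "br n c e (\<lambda>k. if k = i then a else 0) l = (if l = k then a * c j i k else 0)" for l
  proof -
    have "br n c e (\<lambda>k. if k = i then a else 0) l
      = (\<Sum>p\<in>{1..n}. \<Sum>q\<in>{1..n}. if p = j then (if q = i then a * c j i l else 0) else 0)"
      unfolding br_def e_def by (intro sum.cong refl) auto
    also have "\<dots> = (\<Sum>p\<in>{1..n}. if p = j then (\<Sum>q\<in>{1..n}. if q = i then a * c j i l else 0) else 0)"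
      by (rule sum.cong) auto
    also have "\<dots> = a * c j i l"
      using dom Suc.prems(2) by (simp add: sum.delta)
    finally show ?thesis
      using nice_alg_target_unique[OF c jk(1), of l] by auto
  qed
  then have b: "br n c e (\<lambda>k. if k = i then a else 0) = (\<lambda>l. if l = k then a * c j i k else 0)"
    by auto
  obtain xs where "length xs = m" "foldr (br n c) xs (\<lambda>l. if l = k then a * c j i k else 0) \<noteq> (\<lambda>_. 0)"
    using Suc.IH[OF jk(2) dom(2), of "a * c j i k"] jk(1) Suc.prems(3) by auto
  then show ?case
    by (intro exI[of _ "xs @ [e]"]) (simp add: b)
qed

text \<open>The length of chains starting at a node drops along every bracket. The rank is this
  length counted backwards from the nilpotency bound \<open>m\<close>.\<close>

lemma nice_nilpotent_graded:
  assumes "nice_nilpotent n c"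
  shows "\<exists>r. graded_by r c"
proof -
  have c: "nice_alg n c" by (rule nice_nilpotent_imp_nice_alg[OF assms])
  obtain m where m: "\<And>xs y. length xs = m \<Longrightarrow> foldr (br n c) xs y = (\<lambda>_. 0)"
    using assms unfolding nice_nilpotent_def nilpotent_la_def by blast
  have none: "\<not> has_chain c m i" if "i \<in> {1..n}" for i
    using has_chain_imp_foldr_br[OF c _ that, of m 1] m by auto
  define h where "h i = (LEAST m. \<not> has_chain c m i)" for i
  have "m - h i < m - h k" if "c j i k \<noteq> 0" for i j k
  proof -
    have dom: "i \<in> {1..n}" "k \<in> {1..n}"
      using nice_alg_supported[OF c that] by auto
    have "\<not> has_chain c (h i) i"
      unfolding h_def by (rule LeastI[of _ m]) (rule none[OF dom(1)])
    then obtain h' where h': "h i = Suc h'" by (cases "h i") auto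
    with \<open>\<not> has_chain c (h i) i\<close> that have "\<not> has_chain c h' k" by auto
    then have "h k \<le> h'" unfolding h_def by (rule Least_le)
    \<comment> \<open>Needed because of truncated subtraction: without this bound
      \<open>m - h i < m - h k\<close> would not follow from \<open>h k < h i\<close>.\<close>
    moreover have "h i \<le> m" unfolding h_def by (rule Least_le) (rule none[OF dom(1)])
    ultimately show ?thesis using h' by linarith
  qed
  moreover have "c j i k \<noteq> 0" if "c i j k \<noteq> 0" for i j k
    using nice_alg_antisym[OF c, of i j k] that by simp
  ultimately have "graded_by (\<lambda>i. m - h i) c"
    unfolding graded_by_def by blast
  then show ?thesis by blast
qed

text \<open>Being the identity outside the list, a permutation of the first \<open>n\<close> nodes
  extends to the nodes that are added later.\<close>

definition list_perm :: "nat list \<Rightarrow> nat \<Rightarrow> nat" where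
  "list_perm xs i = (if i \<in> {1..length xs} then xs ! (i - 1) else i)"

lemma list_perm_permutes:
  assumes "distinct xs" "set xs = {1..length xs}"
  shows "list_perm xs permutes {1..length xs}"
proof (rule bij_imp_permutes)
  have "bij_betw (\<lambda>i. i - 1) {1..length xs} {..<length xs}"
    by (rule bij_betw_byWitness[of _ Suc]) auto
  then have "bij_betw ((!) xs \<circ> (\<lambda>i. i - 1)) {1..length xs} {1..length xs}"
    using bij_betw_nth[OF assms(1) refl] assms(2) by (metis bij_betw_trans)
  then show "bij_betw (list_perm xs) {1..length xs} {1..length xs}"
    by (rule bij_betw_cong[THEN iffD1, rotated]) (auto simp: list_perm_def)
qed (auto simp: list_perm_def)

lemma ex_sorted_alg:
  assumes c: "nice_alg n c" and r: "graded_by r c"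
  shows "\<exists>c'. nice_equiv n c c' \<and> nice_alg n c' \<and> sorted_alg c'"
proof -
  define xs where "xs = sort_key r [1..<Suc n]"
  have xs: "distinct xs" "length xs = n" "set xs = {1..length xs}" "sorted (map r xs)"
    by (auto simp: xs_def)
  define s where "s = list_perm xs"
  have s: "s permutes {1..n}"
    using list_perm_permutes[OF xs(1) xs(3)] by (simp add: s_def xs(2))
  let ?c' = "relabel s c"
  have c': "nice_alg n ?c'" by (rule nice_alg_relabel[OF c s])
  have mono: "i < k" if "r (s i) < r (s k)" "i \<in> {1..n}" "k \<in> {1..n}" for i k
  proof (rule ccontr)
    assume "\<not> i < k"
    then have "k - 1 \<le> i - 1" "i - 1 < length xs"
      using that xs(2) by auto
    then have "r (s k) \<le> r (s i)"
      using sorted_nth_mono[OF xs(4), of "k - 1" "i - 1"] that xs(2) by (auto simp: s_def list_perm_def)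
    with that show False by simp
  qed
  have "i < k \<and> j < k" if "?c' i j k \<noteq> 0" for i j k
  proof -
    have "c (s i) (s j) (s k) \<noteq> 0" using that by (simp add: relabel_def)
    with r have "r (s i) < r (s k)" "r (s j) < r (s k)" unfolding graded_by_def by blast+
    then show ?thesis using mono nice_alg_supported[OF c' that] by blast
  qed
  then have "sorted_alg ?c'" unfolding sorted_alg_def by blast
  moreover have "nice_equiv n c ?c'"
    by (rule nice_equiv_relabel[OF s])
  ultimately show ?thesis using c' by blast
qed

section \<open>Diagrams and the Ricci-flat equations as a linear system\<close>

type_synonym diagram = "(nat \<times> nat \<times> nat) list"

text \<open>The algebra keeps its full dimension throughout; only the target is bounded by
  \<open>n\<close>, since in a sorted algebra this bounds the sources too. The condition
  \<open>i < j\<close> selects one of the two orientations of a bracket.\<close>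

definition brackets :: "nat \<Rightarrow> (nat \<Rightarrow> nat \<Rightarrow> nat \<Rightarrow> real) \<Rightarrow> (nat \<times> nat \<times> nat) set" where
  "brackets n c = {(i, j, k). i < j \<and> k \<le> n \<and> c i j k \<noteq> 0}"

text \<open>Both orientations of a bracket have the same weight, whence the factor 2. Each bracket
  then counts +1 at its target and -1 at each of its two sources.\<close>

lemma balance_eq_sum_brackets:
  assumes supp: "supported n c" and anti: "\<And>i j k. c i j k = - c j i k" and v: "v \<in> {1..n}"
  shows "balance n c g v = 2 * (\<Sum>(i, j, k)\<in>brackets n c.
    ricci_weight c g i j k * (of_bool (k = v) - of_bool (i = v) - of_bool (j = v)))"
proof -
  let ?N = "{1..n}"
  have dom: "i \<in> ?N \<and> j \<in> ?N \<and> k \<in> ?N" if "c i j k \<noteq> 0" for i j k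
    using supp that unfolding supported_def by blast
  define f where "f i j k = ricci_weight c g i j k * (of_bool (k = v) - of_bool (i = v) - of_bool (j = v))" for i j k
  have sym: "ricci_weight c g i j k = ricci_weight c g j i k" for i j k
    using anti[of i j k] by (simp add: ricci_weight_def mult.commute)
  have "(\<Sum>i\<in>?N. \<Sum>j\<in>?N. \<Sum>k\<in>?N. ricci_weight c g i j k * of_bool (k = v)) = (\<Sum>i\<in>?N. \<Sum>j\<in>?N. ricci_weight c g i j v)"
    using v by (intro sum.cong refl) (simp add: of_bool_def if_distrib sum.delta cong: if_cong)
  moreover have "(\<Sum>i\<in>?N. \<Sum>j\<in>?N. \<Sum>k\<in>?N. ricci_weight c g i j k * of_bool (i = v)) = (\<Sum>j\<in>?N. \<Sum>k\<in>?N. ricci_weight c g v j k)"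
  proof -
    have "(\<Sum>j\<in>?N. \<Sum>k\<in>?N. ricci_weight c g i j k * of_bool (i = v)) = (if i = v then (\<Sum>j\<in>?N. \<Sum>k\<in>?N. ricci_weight c g v j k) else 0)" for i
      by auto
    then show ?thesis using v by (simp add: sum.delta)
  qed
  moreover have "(\<Sum>i\<in>?N. \<Sum>j\<in>?N. \<Sum>k\<in>?N. ricci_weight c g i j k * of_bool (j = v)) = (\<Sum>i\<in>?N. \<Sum>k\<in>?N. ricci_weight c g i v k)"
  proof (rule sum.cong[OF refl])
    fix i
    have "(\<Sum>k\<in>?N. ricci_weight c g i j k * of_bool (j = v)) = (if j = v then (\<Sum>k\<in>?N. ricci_weight c g i v k) else 0)" for j
      by auto
    then show "(\<Sum>j\<in>?N. \<Sum>k\<in>?N. ricci_weight c g i j k * of_bool (j = v)) = (\<Sum>k\<in>?N. ricci_weight c g i v k)"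
      using v by (simp add: sum.delta)
  qed
  ultimately have "balance n c g v = (\<Sum>i\<in>?N. \<Sum>j\<in>?N. \<Sum>k\<in>?N. f i j k)"
    unfolding balance_def f_def
    by (simp add: algebra_simps sum.distrib sum_subtractf sum_distrib_left[symmetric] sym[of _ v])
  also have "\<dots> = (\<Sum>(i, j, k)\<in>?N \<times> ?N \<times> ?N. f i j k)"
    by (simp add: sum.cartesian_product)
  also have "\<dots> = (\<Sum>(i, j, k)\<in>{(i, j, k). k \<le> n \<and> c i j k \<noteq> 0}. f i j k)"
    by (rule sum.mono_neutral_right) (use dom in \<open>auto simp: f_def ricci_weight_def\<close>)
  also have "{(i, j, k). k \<le> n \<and> c i j k \<noteq> 0} = brackets n c \<union> {(i, j, k). j < i \<and> k \<le> n \<and> c i j k \<noteq> 0}"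
    (is "_ = _ \<union> ?B")
  proof -
    have "c i i k = 0" for i k using anti[of i i k] by simp
    then show ?thesis by (auto simp: brackets_def) (metis nat_neq_iff)
  qed
  also have "(\<Sum>(i, j, k)\<in>brackets n c \<union> ?B. f i j k) = (\<Sum>(i, j, k)\<in>brackets n c. f i j k) + (\<Sum>(i, j, k)\<in>?B. f i j k)"
  proof (rule sum.union_disjoint)
    have "brackets n c \<union> ?B \<subseteq> ?N \<times> ?N \<times> ?N"
      using dom by (fastforce simp: brackets_def)
    then show "finite (brackets n c)" "finite ?B"
      by (meson finite_Un finite_SigmaI finite_atLeastAtMost finite_subset)+
  qed (auto simp: brackets_def)
  also have "(\<Sum>(i, j, k)\<in>?B. f i j k) = (\<Sum>(i, j, k)\<in>brackets n c. f i j k)"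
  proof (rule sum.reindex_bij_witness[of _ "\<lambda>(i, j, k). (j, i, k)" "\<lambda>(i, j, k). (j, i, k)"])
    have "c j i k \<noteq> 0" if "c i j k \<noteq> 0" for i j k
      using anti[of i j k] that by simp
    then show "(case a of (i, j, k) \<Rightarrow> (j, i, k)) \<in> brackets n c" if "a \<in> ?B" for a
      using that by (auto simp: brackets_def)
    then show "(case a of (i, j, k) \<Rightarrow> (j, i, k)) \<in> ?B" if "a \<in> brackets n c" for a
      using that \<open>\<And>i j k. c i j k \<noteq> 0 \<Longrightarrow> c j i k \<noteq> 0\<close> by (auto simp: brackets_def)
  qed (auto simp: f_def sym)
  finally show ?thesis by (simp add: f_def)
qed

text \<open>This is the combination of the node equations with coefficients \<open>w\<close>, summed
  over brackets instead of nodes. The coefficient \<open>w k - w i - w j\<close> measures how far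
  the diagonal map with entries \<open>w\<close> is from being a derivation on that bracket.\<close>

lemma weighted_balance:
  assumes c: "nice_alg n c" and g: "balanced n c g"
  shows "(\<Sum>(i, j, k)\<in>brackets n c. ricci_weight c g i j k * (w k - w i - w j)) = 0"
proof -
  have dom: "i \<in> {1..n} \<and> j \<in> {1..n} \<and> k \<in> {1..n}" if "(i, j, k) \<in> brackets n c" for i j k
    using that nice_alg_supported[OF c] by (auto simp: brackets_def)
  have pick: "(\<Sum>v\<in>{1..n}. w v * of_bool (i = v)) = w i" if "i \<in> {1..n}" for i
    using that by (simp add: of_bool_def if_distrib sum.delta cong: if_cong)
  have "0 = (\<Sum>v\<in>{1..n}. w v * (balance n c g v / 2))"
    using g by (simp add: balanced_def)
  also have "\<dots> = (\<Sum>v\<in>{1..n}. \<Sum>(i, j, k)\<in>brackets n c.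
      ricci_weight c g i j k * (w v * of_bool (k = v) - w v * of_bool (i = v) - w v * of_bool (j = v)))"
    by (intro sum.cong refl)
      (simp add: balance_eq_sum_brackets[OF nice_alg_imp_supported[OF c] nice_alg_antisym[OF c]] sum_distrib_left case_prod_unfold algebra_simps)
  also have "\<dots> = (\<Sum>(i, j, k)\<in>brackets n c. \<Sum>v\<in>{1..n}.
      ricci_weight c g i j k * (w v * of_bool (k = v) - w v * of_bool (i = v) - w v * of_bool (j = v)))"
    by (subst sum.swap) (simp add: case_prod_unfold)
  also have "\<dots> = (\<Sum>(i, j, k)\<in>brackets n c. ricci_weight c g i j k * (w k - w i - w j))"
    by (intro sum.cong refl)
      (auto simp: sum_distrib_left[symmetric] sum_subtractf pick dest!: dom)
  finally show ?thesis by simp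
qed

section \<open>Extending a diagram by one node\<close>

definition ordpair :: "nat \<Rightarrow> nat \<Rightarrow> nat \<times> nat" where
  "ordpair a b = (if a < b then (a, b) else (b, a))"

definition targets :: "diagram \<Rightarrow> nat \<Rightarrow> nat \<Rightarrow> nat list" where
  "targets R i j = map (\<lambda>(a, b, q). q) (filter (\<lambda>(a, b, q). (a, b) = ordpair i j) R)"

text \<open>For a nonzero term \<open>[[i, j], l]\<close> of a Jacobi identity, these are the pairs
  whose bracket into the new node would make one of the other two terms nonzero.\<close>

definition completions :: "diagram \<Rightarrow> nat \<Rightarrow> nat \<Rightarrow> nat \<Rightarrow> (nat \<times> nat) list" where
  "completions R i j l = map (\<lambda>q. ordpair q i) (targets R j l) @ map (\<lambda>q. ordpair q j) (targets R i l)"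

text \<open>If the pair \<open>{a, b}\<close> brackets into a new last node, then every bracket \<open>[i, j]\<close> that is a multiple
  of \<open>a\<close> gives a nonzero term \<open>[[i, j], b]\<close> of a Jacobi identity, which one of the pairs in the
  corresponding list of completions has to cancel.\<close>

definition requirements :: "diagram \<Rightarrow> nat \<Rightarrow> nat \<Rightarrow> (nat \<times> nat) list list" where
  "requirements R a b =
     map (\<lambda>(i, j, p). completions R i j b) (filter (\<lambda>(i, j, p). p = a \<and> b \<noteq> i \<and> b \<noteq> j) R) @
     map (\<lambda>(i, j, p). completions R i j a) (filter (\<lambda>(i, j, p). p = b \<and> a \<noteq> i \<and> a \<noteq> j) R)"

text \<open>A pair that already has a target cannot acquire another one, and a requirement without
  completions cannot be met. Discarding such pairs before matchings are formed limits the
  exponential step; the requirements are stored with the pair to be computed once.\<close>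

definition candidates :: "diagram \<Rightarrow> nat \<Rightarrow> ((nat \<times> nat) \<times> (nat \<times> nat) list list) list" where
  "candidates R n = filter (\<lambda>(p, rs). list_all (\<lambda>al. al \<noteq> []) rs)
     (map (\<lambda>p. (p, requirements R (fst p) (snd p)))
       (filter (\<lambda>(i, j). targets R i j = [])
         (concat (map (\<lambda>j. map (\<lambda>i. (i, j)) [1..<j]) [1..<Suc n]))))"

definition disjoint_pairs :: "nat \<times> nat \<Rightarrow> nat \<times> nat \<Rightarrow> bool" where
  "disjoint_pairs p q \<longleftrightarrow> fst p \<noteq> fst q \<and> fst p \<noteq> snd q \<and> snd p \<noteq> fst q \<and> snd p \<noteq> snd q"

text \<open>Receiving the smaller matchings as the argument \<open>M\<close> leaves a single
  recursive call in \<open>matchings\<close>, which matters for evaluation.\<close>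

definition extend_matchings ::
    "(nat \<times> nat) \<times> 'r \<Rightarrow> ((nat \<times> nat) \<times> 'r) list list \<Rightarrow> ((nat \<times> nat) \<times> 'r) list list" where
  "extend_matchings c M = M @ map ((#) c) (filter (list_all (\<lambda>d. disjoint_pairs (fst c) (fst d))) M)"

primrec matchings :: "((nat \<times> nat) \<times> 'r) list \<Rightarrow> ((nat \<times> nat) \<times> 'r) list list" where
  "matchings [] = [[]]"
| "matchings (c # cs) = extend_matchings c (matchings cs)"

text \<open>A necessary condition on supports: it asks that a nonzero Jacobi term has a nonzero
  partner, not that the two cancel.\<close>

definition closed_matching :: "((nat \<times> nat) \<times> (nat \<times> nat) list list) list \<Rightarrow> bool" where
  "closed_matching M \<longleftrightarrow> list_all (\<lambda>(p, rs). list_all (list_ex (\<lambda>q. list_ex (\<lambda>d. fst d = q) M)) rs) M"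

definition extensions :: "diagram \<Rightarrow> nat \<Rightarrow> diagram list" where
  "extensions R n = map (\<lambda>M. R @ map (\<lambda>((i, j), rs). (i, j, Suc n)) M)
     (filter closed_matching (matchings (candidates R n)))"

text \<open>The brackets of an actual algebra are given by a predicate on the candidates, so it is
  enough that \<open>matchings\<close> contains all filtered lists, in the order of the
  candidates.\<close>

lemma filter_in_matchings:
  assumes "distinct (map fst cs)"
    and "\<And>c d. c \<in> set cs \<Longrightarrow> d \<in> set cs \<Longrightarrow> P c \<Longrightarrow> P d \<Longrightarrow> fst c \<noteq> fst d \<Longrightarrow> disjoint_pairs (fst c) (fst d)"
  shows "filter P cs \<in> set (matchings cs)"
  using assms
proof (induction cs)
  case (Cons c cs)
  then have IH: "filter P cs \<in> set (matchings cs)" by simp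
  have "disjoint_pairs (fst c) (fst d)" if "P c" "d \<in> set (filter P cs)" for d
    using Cons.prems(1) that by (intro Cons.prems(2)) force+
  with IH show ?case
    by (auto simp: extend_matchings_def list_all_iff)
qed simp

context
  fixes N n :: nat and c :: "nat \<Rightarrow> nat \<Rightarrow> nat \<Rightarrow> real" and R :: diagram
  assumes c: "nice_alg N c" and sorted: "sorted_alg c" and R: "brackets n c = set R"
begin

lemma ordpair_bracket: "ordpair i j = (a, b) \<Longrightarrow> c a b k \<noteq> 0 \<longleftrightarrow> c i j k \<noteq> 0"
  using nice_alg_antisym[OF c, of i j k] by (auto simp: ordpair_def split: if_splits)

lemma bracket_irrefl: "c i i k = 0"
  using nice_alg_antisym[OF c, of i i k] by simp

lemma in_targets_iff: "q \<in> set (targets R i j) \<longleftrightarrow> q \<le> n \<and> c i j q \<noteq> 0"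
proof -
  obtain a b where ab: "ordpair i j = (a, b)" by force
  have "q \<in> set (targets R i j) \<longleftrightarrow> (a, b, q) \<in> brackets n c"
    unfolding targets_def ab R by force
  also have "\<dots> \<longleftrightarrow> q \<le> n \<and> c a b q \<noteq> 0"
    using ab bracket_irrefl by (auto simp: brackets_def ordpair_def split: if_splits) (metis nat_neq_iff)
  finally show ?thesis using ordpair_bracket[OF ab] by simp
qed

text \<open>By target uniqueness the Jacobi identity has at most one nonzero summand of each kind,
  and a single nonzero one cannot add up to zero. Since \<open>m\<close> is the new node and the
  algebra is sorted, the intermediate node \<open>q\<close> of the partner term is an old one and is
  visible in \<open>R\<close>.\<close>

lemma completion_exists:
  assumes p: "(i, j, p) \<in> set R" and pl: "c p l m \<noteq> 0" and l: "l \<le> n" "l \<noteq> i" "l \<noteq> j"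
    and m: "m = Suc n"
  shows "\<exists>(u, v) \<in> set (completions R i j l). u < v \<and> c u v m \<noteq> 0"
proof -
  have "(i, j, p) \<in> brackets n c" using p R by simp
  then have ij: "c i j p \<noteq> 0" "i < j" by (auto simp: brackets_def)
  have "\<exists>q. c j l q * c i q m \<noteq> 0 \<or> c l i q * c j q m \<noteq> 0"
  proof (rule ccontr)
    assume "\<not> ?thesis"
    then have z: "c j l q * c i q m = 0" "c l i q * c j q m = 0" for q by auto
    have "c i j q * c l q m = c j l q * c i q m + c l i q * c j q m + c i j q * c l q m" for q
      by (simp only: z add_0_left)
    then have "(\<Sum>q\<in>{1..N}. c i j q * c l q m) = 0"
      using nice_alg_jacobi[OF c, of j l i m] by presburger
    moreover have "(\<Sum>q\<in>{1..N}. c i j q * c l q m) = (\<Sum>q\<in>{1..N}. if q = p then c i j p * c l p m else 0)"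
      by (intro sum.cong refl) (use nice_alg_target_unique[OF c ij(1)] in auto)
    moreover have "p \<in> {1..N}" using nice_alg_supported[OF c ij(1)] by simp
    ultimately have "c i j p * c l p m = 0" by simp
    then show False using ij(1) pl nice_alg_antisym[OF c, of p l m] by simp
  qed
  then consider q where "c j l q \<noteq> 0" "c i q m \<noteq> 0" | q where "c i l q \<noteq> 0" "c j q m \<noteq> 0"
    using nice_alg_antisym[OF c, of l i] by force
  then show ?thesis
  proof cases
    case 1
    then have "q \<le> n" using sorted m unfolding sorted_alg_def by fastforce
    with 1 have "ordpair q i \<in> set (completions R i j l)"
      by (auto simp: completions_def in_targets_iff)
    moreover obtain u v where uv: "ordpair q i = (u, v)" by force
    moreover have "c u v m \<noteq> 0"
      using ordpair_bracket[OF uv] 1 nice_alg_antisym[OF c, of i q m] by simp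
    moreover have "u < v"
      using uv calculation(3) bracket_irrefl by (auto simp: ordpair_def split: if_splits) (metis nat_neq_iff)
    ultimately show ?thesis by force
  next
    case 2
    then have "q \<le> n" using sorted m unfolding sorted_alg_def by fastforce
    with 2 have "ordpair q j \<in> set (completions R i j l)"
      by (auto simp: completions_def in_targets_iff)
    moreover obtain u v where uv: "ordpair q j = (u, v)" by force
    moreover have "c u v m \<noteq> 0"
      using ordpair_bracket[OF uv] 2 nice_alg_antisym[OF c, of j q m] by simp
    moreover have "u < v"
      using uv calculation(3) bracket_irrefl by (auto simp: ordpair_def split: if_splits) (metis nat_neq_iff)
    ultimately show ?thesis by force
  qed
qed

lemma requirement_met:
  assumes ab: "c a b (Suc n) \<noteq> 0" and al: "al \<in> set (requirements R a b)"
  shows "\<exists>(u, v) \<in> set al. u < v \<and> c u v (Suc n) \<noteq> 0"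
proof -
  have le: "a \<le> n" "b \<le> n" using sorted ab unfolding sorted_alg_def by fastforce+
  have ba: "c b a (Suc n) \<noteq> 0" using ab nice_alg_antisym[OF c, of a b "Suc n"] by simp
  consider i j where "(i, j, a) \<in> set R" "b \<noteq> i" "b \<noteq> j" "al = completions R i j b"
    | i j where "(i, j, b) \<in> set R" "a \<noteq> i" "a \<noteq> j" "al = completions R i j a"
    using al by (auto simp: requirements_def)
  then show ?thesis
    by cases (use completion_exists ab ba le in blast)+
qed

lemma candidate_iff:
  assumes "c a b (Suc n) \<noteq> 0" "a < b"
  shows "((a, b), requirements R a b) \<in> set (candidates R n)"
proof -
  have "1 \<le> a" using nice_alg_supported[OF c assms(1)] by simp
  moreover have "b \<le> n" using sorted assms(1) unfolding sorted_alg_def by fastforce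
  moreover have "targets R a b = []"
  proof -
    have "q \<notin> set (targets R a b)" for q
      using in_targets_iff[of q a b] nice_alg_target_unique[OF c assms(1), of q] by auto
    then show ?thesis by (metis list.set_intros(1) neq_Nil_conv)
  qed
  moreover have "al \<noteq> []" if "al \<in> set (requirements R a b)" for al
    using requirement_met[OF assms(1) that] by auto
  moreover define L where "L = concat (map (\<lambda>j. map (\<lambda>i. (i, j)) [1..<j]) [1..<Suc n])"
  moreover have "(a, b) \<in> set L"
    using assms(2) calculation(1,2) by (fastforce simp: L_def)
  ultimately show ?thesis
    unfolding candidates_def L_def[symmetric] by (auto simp: list_all_iff)
qed

lemma in_candidatesD:
  "((a, b), rs) \<in> set (candidates R n) \<Longrightarrow> a < b \<and> rs = requirements R a b"
  unfolding candidates_def by auto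

lemma distinct_candidates: "distinct (map fst (candidates R n))"
proof -
  have d: "distinct (concat (map (\<lambda>j. map (\<lambda>i. (i, j)) [1..<j]) [1..<Suc n]))"
    by (rule distinct_concat) (auto simp: distinct_map inj_on_def dest!: map_eq_imp_length_eq)
  show ?thesis
    unfolding candidates_def using d
    by (simp add: distinct_map inj_on_def filter_map comp_def)
qed

text \<open>Completeness of the enumeration step. The true brackets into the new node are pairwise
  disjoint by source uniqueness and satisfy the requirements by the Jacobi identities, so they occur
  among the matchings that were generated.\<close>

lemma brackets_Suc_in_extensions:
  "\<exists>D\<in>set (extensions R n). brackets (Suc n) c = set D"
proof -
  define P where "P d = (c (fst (fst d)) (snd (fst d)) (Suc n) \<noteq> 0)" for d :: "(nat \<times> nat) \<times> (nat \<times> nat) list list"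
  define M where "M = filter P (candidates R n)"
  have M: "((a, b), rs) \<in> set M \<longleftrightarrow> a < b \<and> c a b (Suc n) \<noteq> 0 \<and> rs = requirements R a b" for a b rs
    using candidate_iff[of a b] in_candidatesD[of a b rs] by (auto simp: M_def P_def)
  have "disjoint_pairs (fst d) (fst e)" if "d \<in> set (candidates R n)" "e \<in> set (candidates R n)" "P d" "P e" "fst d \<noteq> fst e" for d e
  proof -
    obtain a b rs a' b' rs' where de: "d = ((a, b), rs)" "e = ((a', b'), rs')" by (metis prod.exhaust)
    have lt: "a < b" "a' < b'" using that(1,2) in_candidatesD unfolding de by blast+
    have nz: "c a b (Suc n) \<noteq> 0" "c a' b' (Suc n) \<noteq> 0" "c b a (Suc n) \<noteq> 0" "c b' a' (Suc n) \<noteq> 0"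
      using that(3,4) nice_alg_antisym[OF c, of a b] nice_alg_antisym[OF c, of a' b'] by (auto simp: P_def de)
    note u = nice_alg_source_unique[OF c]
    have "b = b'" if "a = a'" using u[OF nz(1)] nz(2) unfolding that by blast
    moreover have "a = a'" if "b = b'" using u[OF nz(3)] nz(4) unfolding that by blast
    moreover have "b = a'" if "a = b'" using u[OF nz(1)] nz(4) unfolding that by blast
    moreover have "a = b'" if "b = a'" using u[OF nz(3)] nz(2) unfolding that by blast
    ultimately show ?thesis
      using lt that(5) unfolding disjoint_pairs_def de by fastforce
  qed
  then have "M \<in> set (matchings (candidates R n))"
    unfolding M_def by (intro filter_in_matchings distinct_candidates)
  moreover have "closed_matching M"
    unfolding closed_matching_def list_all_iff list_ex_iff
  proof (clarsimp)
    fix a b rs al assume "((a, b), rs) \<in> set M" "al \<in> set rs"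
    then obtain u v where "(u, v) \<in> set al" "u < v" "c u v (Suc n) \<noteq> 0"
      using requirement_met[of a b al] M by auto
    then show "\<exists>q\<in>set al. \<exists>d\<in>set M. fst d = q"
      using M[of u v "requirements R u v"] by force
  qed
  ultimately have "R @ map (\<lambda>((i, j), rs). (i, j, Suc n)) M \<in> set (extensions R n)"
    unfolding extensions_def by auto
  moreover have "brackets (Suc n) c = set (R @ map (\<lambda>((i, j), rs). (i, j, Suc n)) M)"
  proof -
    have "brackets (Suc n) c = brackets n c \<union> {(a, b, Suc n) |a b. a < b \<and> c a b (Suc n) \<noteq> 0}"
      by (auto simp: brackets_def le_Suc_eq)
    moreover have "{(a, b, Suc n) |a b. a < b \<and> c a b (Suc n) \<noteq> 0} = set (map (\<lambda>((i, j), rs). (i, j, Suc n)) M)"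
      (is "?A = set (map ?f M)")
    proof (intro subset_antisym subsetI)
      fix x assume "x \<in> ?A"
      then obtain a b where x: "x = (a, b, Suc n)" "a < b" "c a b (Suc n) \<noteq> 0" by blast
      then have "((a, b), requirements R a b) \<in> set M" using M by blast
      then have "?f ((a, b), requirements R a b) \<in> ?f ` set M" by (rule imageI)
      then show "x \<in> set (map ?f M)" using x(1) by simp
    next
      fix x assume "x \<in> set (map ?f M)"
      then obtain a b rs where "((a, b), rs) \<in> set M" "x = (a, b, Suc n)" by auto
      then show "x \<in> ?A" using M by blast
    qed
    ultimately show ?thesis using R by simp
  qed
  ultimately show ?thesis by blast
qed

end

section \<open>Certificates\<close>

text \<open>\<open>Q\<close> assigns to each \<open>a\<close> a block of diagrams. A certificate for a diagram either locates it in
  these blocks (\<open>Same a b\<close>, or \<open>Iso p a b\<close> up to the relabelling \<open>p\<close>), or excludes it: \<open>Lin ps ns\<close> is a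
  combination of the Ricci-flat equations at the nodes, with coefficients given by the multiplicities in
  \<open>ps\<close> minus those in \<open>ns\<close>, in which the Ricci weight of exactly one bracket survives. A node incident
  to a single bracket excludes the diagram without a certificate.\<close>

datatype certificate = Same nat nat | Iso "nat list" nat nat | Lin "nat list" "nat list"

definition image_diagram :: "nat list \<Rightarrow> diagram \<Rightarrow> diagram" where
  "image_diagram p R = map (\<lambda>(i, j, k). case ordpair (p ! (i - 1)) (p ! (j - 1)) of (a, b) \<Rightarrow> (a, b, p ! (k - 1))) R"

definition same_elements :: "diagram \<Rightarrow> diagram \<Rightarrow> bool" where
  "same_elements D E \<longleftrightarrow> list_all (\<lambda>t. t \<in> set D) E \<and> list_all (\<lambda>t. t \<in> set E) D"

text \<open>The map goes from the representative \<open>R\<close> to the diagram \<open>D\<close>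
  found. The order conditions on \<open>R\<close> are checked here because the relabelled algebra
  has to be sorted again.\<close>

definition is_isomorphism :: "nat \<Rightarrow> nat list \<Rightarrow> diagram \<Rightarrow> diagram \<Rightarrow> bool" where
  "is_isomorphism n p R D \<longleftrightarrow> length p = n \<and> distinct p \<and> list_all (\<lambda>x. 1 \<le> x \<and> x \<le> n) p
     \<and> list_all (\<lambda>(i, j, k). 0 < i \<and> i < j \<and> j < k \<and> k \<le> n) R \<and> same_elements D (image_diagram p R)"

definition is_singleton_list :: "'b list \<Rightarrow> bool" where
  "is_singleton_list xs = (case xs of [] \<Rightarrow> False | x # ys \<Rightarrow> ys = [])"

definition node_weight :: "nat list \<Rightarrow> nat list \<Rightarrow> nat \<Rightarrow> int" where
  "node_weight ps ns v = int (count_list ps v) - int (count_list ns v)"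

definition bracket_weight :: "nat list \<Rightarrow> nat list \<Rightarrow> nat \<times> nat \<times> nat \<Rightarrow> int" where
  "bracket_weight ps ns = (\<lambda>(i, j, k). node_weight ps ns k - node_weight ps ns i - node_weight ps ns j)"

definition incident :: "nat \<Rightarrow> nat \<times> nat \<times> nat \<Rightarrow> bool" where
  "incident v = (\<lambda>(i, j, k). v = i \<or> v = j \<or> v = k)"

definition has_leaf :: "diagram \<Rightarrow> bool" where
  "has_leaf D \<longleftrightarrow> list_ex (\<lambda>v. is_singleton_list (filter (incident v) D)) [1..<9]"

text \<open>\<open>Lin\<close> demands \<open>n = 8\<close> because a node equation is available
  only when all brackets at the node are known.\<close>

fun certifies :: "nat \<Rightarrow> (nat \<Rightarrow> diagram list) \<Rightarrow> diagram \<Rightarrow> certificate \<Rightarrow> bool" where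
  "certifies n Q D (Same a b) = (b < length (Q a) \<and> Q a ! b = D)"
| "certifies n Q D (Iso p a b) = (b < length (Q a) \<and> is_isomorphism n p (Q a ! b) D)"
| "certifies n Q D (Lin ps ns) = (n = 8 \<and> is_singleton_list (filter (\<lambda>t. bracket_weight ps ns t \<noteq> 0) D))"

text \<open>Certificates run parallel to the extensions in the order of generation. For the same
  reason as with \<open>Lin\<close>, leaves are discarded only in the last step.\<close>

definition check_step :: "nat \<Rightarrow> (nat \<Rightarrow> diagram list) \<Rightarrow> diagram list \<Rightarrow> certificate list list \<Rightarrow> bool" where
  "check_step n Q = list_all2 (\<lambda>R. list_all2 (certifies (Suc n) Q)
     (if n = 7 then filter (\<lambda>D. \<not> has_leaf D) (extensions R n) else extensions R n))"

section \<open>Soundness of the certificates\<close>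

lemma check_step_Nil: "check_step n Q [] []"
  by (simp add: check_step_def)

text \<open>The relabelling permutes the first \<open>n\<close> nodes and fixes the others. Brackets
  into an old node point upwards because \<open>R\<close> does; brackets into a later node still do
  because their sources are permuted below it.\<close>

lemma isomorphism_relabel:
  assumes c: "nice_alg N c" and sorted: "sorted_alg c" and n: "n \<le> N"
    and D: "brackets n c = set D" and iso: "is_isomorphism n p R D"
  shows "\<exists>c'. nice_equiv N c c' \<and> nice_alg N c' \<and> sorted_alg c' \<and> brackets n c' = set R"
proof -
  define s where "s = list_perm p"
  have p: "length p = n" "distinct p" "set p \<subseteq> {1..n}"
    using iso by (auto simp: is_isomorphism_def list_all_iff)
  have "set p = {1..length p}"
    using p by (intro card_subset_eq) (auto simp: distinct_card)
  then have sn: "s permutes {1..n}"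
    using list_perm_permutes[of p] p by (simp add: s_def)
  then have s: "s permutes {1..N}"
    by (rule permutes_subset) (use n in auto)
  have out: "s k = k" if "k > n" for k
    using that p by (simp add: s_def list_perm_def)
  have s_le: "s i \<le> n \<longleftrightarrow> i \<le> n" for i
    using permutes_in_image[OF sn, of i] out[of i] by (cases "i > n"; cases "i = 0") (auto simp: s_def list_perm_def)
  let ?c' = "relabel s c"
  have nz: "?c' i j k \<noteq> 0 \<longleftrightarrow> c (s i) (s j) (s k) \<noteq> 0" for i j k
    by (simp add: relabel_def)
  have c': "nice_alg N ?c'" by (rule nice_alg_relabel[OF c s])
  have wf: "0 < i \<and> i < j \<and> j < k \<and> k \<le> n" if "(i, j, k) \<in> set R" for i j k
    using iso that by (auto simp: is_isomorphism_def list_all_iff)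
  have imD: "set (image_diagram p R) = set D"
    using iso by (auto simp: is_isomorphism_def same_elements_def list_all_iff)
  have im: "set (image_diagram p R) = (\<lambda>(i, j, k). case ordpair (s i) (s j) of (a, b) \<Rightarrow> (a, b, s k)) ` set R"
    unfolding image_diagram_def set_map
    by (intro image_cong refl) (use wf p in \<open>fastforce simp: s_def list_perm_def\<close>)
  have sub: "(i, j, k) \<in> set R" if "i < j" "k \<le> n" "c (s i) (s j) (s k) \<noteq> 0" for i j k
  proof -
    obtain a b where ab: "ordpair (s i) (s j) = (a, b)" by force
    have "s i \<noteq> s j" using that(1) permutes_inj[OF s] by (metis injD less_irrefl)
    then have "a < b" using ab by (auto simp: ordpair_def split: if_splits)
    moreover have "c a b (s k) \<noteq> 0"
      using that(3) ab nice_alg_antisym[OF c, of "s i" "s j" "s k"] by (auto simp: ordpair_def split: if_splits)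
    ultimately have "(a, b, s k) \<in> brackets n c"
      using that(2) s_le by (simp add: brackets_def)
    then obtain i' j' k' where t: "(i', j', k') \<in> set R" "ordpair (s i') (s j') = (a, b)" "s k' = s k"
      unfolding D imD[symmetric] im by (auto split: prod.splits)
    have "k' = k" using t(3) permutes_inj[OF s] by (meson injD)
    \<comment> \<open>Comparison of unordered pairs, since the permutation may reverse the order of
      the two sources.\<close>
    moreover have "{s i', s j'} = {s i, s j}"
      using t(2) ab by (auto simp: ordpair_def split: if_splits)
    then have "{i', j'} = {i, j}"
      using inj_image_eq_iff[OF permutes_inj[OF s], of "{i', j'}" "{i, j}"] by simp
    then have "i' = i \<and> j' = j"
      using wf[OF t(1)] that(1) by (auto simp: doubleton_eq_iff)
    ultimately show ?thesis using t(1) by simp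
  qed
  have "i < k \<and> j < k" if "?c' i j k \<noteq> 0" for i j k
  proof (cases "k \<le> n")
    case True
    have "i \<noteq> j" using that nice_alg_antisym[OF c', of i i k] by auto
    moreover have "?c' j i k \<noteq> 0" using that nice_alg_antisym[OF c', of i j k] by simp
    ultimately show ?thesis
      using sub[of i j k] sub[of j i k] wf[of i j k] wf[of j i k] that True unfolding nz
      by (metis nat_neq_iff order.strict_trans)
  next
    case False
    then have "s i < k" "s j < k"
      using that sorted out[of k] unfolding nz sorted_alg_def by fastforce+
    then show ?thesis
      using s_le[of i] s_le[of j] out[of i] out[of j] False by (metis not_le order.strict_trans1 order.trans not_less)
  qed
  then have "sorted_alg ?c'" unfolding sorted_alg_def by blast
  moreover have "brackets n ?c' = set R"
  proof (intro subset_antisym subsetI)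
    fix t assume "t \<in> brackets n ?c'"
    then show "t \<in> set R" using sub by (auto simp: brackets_def nz)
  next
    fix t assume t: "t \<in> set R"
    obtain i j k where ijk: "t = (i, j, k)" by (rule prod_cases3)
    obtain a b where ab: "ordpair (s i) (s j) = (a, b)" by force
    have "(\<lambda>(i, j, k). case ordpair (s i) (s j) of (a, b) \<Rightarrow> (a, b, s k)) t \<in> brackets n c"
      using t unfolding D imD[symmetric] im by (rule imageI)
    then have "(a, b, s k) \<in> brackets n c" by (simp add: ijk ab)
    then have "c (s i) (s j) (s k) \<noteq> 0"
      using ab nice_alg_antisym[OF c, of "s i" "s j" "s k"]
      by (auto simp: ordpair_def brackets_def split: if_splits)
    then show "t \<in> brackets n ?c'"
      using wf[of i j k] t by (simp add: brackets_def ijk nz)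
  qed
  moreover have "nice_equiv N c ?c'"
    by (rule nice_equiv_relabel[OF s])
  ultimately show ?thesis using c' by blast
qed

text \<open>In the combination of node equations given by \<open>w\<close> a single summand
  survives, and it is a product of nonzero factors.\<close>

lemma not_balanced_if_isolating_weight:
  fixes w :: "nat \<Rightarrow> real"
  assumes c: "nice_alg n c" and g: "balanced n c g" and D: "brackets n c = set D"
    and t: "t \<in> set D" "\<And>i j k. (i, j, k) \<in> set D \<Longrightarrow> w k - w i - w j \<noteq> 0 \<longleftrightarrow> (i, j, k) = t"
  shows False
proof -
  obtain i j k where ijk: "t = (i, j, k)" by (rule prod_cases3)
  have "(\<Sum>(i, j, k)\<in>set D. ricci_weight c g i j k * (w k - w i - w j))
    = (\<Sum>u\<in>set D. if u = t then ricci_weight c g i j k * (w k - w i - w j) else 0)"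
    using t(2) by (intro sum.cong refl) (auto simp: ijk)
  also have "\<dots> = ricci_weight c g i j k * (w k - w i - w j)"
    using t(1) by simp
  finally have "ricci_weight c g i j k * (w k - w i - w j) = 0"
    using weighted_balance[OF c g, of w] unfolding D by simp
  moreover have cnz: "c i j k \<noteq> 0"
  proof -
    have "(i, j, k) \<in> brackets n c" using t(1) by (simp add: D ijk)
    then show ?thesis by (simp add: brackets_def)
  qed
  moreover have "g i \<noteq> 0 \<and> g j \<noteq> 0 \<and> g k \<noteq> 0"
    using nice_alg_supported[OF c cnz] g by (simp add: balanced_def diag_metric_def)
  moreover have "w k - w i - w j \<noteq> 0"
    using t(2)[of i j k] t(1) by (simp add: ijk)
  ultimately show False
    by (simp add: ricci_weight_def)
qed

lemma is_singleton_filter: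
  assumes "is_singleton_list (filter P D)"
  obtains t where "t \<in> set D" "\<And>u. u \<in> set D \<Longrightarrow> P u \<longleftrightarrow> u = t"
proof -
  obtain t where "filter P D = [t]"
    using assms by (auto simp: is_singleton_list_def split: list.splits)
  then have "{u \<in> set D. P u} = {t}" by (metis set_filter list.set(1) list.set(2))
  then show ?thesis using that[of t] by blast
qed

lemma list_all2_obtain:
  assumes "list_all2 P xs ys" "x \<in> set xs"
  obtains y where "P x y"
  using assms by (auto simp: list_all2_conv_all_nth in_set_conv_nth)

lemma check_step_sound:
  assumes chk: "\<And>a. \<exists>C. check_step n Q' (Q a) C" and n: "n \<le> 7"
    and c: "nice_alg 8 c" and sorted: "sorted_alg c" and g: "balanced 8 c g"
    and R: "brackets n c = set R" "R \<in> set (Q a)"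
  shows "\<exists>c'. nice_equiv 8 c c' \<and> nice_alg 8 c' \<and> sorted_alg c' \<and> (\<exists>a. \<exists>D\<in>set (Q' a). brackets (Suc n) c' = set D)"
proof -
  obtain D where D: "D \<in> set (extensions R n)" "brackets (Suc n) c = set D"
    using brackets_Suc_in_extensions[OF c sorted R(1)] by blast
  have no_leaf: "\<not> has_leaf D" if "n = 7"
  proof
    assume "has_leaf D"
    then obtain v where v: "is_singleton_list (filter (incident v) D)"
      by (auto simp: has_leaf_def list_ex_iff)
    have D8: "brackets 8 c = set D" using D(2) that by simp
    obtain t where t: "t \<in> set D" "\<And>u. u \<in> set D \<Longrightarrow> incident v u \<longleftrightarrow> u = t"
      by (rule is_singleton_filter[OF v]) (rule that)
    have ord: "i < j \<and> j < k" if "(i, j, k) \<in> set D" for i j k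
      using that sorted D8[symmetric] by (auto simp: brackets_def sorted_alg_def)
    \<comment> \<open>A leaf is the special case of an isolating weight that is the indicator of
      \<open>v\<close>. As \<open>i\<close>, \<open>j\<close> and \<open>k\<close> are distinct, the
      contributions of a bracket at \<open>v\<close> cannot cancel.\<close>
    have "of_bool (k = v) - of_bool (i = v) - of_bool (j = v) \<noteq> (0 :: real) \<longleftrightarrow> (i, j, k) = t"
      if "(i, j, k) \<in> set D" for i j k
      using t(2)[OF that] ord[OF that] by (auto simp: incident_def of_bool_def)
    with not_balanced_if_isolating_weight[OF c g D8 t(1), of "\<lambda>u. of_bool (u = v)"] show False by blast
  qed
  obtain C where "check_step n Q' (Q a) C" using chk by blast
  then obtain cs where cs: "list_all2 (certifies (Suc n) Q')
     (if n = 7 then filter (\<lambda>D. \<not> has_leaf D) (extensions R n) else extensions R n) cs"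
    unfolding check_step_def using R(2) by (rule list_all2_obtain)
  have "D \<in> set (if n = 7 then filter (\<lambda>D. \<not> has_leaf D) (extensions R n) else extensions R n)"
    using D(1) no_leaf by auto
  with cs obtain x where x: "certifies (Suc n) Q' D x" by (rule list_all2_obtain)
  show ?thesis
  proof (cases x)
    case (Same b m)
    then have "D \<in> set (Q' b)" using x by (auto simp: in_set_conv_nth)
    moreover have "nice_equiv 8 c c" by (rule nice_equiv_refl)
    ultimately show ?thesis using c sorted D(2) by blast
  next
    case (Iso p b m)
    then have *: "m < length (Q' b)" "is_isomorphism (Suc n) p (Q' b ! m) D" using x by simp_all
    then show ?thesis
      using isomorphism_relabel[OF c sorted _ D(2) *(2)] n nth_mem[OF *(1)] by fastforce
  next
    case (Lin ps ns)
    then have n7: "n = 7" and single: "is_singleton_list (filter (\<lambda>t. bracket_weight ps ns t \<noteq> 0) D)"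
      using x by simp_all
    have D8: "brackets 8 c = set D" using D(2) n7 by simp
    obtain t where t: "t \<in> set D" "\<And>u. u \<in> set D \<Longrightarrow> bracket_weight ps ns u \<noteq> 0 \<longleftrightarrow> u = t"
      by (rule is_singleton_filter[OF single]) (rule that)
    define w where "w v = real_of_int (node_weight ps ns v)" for v
    have "w k - w i - w j \<noteq> 0 \<longleftrightarrow> (i, j, k) = t" if "(i, j, k) \<in> set D" for i j k
    proof -
      have "w k - w i - w j = real_of_int (bracket_weight ps ns (i, j, k))" by (simp add: w_def bracket_weight_def)
      then show ?thesis using t(2)[OF that] by simp
    qed
    then show ?thesis
      using not_balanced_if_isolating_weight[OF c g D8 t(1), of w] by blast
  qed
qed

section \<open>Enumeration of the diagrams\<close>

text \<open>\<open>level n\<close> lists, up to isomorphism, the nice diagrams with \<open>n\<close> nodes (in dimension 8 only those that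
  survive the linear system); they and the certificates come from a computer search. The blocks keep the
  terms small that \<open>code_simp\<close> has to traverse. The first block of \<open>level8\<close> consists of the seven diagrams
  of the theorem and the abelian one.\<close>

definition diagrams0_0 :: "diagram list" where "diagrams0_0 =
   [[]]"

text \<open>The default \<open>[]\<close> is a block that needs no certificates, so the check can be
  asserted for every index \<open>a\<close>.\<close>

definition level0 :: "nat \<Rightarrow> diagram list" where "level0 a =
  (if a = 0 then diagrams0_0
   else [])"

definition diagrams1_0 :: "diagram list" where "diagrams1_0 =
   [[]]"

definition level1 :: "nat \<Rightarrow> diagram list" where "level1 a =
  (if a = 0 then diagrams1_0
   else [])"

definition diagrams2_0 :: "diagram list" where "diagrams2_0 =
   [[]]"

definition level2 :: "nat \<Rightarrow> diagram list" where "level2 a =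
  (if a = 0 then diagrams2_0
   else [])"

definition diagrams3_0 :: "diagram list" where "diagrams3_0 =
   [[], [(1,2,3)]]"

definition level3 :: "nat \<Rightarrow> diagram list" where "level3 a =
  (if a = 0 then diagrams3_0
   else [])"

definition diagrams4_0 :: "diagram list" where "diagrams4_0 =
   [[], [(2,3,4)], [(1,2,3),(2,3,4)]]"

definition level4 :: "nat \<Rightarrow> diagram list" where "level4 a =
  (if a = 0 then diagrams4_0
   else [])"

definition diagrams5_0 :: "diagram list" where "diagrams5_0 =
   [[], [(3,4,5)], [(2,3,5),(1,4,5)], [(2,3,4),(3,4,5)], [(2,3,4),(1,3,5)], [(2,3,4),(1,3,5),(2,4,5)], [(1,2,3),(2,3,4),
    (2,4,5)], [(1,2,3),(2,3,4),(1,3,5)], [(1,2,3),(2,3,4),(1,3,5),(2,4,5)]]"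

definition level5 :: "nat \<Rightarrow> diagram list" where "level5 a =
  (if a = 0 then diagrams5_0
   else [])"

definition diagrams6_0 :: "diagram list" where "diagrams6_0 =
   [[], [(4,5,6)], [(3,4,6),(2,5,6)], [(3,4,5),(4,5,6)], [(3,4,5),(2,4,6)], [(3,4,5),(2,4,6),(3,5,6)], [(3,4,5),(2,3,6),
    (1,4,6)], [(3,4,5),(1,2,6)], [(3,4,5),(1,2,6),(4,5,6)], [(2,3,5),(1,4,5),(1,3,6),(2,4,6)], [(2,3,4),(3,4,5),(3,5,
    6)], [(2,3,4),(3,4,5),(2,4,6)], [(2,3,4),(3,4,5),(2,4,6),(3,5,6)], [(2,3,4),(3,4,5),(1,3,6)], [(2,3,4),(3,4,5),(1,
    3,6),(2,4,6)], [(2,3,4),(3,4,5),(1,2,6)]]"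

definition diagrams6_1 :: "diagram list" where "diagrams6_1 =
   [[(2,3,4),(3,4,5),(1,2,6),(3,5,6)], [(2,3,4),(1,3,5),(3,4,6),(1,5,6)], [(2,3,4),(1,3,5),(2,4,6),(1,5,6)], [(2,3,4),(1,
    3,5),(1,4,6),(2,5,6)], [(2,3,4),(1,3,5),(1,2,6)], [(2,3,4),(1,3,5),(1,2,6),(3,5,6)], [(2,3,4),(1,3,5),(2,4,5),(1,
    4,6),(2,5,6)], [(2,3,4),(1,3,5),(2,4,5),(1,2,6),(3,4,6)], [(1,2,3),(2,3,4),(2,4,5),(2,5,6)], [(1,2,3),(2,3,4),(2,
    4,5),(3,4,6),(1,5,6)], [(1,2,3),(2,3,4),(2,4,5),(1,3,6)], [(1,2,3),(2,3,4),(2,4,5),(1,3,6),(2,5,6)], [(1,2,3),(2,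
    3,4),(1,3,5),(2,4,6),(1,5,6)], [(1,2,3),(2,3,4),(1,3,5),(1,4,6),(2,5,6)], [(1,2,3),(2,3,4),(1,3,5),(2,4,5),(3,4,
    6),(1,5,6)], [(1,2,3),(2,3,4),(1,3,5),(2,4,5),(1,4,6),(2,5,6)]]"

definition level6 :: "nat \<Rightarrow> diagram list" where "level6 a =
  (if a = 0 then diagrams6_0
   else if a = 1 then diagrams6_1
   else [])"

definition diagrams7_0 :: "diagram list" where "diagrams7_0 =
   [[], [(5,6,7)], [(4,5,7),(3,6,7)], [(3,4,7),(2,5,7),(1,6,7)], [(4,5,6),(5,6,7)], [(4,5,6),(3,5,7)], [(4,5,6),(3,5,7),
    (4,6,7)], [(4,5,6),(3,4,7),(2,5,7)], [(4,5,6),(2,3,7)], [(4,5,6),(2,3,7),(5,6,7)], [(4,5,6),(2,3,7),(1,5,7)], [(4,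
    5,6),(2,3,7),(1,5,7),(4,6,7)], [(3,4,6),(2,5,6),(2,4,7),(3,5,7)], [(3,4,6),(2,5,6),(2,4,7),(1,5,7)], [(3,4,5),(4,
    5,6),(4,6,7)], [(3,4,5),(4,5,6),(3,5,7)]]"

definition diagrams7_1 :: "diagram list" where "diagrams7_1 =
   [[(3,4,5),(4,5,6),(3,5,7),(4,6,7)], [(3,4,5),(4,5,6),(2,4,7)], [(3,4,5),(4,5,6),(2,4,7),(3,5,7)], [(3,4,5),(4,5,6),(2,
    3,7)], [(3,4,5),(4,5,6),(2,3,7),(4,6,7)], [(3,4,5),(4,5,6),(2,3,7),(1,4,7)], [(3,4,5),(4,5,6),(1,2,7)], [(3,4,5),
    (4,5,6),(1,2,7),(4,6,7)], [(3,4,5),(4,5,6),(1,2,7),(3,5,7)], [(3,4,5),(4,5,6),(1,2,7),(3,5,7),(4,6,7)], [(3,4,5),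
    (2,4,6),(4,5,7),(2,6,7)], [(3,4,5),(2,4,6),(3,5,7),(2,6,7)], [(3,4,5),(2,4,6),(2,5,7),(3,6,7)], [(3,4,5),(2,4,6),
    (1,4,7)], [(3,4,5),(2,4,6),(1,4,7),(2,6,7)], [(3,4,5),(2,4,6),(1,4,7),(3,5,7),(2,6,7)]]"

definition diagrams7_2 :: "diagram list" where "diagrams7_2 =
   [[(3,4,5),(2,4,6),(1,4,7),(2,5,7),(3,6,7)], [(3,4,5),(2,4,6),(2,3,7)], [(3,4,5),(2,4,6),(2,3,7),(4,6,7)], [(3,4,5),(2,
    4,6),(2,3,7),(1,4,7)], [(3,4,5),(2,4,6),(1,3,7)], [(3,4,5),(2,4,6),(1,3,7),(4,6,7)], [(3,4,5),(2,4,6),(1,3,7),(2,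
    6,7)], [(3,4,5),(2,4,6),(1,3,7),(4,5,7)], [(3,4,5),(2,4,6),(1,3,7),(4,5,7),(2,6,7)], [(3,4,5),(2,4,6),(3,5,6),(2,
    5,7),(3,6,7)], [(3,4,5),(2,4,6),(3,5,6),(1,4,7),(2,5,7),(3,6,7)], [(3,4,5),(2,4,6),(3,5,6),(2,3,7),(4,5,7)], [(3,
    4,5),(2,4,6),(3,5,6),(2,3,7),(1,4,7)], [(3,4,5),(2,4,6),(3,5,6),(1,3,7),(4,5,7)], [(3,4,5),(2,4,6),(3,5,6),(1,2,
    7)], [(3,4,5),(2,4,6),(3,5,6),(1,2,7),(4,5,7)]]"

definition diagrams7_3 :: "diagram list" where "diagrams7_3 =
   [[(3,4,5),(2,3,6),(1,4,6),(2,5,7),(4,6,7)], [(3,4,5),(2,3,6),(1,4,6),(2,4,7),(1,5,7),(3,6,7)], [(3,4,5),(2,3,6),(1,4,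
    6),(1,3,7),(2,4,7)], [(3,4,5),(2,3,6),(1,4,6),(1,2,7)], [(3,4,5),(2,3,6),(1,4,6),(1,2,7),(4,5,7)], [(3,4,5),(1,2,
    6),(4,5,7),(2,6,7)], [(3,4,5),(1,2,6),(2,4,7),(3,5,7),(1,6,7)], [(2,3,5),(1,4,5),(1,3,6),(2,4,6),(4,5,7),(3,6,7)],
     [(2,3,5),(1,4,5),(1,3,6),(2,4,6),(3,4,7),(2,5,7),(1,6,7)], [(2,3,5),(1,4,5),(1,3,6),(2,4,6),(1,2,7),(3,4,7)],
     [(2,3,4),(3,4,5),(3,5,6),(3,6,7)], [(2,3,4),(3,4,5),(3,5,6),(4,5,7),(2,6,7)], [(2,3,4),(3,4,5),(3,5,6),(2,4,7)],
     [(2,3,4),(3,4,5),(3,5,6),(2,4,7),(3,6,7)], [(2,3,4),(3,4,5),(3,5,6),(1,3,7)], [(2,3,4),(3,4,5),(3,5,6),(1,3,7),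
    (4,5,7),(2,6,7)]]"

definition diagrams7_4 :: "diagram list" where "diagrams7_4 =
   [[(2,3,4),(3,4,5),(3,5,6),(1,3,7),(2,4,7)], [(2,3,4),(3,4,5),(3,5,6),(1,2,7)], [(2,3,4),(3,4,5),(3,5,6),(1,2,7),(3,6,
    7)], [(2,3,4),(3,4,5),(2,4,6),(3,5,7),(2,6,7)], [(2,3,4),(3,4,5),(2,4,6),(2,5,7),(3,6,7)], [(2,3,4),(3,4,5),(2,4,
    6),(1,3,7)], [(2,3,4),(3,4,5),(2,4,6),(1,3,7),(2,6,7)], [(2,3,4),(3,4,5),(2,4,6),(3,5,6),(4,5,7),(2,6,7)], [(2,3,
    4),(3,4,5),(2,4,6),(3,5,6),(2,5,7),(3,6,7)], [(2,3,4),(3,4,5),(2,4,6),(3,5,6),(1,3,7)], [(2,3,4),(3,4,5),(2,4,6),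
    (3,5,6),(1,3,7),(4,5,7),(2,6,7)], [(2,3,4),(3,4,5),(2,4,6),(3,5,6),(1,2,7)], [(2,3,4),(3,4,5),(1,3,6),(3,6,7)],
     [(2,3,4),(3,4,5),(1,3,6),(1,6,7)], [(2,3,4),(3,4,5),(1,3,6),(3,5,7),(1,6,7)], [(2,3,4),(3,4,5),(1,3,6),(2,4,7),
    (3,6,7)]]"

definition diagrams7_5 :: "diagram list" where "diagrams7_5 =
   [[(2,3,4),(3,4,5),(1,3,6),(2,4,7),(1,6,7)], [(2,3,4),(3,4,5),(1,3,6),(2,4,7),(3,5,7),(1,6,7)], [(2,3,4),(3,4,5),(1,3,
    6),(1,4,7),(2,6,7)], [(2,3,4),(3,4,5),(1,3,6),(1,4,7),(3,5,7),(2,6,7)], [(2,3,4),(3,4,5),(1,3,6),(1,2,7)], [(2,3,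
    4),(3,4,5),(1,3,6),(1,2,7),(3,6,7)], [(2,3,4),(3,4,5),(1,3,6),(1,2,7),(3,5,7)], [(2,3,4),(3,4,5),(1,3,6),(2,4,6),
    (2,5,7),(3,6,7)], [(2,3,4),(3,4,5),(1,3,6),(2,4,6),(1,4,7),(2,6,7)], [(2,3,4),(3,4,5),(1,3,6),(2,4,6),(1,4,7),(3,
    5,7),(2,6,7)], [(2,3,4),(3,4,5),(1,3,6),(2,4,6),(1,2,7)], [(2,3,4),(3,4,5),(1,3,6),(2,4,6),(1,2,7),(3,5,7)], [(2,
    3,4),(3,4,5),(1,2,6),(1,6,7)], [(2,3,4),(3,4,5),(1,2,6),(3,5,7),(2,6,7)], [(2,3,4),(3,4,5),(1,2,6),(3,5,7),(1,6,
    7)], [(2,3,4),(3,4,5),(1,2,6),(2,4,7),(1,6,7)]]"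

definition diagrams7_6 :: "diagram list" where "diagrams7_6 =
   [[(2,3,4),(3,4,5),(1,2,6),(2,4,7),(3,5,7),(1,6,7)], [(2,3,4),(3,4,5),(1,2,6),(1,4,7),(3,6,7)], [(2,3,4),(3,4,5),(1,2,
    6),(1,3,7),(2,6,7)], [(2,3,4),(3,4,5),(1,2,6),(3,5,6),(4,5,7),(2,6,7)], [(2,3,4),(3,4,5),(1,2,6),(3,5,6),(1,4,7),
    (3,6,7)], [(2,3,4),(3,4,5),(1,2,6),(3,5,6),(1,3,7),(4,5,7),(2,6,7)], [(2,3,4),(1,3,5),(3,4,6),(1,5,6),(2,4,7),(3,
    5,7)], [(2,3,4),(1,3,5),(3,4,6),(1,5,6),(1,4,7),(2,5,7)], [(2,3,4),(1,3,5),(3,4,6),(1,5,6),(1,2,7)], [(2,3,4),(1,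
    3,5),(3,4,6),(1,5,6),(1,2,7),(3,5,7)], [(2,3,4),(1,3,5),(2,4,6),(1,5,6),(1,4,7),(2,5,7)], [(2,3,4),(1,3,5),(2,4,
    6),(1,5,6),(1,2,7)], [(2,3,4),(1,3,5),(2,4,6),(1,5,6),(1,2,7),(3,5,7)], [(2,3,4),(1,3,5),(1,4,6),(2,5,6),(4,5,7),
    (3,6,7)], [(2,3,4),(1,3,5),(1,4,6),(2,5,6),(1,2,7)], [(2,3,4),(1,3,5),(1,4,6),(2,5,6),(1,2,7),(4,5,7),(3,6,7)]]"

definition diagrams7_7 :: "diagram list" where "diagrams7_7 =
   [[(2,3,4),(1,3,5),(1,4,6),(2,5,6),(1,2,7),(3,5,7)], [(2,3,4),(1,3,5),(1,2,6),(3,4,7),(1,5,7),(2,6,7)], [(2,3,4),(1,3,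
    5),(1,2,6),(1,4,7),(2,5,7),(3,6,7)], [(2,3,4),(1,3,5),(1,2,6),(3,5,6),(2,5,7),(3,6,7)], [(2,3,4),(1,3,5),(1,2,6),
    (3,5,6),(1,4,7),(3,6,7)], [(2,3,4),(1,3,5),(1,2,6),(3,5,6),(1,4,7),(2,5,7),(3,6,7)], [(2,3,4),(1,3,5),(2,4,5),(1,
    4,6),(2,5,6),(4,5,7),(3,6,7)], [(2,3,4),(1,3,5),(2,4,5),(1,4,6),(2,5,6),(1,5,7),(2,6,7)], [(2,3,4),(1,3,5),(2,4,
    5),(1,4,6),(2,5,6),(3,4,7),(1,5,7),(2,6,7)], [(2,3,4),(1,3,5),(2,4,5),(1,4,6),(2,5,6),(1,2,7),(4,5,7),(3,6,7)],
     [(2,3,4),(1,3,5),(2,4,5),(1,4,6),(2,5,6),(1,2,7),(3,4,7)], [(2,3,4),(1,3,5),(2,4,5),(1,2,6),(3,4,6),(3,5,7),(2,6,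
    7)], [(2,3,4),(1,3,5),(2,4,5),(1,2,6),(3,4,6),(2,5,7),(3,6,7)], [(2,3,4),(1,3,5),(2,4,5),(1,2,6),(3,4,6),(1,4,7),
    (2,5,7),(3,6,7)], [(1,2,3),(2,3,4),(2,4,5),(2,5,6),(2,6,7)], [(1,2,3),(2,3,4),(2,4,5),(2,5,6),(3,4,7),(1,5,7)]]"

definition diagrams7_8 :: "diagram list" where "diagrams7_8 =
   [[(1,2,3),(2,3,4),(2,4,5),(2,5,6),(3,4,7),(1,5,7),(2,6,7)], [(1,2,3),(2,3,4),(2,4,5),(2,5,6),(1,3,7)], [(1,2,3),(2,3,
    4),(2,4,5),(2,5,6),(1,3,7),(2,6,7)], [(1,2,3),(2,3,4),(2,4,5),(3,4,6),(1,5,6),(3,5,7),(2,6,7)], [(1,2,3),(2,3,4),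
    (2,4,5),(3,4,6),(1,5,6),(1,3,7)], [(1,2,3),(2,3,4),(2,4,5),(3,4,6),(1,5,6),(1,3,7),(2,5,7)], [(1,2,3),(2,3,4),(2,
    4,5),(1,3,6),(1,6,7)], [(1,2,3),(2,3,4),(2,4,5),(1,3,6),(2,5,7),(1,6,7)], [(1,2,3),(2,3,4),(2,4,5),(1,3,6),(1,4,
    7),(2,6,7)], [(1,2,3),(2,3,4),(2,4,5),(1,3,6),(2,5,6),(1,4,7),(2,6,7)], [(1,2,3),(2,3,4),(1,3,5),(2,4,6),(1,5,6),
    (3,5,7),(2,6,7)], [(1,2,3),(2,3,4),(1,3,5),(2,4,6),(1,5,6),(1,4,7),(2,5,7)], [(1,2,3),(2,3,4),(1,3,5),(1,4,6),(2,
    5,6),(3,5,7),(1,6,7)], [(1,2,3),(2,3,4),(1,3,5),(1,4,6),(2,5,6),(3,4,7),(1,5,7),(2,6,7)], [(1,2,3),(2,3,4),(1,3,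
    5),(2,4,5),(3,4,6),(1,5,6),(3,5,7),(2,6,7)], [(1,2,3),(2,3,4),(1,3,5),(2,4,5),(3,4,6),(1,5,6),(1,4,7),(2,5,7)]]"

definition diagrams7_9 :: "diagram list" where "diagrams7_9 =
   [[(1,2,3),(2,3,4),(1,3,5),(2,4,5),(1,4,6),(2,5,6),(1,5,7),(2,6,7)], [(1,2,3),(2,3,4),(1,3,5),(2,4,5),(1,4,6),(2,5,6),
    (3,4,7),(2,6,7)], [(1,2,3),(2,3,4),(1,3,5),(2,4,5),(1,4,6),(2,5,6),(3,4,7),(1,5,7),(2,6,7)]]"

definition level7 :: "nat \<Rightarrow> diagram list" where "level7 a =
  (if a = 0 then diagrams7_0
   else if a = 1 then diagrams7_1
   else if a = 2 then diagrams7_2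
   else if a = 3 then diagrams7_3
   else if a = 4 then diagrams7_4
   else if a = 5 then diagrams7_5
   else if a = 6 then diagrams7_6
   else if a = 7 then diagrams7_7
   else if a = 8 then diagrams7_8
   else if a = 9 then diagrams7_9
   else [])"

definition diagrams8_0 :: "diagram list" where "diagrams8_0 =
   [[(1,2,3),(1,3,4),(2,3,5),(1,4,6),(1,5,7),(2,4,7),(2,6,8),(3,4,8)], [(1,2,4),(1,4,5),(1,5,6),(2,4,6),(1,6,7),(2,5,7),
    (2,6,8),(4,5,8)], [(1,2,4),(1,3,5),(2,4,5),(1,4,6),(2,5,7),(3,4,7),(1,5,8),(2,6,8)], [(1,2,4),(1,3,5),(2,4,5),(1,
    4,6),(2,3,6),(1,5,7),(2,6,7),(1,6,8),(2,5,8),(3,4,8)], [(1,4,5),(2,3,5),(1,3,6),(2,4,6),(1,6,7),(2,5,7),(1,5,8),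
    (2,6,8)], [(1,2,5),(1,3,6),(2,3,7),(1,7,8),(2,6,8),(3,5,8)], [(1,2,6),(1,3,7),(2,7,8),(3,6,8)], []]"

definition diagrams8_1 :: "diagram list" where "diagrams8_1 =
   [[(3,4,5),(2,4,6),(2,5,7),(3,6,7),(5,6,8),(4,7,8)], [(3,4,5),(2,4,6),(1,3,7),(4,5,7),(1,2,8),(4,6,8)], [(3,4,5),(2,4,
    6),(3,5,6),(2,5,7),(3,6,7),(2,6,8),(3,7,8)], [(3,4,5),(2,4,6),(3,5,6),(1,4,7),(2,5,7),(3,6,7),(1,5,8),(2,6,8),(3,
    7,8)], [(3,4,5),(2,4,6),(3,5,6),(1,3,7),(4,5,7),(1,2,8),(4,6,8),(3,7,8)], [(3,4,5),(2,3,6),(1,4,6),(2,5,7),(4,6,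
    7),(1,5,8),(3,6,8)], [(2,3,4),(3,4,5),(2,4,6),(2,5,7),(3,6,7),(4,6,8),(2,7,8)], [(2,3,4),(3,4,5),(2,4,6),(3,5,6),
    (2,5,7),(3,6,7),(4,5,8),(2,6,8),(3,7,8)]]"

definition diagrams8_2 :: "diagram list" where "diagrams8_2 =
   [[(2,3,4),(3,4,5),(2,4,6),(3,5,6),(1,3,7),(4,5,7),(2,6,7),(1,2,8),(4,6,8),(3,7,8)], [(2,3,4),(3,4,5),(1,3,6),(3,6,7),
    (1,5,8),(4,6,8),(2,7,8)], [(2,3,4),(3,4,5),(1,3,6),(1,4,7),(2,6,7),(1,5,8),(4,6,8),(3,7,8)], [(2,3,4),(3,4,5),(1,
    3,6),(2,4,6),(2,5,7),(3,6,7),(1,5,8),(4,6,8),(2,7,8)], [(2,3,4),(3,4,5),(1,2,6),(1,4,7),(3,6,7),(1,5,8),(3,7,8)],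
     [(2,3,4),(1,3,5),(1,4,6),(2,5,6),(4,5,7),(3,6,7),(5,6,8),(1,7,8)], [(2,3,4),(1,3,5),(1,2,6),(3,4,7),(1,5,7),(2,6,
    7),(2,4,8),(3,5,8),(1,6,8)], [(2,3,4),(1,3,5),(1,2,6),(1,4,7),(2,5,7),(3,6,7),(5,6,8),(1,7,8)]]"

definition diagrams8_3 :: "diagram list" where "diagrams8_3 =
   [[(2,3,4),(1,3,5),(1,2,6),(3,5,6),(1,4,7),(3,6,7),(4,5,8),(2,6,8),(3,7,8)], [(2,3,4),(1,3,5),(1,2,6),(3,5,6),(1,4,7),
    (2,5,7),(3,6,7),(4,5,8),(2,6,8),(3,7,8)], [(2,3,4),(1,3,5),(2,4,5),(1,4,6),(2,5,6),(4,5,7),(3,6,7),(1,5,8),(2,6,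
    8)], [(2,3,4),(1,3,5),(2,4,5),(1,4,6),(2,5,6),(1,5,7),(2,6,7),(1,6,8),(2,7,8)], [(2,3,4),(1,3,5),(2,4,5),(1,4,6),
    (2,5,6),(3,4,7),(1,5,7),(2,6,7),(3,5,8),(1,6,8),(2,7,8)], [(1,2,3),(2,3,4),(2,4,5),(3,4,6),(1,5,6),(3,5,7),(2,6,
    7),(4,5,8),(2,7,8)], [(1,2,3),(2,3,4),(2,4,5),(1,3,6),(1,4,7),(2,6,7),(3,4,8),(1,5,8),(2,7,8)], [(1,2,3),(2,3,4),
    (1,3,5),(1,4,6),(2,5,6),(3,5,7),(1,6,7),(4,5,8),(3,6,8),(2,7,8)]]"

definition diagrams8_4 :: "diagram list" where "diagrams8_4 =
   [[(1,2,3),(2,3,4),(1,3,5),(1,4,6),(2,5,6),(3,5,7),(1,6,7),(3,4,8),(2,6,8)], [(1,2,3),(2,3,4),(1,3,5),(2,4,5),(3,4,6),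
    (1,5,6),(3,5,7),(2,6,7),(4,5,8),(1,6,8),(2,7,8)], [(1,2,3),(2,3,4),(1,3,5),(2,4,5),(3,4,6),(1,5,6),(3,5,7),(2,6,
    7),(1,4,8),(2,5,8)], [(1,2,3),(2,3,4),(1,3,5),(2,4,5),(3,4,6),(1,5,6),(1,4,7),(2,5,7),(3,5,8),(2,6,8),(1,7,8)],
     [(1,2,3),(2,3,4),(1,3,5),(2,4,5),(1,4,6),(2,5,6),(1,5,7),(2,6,7),(4,5,8),(3,6,8),(1,7,8)], [(1,2,3),(2,3,4),(1,3,
    5),(2,4,5),(1,4,6),(2,5,6),(3,4,7),(2,6,7),(3,5,8),(1,6,8),(2,7,8)], [(1,2,3),(2,3,4),(1,3,5),(2,4,5),(1,4,6),(2,
    5,6),(3,4,7),(1,5,7),(2,6,7),(4,5,8),(3,6,8),(1,7,8)], [(1,2,3),(2,3,4),(1,3,5),(2,4,5),(1,4,6),(2,5,6),(3,4,7),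
    (1,5,7),(2,6,7),(3,5,8),(2,7,8)]]"

definition diagrams8_5 :: "diagram list" where "diagrams8_5 =
   [[(1,2,3),(2,3,4),(1,3,5),(2,4,5),(1,4,6),(2,5,6),(3,4,7),(1,5,7),(2,6,7),(3,5,8),(1,6,8),(2,7,8)]]"

definition level8 :: "nat \<Rightarrow> diagram list" where "level8 a =
  (if a = 0 then diagrams8_0
   else if a = 1 then diagrams8_1
   else if a = 2 then diagrams8_2
   else if a = 3 then diagrams8_3
   else if a = 4 then diagrams8_4
   else if a = 5 then diagrams8_5
   else [])"

section \<open>Certificates for the extensions of each level\<close>

definition certs0_0 :: "certificate list list" where "certs0_0 =
   [[Same 0 0]]"

lemma check0_0: "check_step 0 level1 diagrams0_0 certs0_0"
  by code_simp

lemma check_level0: "\<exists>C. check_step 0 level1 (level0 a) C"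
  unfolding level0_def using check_step_Nil check0_0
  by (simp split: if_split) blast

definition certs1_0 :: "certificate list list" where "certs1_0 =
   [[Same 0 0]]"

lemma check1_0: "check_step 1 level2 diagrams1_0 certs1_0"
  by code_simp

lemma check_level1: "\<exists>C. check_step 1 level2 (level1 a) C"
  unfolding level1_def using check_step_Nil check1_0
  by (simp split: if_split) blast

definition certs2_0 :: "certificate list list" where "certs2_0 =
   [[Same 0 0,Same 0 1]]"

lemma check2_0: "check_step 2 level3 diagrams2_0 certs2_0"
  by code_simp

lemma check_level2: "\<exists>C. check_step 2 level3 (level2 a) C"
  unfolding level2_def using check_step_Nil check2_0
  by (simp split: if_split) blast

definition certs3_0 :: "certificate list list" where "certs3_0 =
   [[Same 0 0,Same 0 1,Iso [2,1,3,4] 0 1,Iso [3,1,2,4] 0 1], [Iso [4,1,2,3] 0 1,Same 0 2,Iso [2,1,3,4] 0 2]]"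

lemma check3_0: "check_step 3 level4 diagrams3_0 certs3_0"
  by code_simp

lemma check_level3: "\<exists>C. check_step 3 level4 (level3 a) C"
  unfolding level3_def using check_step_Nil check3_0
  by (simp split: if_split) blast

definition certs4_0 :: "certificate list list" where "certs4_0 =
   [[Same 0 0,Same 0 1,Iso [1,3,2,4,5] 0 1,Iso [2,3,1,4,5] 0 1,Iso [1,4,2,3,5] 0 1,Same 0 2,Iso [2,4,1,3,5] 0 1,Iso [1,2,
    4,3,5] 0 2,Iso [3,4,1,2,5] 0 1,Iso [1,3,4,2,5] 0 2], [Iso [1,5,2,3,4] 0 1,Same 0 3,Iso [1,3,2,4,5] 0 3,Same 0 4,
    Same 0 5,Iso [1,3,2,4,5] 0 4,Iso [1,3,2,4,5] 0 5], [Iso [5,1,2,3,4] 0 3,Same 0 6,Same 0 7,Same 0 8]]"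

lemma check4_0: "check_step 4 level5 diagrams4_0 certs4_0"
  by code_simp

lemma check_level4: "\<exists>C. check_step 4 level5 (level4 a) C"
  unfolding level4_def using check_step_Nil check4_0
  by (simp split: if_split) blast

definition certs5_0 :: "certificate list list" where "certs5_0 =
   [[Same 0 0,Same 0 1,Iso [1,2,4,3,5,6] 0 1,Iso [1,3,4,2,5,6] 0 1,Iso [2,3,4,1,5,6] 0 1,Iso [1,2,5,3,4,6] 0 1,Same 0 2,
    Iso [2,1,3,4,5,6] 0 2,Iso [1,3,5,2,4,6] 0 1,Iso [1,2,3,5,4,6] 0 2,Iso [3,1,2,4,5,6] 0 2,Iso [2,3,5,1,4,6] 0 1,
    Iso [2,1,3,5,4,6] 0 2,Iso [3,1,2,5,4,6] 0 2,Iso [1,4,5,2,3,6] 0 1,Iso [1,2,4,5,3,6] 0 2,Iso [4,1,2,3,5,6] 0 2,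
    Iso [5,1,2,3,4,6] 0 2,Iso [2,4,5,1,3,6] 0 1,Iso [2,1,4,5,3,6] 0 2,Iso [4,1,2,5,3,6] 0 2,Iso [5,1,2,4,3,6] 0 2,
    Iso [3,4,5,1,2,6] 0 1,Iso [3,1,4,5,2,6] 0 2,Iso [4,1,3,5,2,6] 0 2,Iso [5,1,3,4,2,6] 0 2], [Iso [1,2,6,3,4,5] 0 1,
    Same 0 3,Iso [1,2,4,3,5,6] 0 3,Same 0 4,Same 0 5,Iso [2,1,3,4,5,6] 0 4,Iso [2,1,3,4,5,6] 0 5,Iso [1,2,4,3,5,
    6] 0 4,Iso [1,2,4,3,5,6] 0 5,Same 0 6,Iso [2,1,4,3,5,6] 0 4,Iso [2,1,4,3,5,6] 0 5,Iso [1,2,4,3,5,6] 0 6,Same 0 7,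
    Same 0 8,Iso [1,2,4,3,5,6] 0 8], [Iso [6,1,2,3,4,5] 0 2,Iso [1,2,3,4,6,5] 0 6,Iso [1,3,2,4,6,5] 0 6,Iso [2,4,1,3,
    6,5] 0 6,Same 0 9,Iso [3,4,1,2,6,5] 0 6,Iso [1,3,2,4,5,6] 0 9], [Iso [1,6,2,3,4,5] 0 3,Same 0 10,Same 0 11,
    Same 0 12,Same 0 13,Same 0 14,Same 0 15,Same 1 0], [Iso [6,1,2,3,4,5] 0 4,Iso [2,1,3,5,6,4] 0 13,Iso [2,3,1,5,6,
    4] 0 15,Iso [1,2,3,4,6,5] 0 13,Same 1 1,Iso [1,3,2,4,6,5] 0 15,Iso [2,1,3,5,4,6] 1 1,Same 1 2,Same 1 3,Same 1 4,
    Same 1 5,Iso [2,1,3,5,4,6] 1 5], [Iso [6,1,2,3,4,5] 0 5,Iso [1,2,3,4,6,5] 0 14,Same 1 6,Iso [3,1,2,6,4,5] 1 5,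
    Same 1 7], [Iso [6,1,2,3,4,5] 0 10,Same 1 8,Same 1 9,Same 1 10,Same 1 11], [Iso [6,1,2,3,4,5] 0 11,Iso [2,1,3,5,6,
    4] 1 10,Iso [1,2,3,4,6,5] 1 10,Same 1 12,Same 1 13], [Iso [6,1,2,3,4,5] 0 12,Same 1 14,Same 1 15]]"

lemma check5_0: "check_step 5 level6 diagrams5_0 certs5_0"
  by code_simp

lemma check_level5: "\<exists>C. check_step 5 level6 (level5 a) C"
  unfolding level5_def using check_step_Nil check5_0
  by (simp split: if_split) blast

definition certs6_0 :: "certificate list list" where "certs6_0 =
   [[Same 0 0,Same 0 1,Iso [1,2,3,5,4,6,7] 0 1,Iso [1,2,4,5,3,6,7] 0 1,Iso [1,3,4,5,2,6,7] 0 1,Iso [2,3,4,5,1,6,7] 0 1,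
    Iso [1,2,3,6,4,5,7] 0 1,Same 0 2,Iso [1,3,2,4,5,6,7] 0 2,Iso [2,3,1,4,5,6,7] 0 2,Iso [1,2,4,6,3,5,7] 0 1,Iso [1,2,
    3,4,6,5,7] 0 2,Iso [1,4,2,3,5,6,7] 0 2,Iso [2,4,1,3,5,6,7] 0 2,Iso [1,3,4,6,2,5,7] 0 1,Iso [1,3,2,4,6,5,7] 0 2,
    Iso [1,4,2,3,6,5,7] 0 2,Iso [3,4,1,2,5,6,7] 0 2,Iso [2,3,4,6,1,5,7] 0 1,Iso [2,3,1,4,6,5,7] 0 2,Iso [2,4,1,3,6,5,
    7] 0 2,Iso [3,4,1,2,6,5,7] 0 2,Iso [1,2,5,6,3,4,7] 0 1,Iso [1,2,3,5,6,4,7] 0 2,Iso [1,5,2,3,4,6,7] 0 2,Iso [2,5,1,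
    3,4,6,7] 0 2,Iso [1,6,2,3,4,5,7] 0 2,Same 0 3,Iso [2,6,1,3,4,5,7] 0 2,Iso [1,2,3,4,6,5,7] 0 3,Iso [1,3,5,6,2,4,
    7] 0 1,Iso [1,3,2,5,6,4,7] 0 2,Iso [1,5,2,3,6,4,7] 0 2,Iso [3,5,1,2,4,6,7] 0 2,Iso [1,6,2,3,5,4,7] 0 2,Iso [1,2,3,
    5,4,6,7] 0 3,Iso [3,6,1,2,4,5,7] 0 2,Iso [1,2,3,6,4,5,7] 0 3,Iso [2,3,5,6,1,4,7] 0 1,Iso [2,3,1,5,6,4,7] 0 2,
    Iso [2,5,1,3,6,4,7] 0 2,Iso [3,5,1,2,6,4,7] 0 2,Iso [2,6,1,3,5,4,7] 0 2,Iso [1,2,3,5,6,4,7] 0 3,Iso [3,6,1,2,5,4,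
    7] 0 2,Iso [1,2,3,6,5,4,7] 0 3,Iso [1,4,5,6,2,3,7] 0 1,Iso [1,4,2,5,6,3,7] 0 2,Iso [1,5,2,4,6,3,7] 0 2,Iso [4,5,1,
    2,3,6,7] 0 2,Iso [1,6,2,4,5,3,7] 0 2,Iso [1,2,4,5,3,6,7] 0 3,Iso [4,6,1,2,3,5,7] 0 2,Iso [1,2,4,6,3,5,7] 0 3,
    Iso [5,6,1,2,3,4,7] 0 2,Iso [1,2,5,6,3,4,7] 0 3,Iso [2,4,5,6,1,3,7] 0 1,Iso [2,4,1,5,6,3,7] 0 2,Iso [2,5,1,4,6,3,
    7] 0 2,Iso [4,5,1,2,6,3,7] 0 2,Iso [2,6,1,4,5,3,7] 0 2,Iso [1,2,4,5,6,3,7] 0 3,Iso [4,6,1,2,5,3,7] 0 2,Iso [1,2,4,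
    6,5,3,7] 0 3,Iso [5,6,1,2,4,3,7] 0 2,Iso [1,2,5,6,4,3,7] 0 3,Iso [3,4,5,6,1,2,7] 0 1,Iso [3,4,1,5,6,2,7] 0 2,
    Iso [3,5,1,4,6,2,7] 0 2,Iso [4,5,1,3,6,2,7] 0 2,Iso [3,6,1,4,5,2,7] 0 2,Iso [1,3,4,5,6,2,7] 0 3,Iso [4,6,1,3,5,2,
    7] 0 2,Iso [1,3,4,6,5,2,7] 0 3,Iso [5,6,1,3,4,2,7] 0 2,Iso [1,3,5,6,4,2,7] 0 3], [Iso [1,2,3,7,4,5,6] 0 1,
    Same 0 4,Iso [1,2,3,5,4,6,7] 0 4,Same 0 5,Same 0 6,Iso [1,3,2,4,5,6,7] 0 5,Iso [1,3,2,4,5,6,7] 0 6,Iso [2,3,1,4,5,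
    6,7] 0 5,Iso [2,3,1,4,5,6,7] 0 6,Iso [1,2,3,5,4,6,7] 0 5,Iso [1,2,3,5,4,6,7] 0 6,Same 0 7,Iso [2,1,3,4,5,6,7] 0 7,
    Iso [1,3,2,5,4,6,7] 0 5,Iso [1,3,2,5,4,6,7] 0 6,Iso [1,2,3,5,4,6,7] 0 7,Iso [3,1,2,4,5,6,7] 0 7,Iso [2,3,1,5,4,6,
    7] 0 5,Iso [2,3,1,5,4,6,7] 0 6,Iso [2,1,3,5,4,6,7] 0 7,Iso [3,1,2,5,4,6,7] 0 7,Same 0 8,Same 0 9,Iso [1,2,3,5,4,6,
    7] 0 9,Same 0 10,Same 0 11,Iso [1,2,3,5,4,6,7] 0 10,Iso [1,2,3,5,4,6,7] 0 11,Iso [2,1,3,4,5,6,7] 0 8,Iso [2,1,3,4,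
    5,6,7] 0 9,Iso [2,1,3,5,4,6,7] 0 9,Iso [2,1,3,4,5,6,7] 0 10,Iso [2,1,3,4,5,6,7] 0 11,Iso [2,1,3,5,4,6,7] 0 10,
    Iso [2,1,3,5,4,6,7] 0 11,Iso [3,1,2,4,5,6,7] 0 8,Iso [3,1,2,4,5,6,7] 0 9,Iso [3,1,2,5,4,6,7] 0 9,Iso [3,1,2,4,5,6,
    7] 0 10,Iso [3,1,2,4,5,6,7] 0 11,Iso [3,1,2,5,4,6,7] 0 10,Iso [3,1,2,5,4,6,7] 0 11], [Iso [1,7,2,3,4,5,6] 0 2,
    Iso [1,2,3,4,5,7,6] 0 7,Iso [1,2,4,3,5,7,6] 0 7,Iso [2,3,4,1,5,7,6] 0 10,Iso [1,3,5,2,4,7,6] 0 7,Same 0 12,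
    Same 0 13,Iso [3,2,5,1,4,7,6] 0 10,Iso [1,3,2,5,4,6,7] 0 13,Iso [1,4,5,2,3,7,6] 0 7,Iso [1,2,4,3,5,6,7] 0 12,
    Iso [1,2,4,3,5,6,7] 0 13,Iso [1,3,5,2,4,6,7] 0 13,Iso [4,2,5,1,3,7,6] 0 10,Iso [1,4,2,5,3,6,7] 0 13,Iso [1,4,5,2,
    3,6,7] 0 13,Iso [5,3,4,1,2,7,6] 0 10,Iso [1,5,3,4,2,6,7] 0 13,Iso [1,5,4,3,2,6,7] 0 13], [Iso [1,2,7,3,4,5,6] 0 4,
    Same 0 14,Same 0 15,Same 1 0,Same 1 1,Same 1 2,Iso [2,1,3,4,5,6,7] 1 1,Iso [2,1,3,4,5,6,7] 1 2,Same 1 3,Same 1 4,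
    Same 1 5,Iso [2,1,3,4,5,6,7] 1 3,Iso [2,1,3,4,5,6,7] 1 4,Iso [2,1,3,4,5,6,7] 1 5,Same 1 6,Same 1 7,Same 1 8,
    Same 1 9], [Iso [1,7,2,3,4,5,6] 0 5,Iso [1,3,2,4,6,7,5] 1 1,Iso [1,3,4,2,6,7,5] 1 3,Iso [1,2,3,4,5,7,6] 1 1,
    Same 1 10,Iso [1,2,4,3,5,7,6] 1 3,Iso [1,3,2,4,6,5,7] 1 10,Same 1 11,Same 1 12,Same 1 13,Same 1 14,Iso [1,3,2,4,6,
    5,7] 1 14,Same 1 15,Same 2 0,Same 2 1,Same 2 2,Iso [1,3,2,4,6,5,7] 2 2,Same 2 3,Same 2 4,Same 2 5,Same 2 6,
    Same 2 7,Same 2 8,Iso [1,3,2,4,6,5,7] 2 4,Iso [1,3,2,4,6,5,7] 2 7,Iso [1,3,2,4,6,5,7] 2 5,Iso [1,3,2,4,6,5,7] 2 6,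
    Iso [1,3,2,4,6,5,7] 2 8], [Iso [1,7,2,3,4,5,6] 0 6,Iso [1,2,3,4,5,7,6] 1 2,Same 2 9,Iso [2,3,1,4,7,5,6] 1 14,
    Same 2 10,Iso [1,4,2,3,7,5,6] 2 2,Same 2 11,Same 2 12,Iso [2,1,4,3,5,7,6] 2 7,Same 2 13,Same 2 14,Same 2 15],
     [Iso [7,1,2,3,4,5,6] 0 7,Iso [1,2,3,4,5,7,6] 1 5,Iso [2,1,4,3,5,7,6] 1 5,Same 3 0,Iso [2,1,4,3,5,6,7] 3 0,Iso [1,
    2,3,4,5,7,6] 2 3,Iso [1,2,3,4,5,7,6] 2 12,Same 3 1,Iso [2,1,4,3,5,7,6] 2 3,Iso [2,1,4,3,5,7,6] 2 12,Iso [2,1,4,3,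
    5,6,7] 3 1,Same 3 2,Same 3 3,Same 3 4,Iso [2,1,4,3,5,6,7] 3 4], [Iso [7,1,2,3,4,5,6] 0 8,Iso [3,4,1,2,6,7,5] 1 6,
    Iso [3,4,2,1,6,7,5] 1 6,Iso [1,2,3,4,5,7,6] 1 6,Same 3 5,Iso [2,1,3,4,5,6,7] 3 5,Iso [1,2,4,3,5,7,6] 1 6,Iso [1,2,
    4,3,5,6,7] 3 5,Iso [2,1,4,3,5,6,7] 3 5,Iso [1,3,2,4,7,5,6] 2 4,Iso [3,4,1,2,6,7,5] 2 14,Iso [1,2,3,4,5,7,6] 2 14,
    Same 3 6,Iso [2,3,1,4,7,5,6] 2 4,Iso [3,4,2,1,6,7,5] 2 14,Iso [2,1,3,4,5,7,6] 2 14,Iso [2,1,3,4,5,6,7] 3 6,Iso [1,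
    4,2,3,7,5,6] 2 4,Iso [4,3,1,2,6,7,5] 2 14,Iso [1,2,4,3,5,7,6] 2 14,Iso [1,2,4,3,5,6,7] 3 6,Iso [1,2,3,4,5,7,
    6] 3 3,Iso [2,4,1,3,7,5,6] 2 4,Iso [4,3,2,1,6,7,5] 2 14,Iso [2,1,4,3,5,7,6] 2 14,Iso [2,1,4,3,5,6,7] 3 6,Iso [1,2,
    4,3,5,7,6] 3 3], [Iso [7,1,2,3,4,5,6] 0 9,Iso [1,2,4,3,5,7,6] 1 8,Iso [1,3,2,4,7,5,6] 2 5,Iso [1,2,3,4,5,7,
    6] 2 15,Iso [2,3,1,4,7,5,6] 2 5,Iso [2,1,3,4,5,7,6] 2 15,Iso [1,4,2,3,7,5,6] 2 6,Iso [1,2,3,4,5,7,6] 3 4,Iso [2,4,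
    1,3,7,5,6] 2 6,Iso [2,1,3,4,5,7,6] 3 4], [Iso [7,1,2,3,4,5,6] 0 12,Same 3 7,Iso [2,1,3,4,6,5,7] 3 7,Iso [3,4,1,2,
    5,6,7] 3 7,Iso [4,3,1,2,6,5,7] 3 7,Iso [1,2,3,4,7,5,6] 3 2,Same 3 8,Iso [1,2,4,3,6,5,7] 3 8,Iso [3,4,1,2,7,5,
    6] 3 2,Iso [3,4,1,2,5,6,7] 3 8,Iso [3,4,2,1,6,5,7] 3 8,Same 3 9], [Iso [1,7,2,3,4,5,6] 0 14,Same 3 10,Same 3 11,
    Same 3 12,Same 3 13,Same 3 14,Same 3 15,Same 4 0,Same 4 1,Same 4 2], [Iso [1,7,2,3,4,5,6] 0 15,Iso [1,3,2,4,6,7,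
    5] 3 12,Iso [1,2,3,4,5,7,6] 3 12,Same 4 3,Same 4 4,Same 4 5,Same 4 6,Iso [1,3,2,4,6,5,7] 4 5,Iso [1,3,2,4,6,5,
    7] 4 6], [Iso [1,7,2,3,4,5,6] 1 0,Same 4 7,Same 4 8,Same 4 9,Same 4 10,Same 4 11], [Iso [7,1,2,3,4,5,6] 1 1,
    Same 4 12,Same 4 13,Iso [1,2,3,4,5,7,6] 3 14,Same 4 14,Iso [1,2,3,4,5,7,6] 4 5,Same 4 15,Same 5 0,Iso [1,2,3,4,5,
    7,6] 4 9,Same 5 1,Same 5 2,Same 5 3,Same 5 4,Same 5 5,Same 5 6], [Iso [7,1,2,3,4,5,6] 1 2,Iso [1,2,3,4,5,7,6] 4 0,
    Same 5 7,Same 5 8,Same 5 9,Same 5 10,Same 5 11], [Iso [7,1,2,3,4,5,6] 1 3,Iso [3,1,2,6,7,4,5] 4 13,Same 5 12,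
    Iso [1,2,3,4,5,7,6] 4 1,Same 5 13,Same 5 14,Iso [1,3,2,4,7,5,6] 4 5,Same 5 15,Iso [1,2,3,4,5,7,6] 4 11,Same 6 0,
    Same 6 1,Iso [1,2,3,4,5,7,6] 5 4,Same 6 2,Iso [1,2,3,4,5,7,6] 5 10]]"

lemma check6_0: "check_step 6 level7 diagrams6_0 certs6_0"
  by code_simp

definition certs6_1 :: "certificate list list" where "certs6_1 =
   [[Iso [7,1,2,3,4,5,6] 1 4,Same 6 3,Iso [1,3,2,4,7,5,6] 4 6,Same 6 4,Iso [1,2,3,4,5,7,6] 5 6,Same 6 5,Iso [1,2,3,4,5,7,
    6] 5 11], [Iso [7,1,2,3,4,5,6] 1 10,Iso [2,1,3,5,7,4,6] 4 15,Iso [1,3,2,4,7,5,6] 5 15,Same 6 6,Same 6 7,Same 6 8,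
    Same 6 9], [Iso [7,1,2,3,4,5,6] 1 11,Iso [2,1,3,5,7,4,6] 5 0,Iso [1,2,3,4,7,5,6] 5 0,Same 6 10,Same 6 11,
    Same 6 12,Iso [2,1,3,5,4,6,7] 6 12], [Iso [7,1,2,3,4,5,6] 1 12,Same 6 13,Iso [2,1,3,5,7,4,6] 5 2,Iso [2,3,1,5,7,4,
    6] 6 1,Iso [1,2,3,4,7,5,6] 5 2,Iso [1,2,3,4,5,7,6] 6 7,Iso [1,3,2,4,7,5,6] 6 1,Iso [2,1,3,5,4,7,6] 6 7,Iso [1,2,3,
    4,5,7,6] 6 10,Same 6 14,Same 6 15,Same 7 0,Iso [2,1,3,5,4,6,7] 7 0], [Iso [7,1,2,3,4,5,6] 2 1,Iso [3,1,2,6,7,4,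
    5] 5 4,Iso [3,2,1,6,7,5,4] 5 4,Iso [2,1,3,5,7,4,6] 5 4,Iso [2,3,1,5,6,7,4] 6 11,Iso [3,2,1,6,5,7,4] 6 8,Iso [2,3,
    1,5,6,7,4] 6 14,Iso [2,3,1,5,7,6,4] 5 4,Iso [2,3,1,5,6,7,4] 6 8,Iso [1,2,3,4,7,5,6] 5 4,Iso [3,1,2,6,4,7,5] 6 8,
    Iso [1,3,2,4,6,7,5] 6 11,Iso [1,2,3,4,5,7,6] 6 8,Same 7 1,Iso [1,3,2,4,7,6,5] 5 4,Iso [1,3,2,4,6,7,5] 6 8,Iso [2,
    1,3,5,4,7,6] 6 8,Iso [1,3,2,4,6,5,7] 7 1,Iso [1,2,3,4,5,7,6] 6 11,Iso [1,3,2,4,6,7,5] 6 14,Iso [1,2,3,4,5,7,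
    6] 6 14,Same 7 2], [Iso [7,1,2,3,4,5,6] 2 2,Same 7 3,Iso [2,3,1,5,7,6,4] 5 10,Iso [1,2,3,4,7,5,6] 5 5,Iso [1,2,3,
    4,5,7,6] 6 9,Iso [1,3,2,4,7,5,6] 6 2,Iso [1,2,3,4,5,7,6] 6 12,Same 7 4,Iso [1,2,3,4,5,7,6] 7 0,Same 7 5], [Iso [7,
    1,2,3,4,5,6] 2 9,Same 7 6,Same 7 7,Iso [1,2,3,4,7,5,6] 5 8,Same 7 8,Iso [3,1,2,7,4,5,6] 7 3,Same 7 9,Same 7 10],
     [Iso [7,1,2,3,4,5,6] 2 11,Same 7 11,Same 7 12,Iso [1,3,2,4,6,7,5] 7 10,Iso [1,2,3,4,5,7,6] 7 10,Same 7 13],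
     [Iso [7,1,2,3,4,5,6] 3 10,Same 7 14,Same 7 15,Same 8 0,Same 8 1,Same 8 2], [Iso [7,1,2,3,4,5,6] 3 11,Same 8 3,
    Iso [1,2,3,4,5,7,6] 7 15,Same 8 4,Same 8 5], [Iso [7,1,2,3,4,5,6] 3 12,Same 8 6,Iso [1,2,3,4,5,7,6] 8 1,Same 8 7,
    Iso [1,2,3,4,5,7,6] 8 4,Same 8 8], [Iso [7,1,2,3,4,5,6] 3 13,Iso [1,2,3,4,5,7,6] 8 5,Same 8 9], [Iso [7,1,2,3,4,5,
    6] 4 3,Same 8 10,Iso [2,1,3,5,4,6,7] 8 10,Same 8 11], [Iso [7,1,2,3,4,5,6] 4 4,Same 8 12,Iso [2,1,3,5,7,4,6] 8 8,
    Iso [2,1,3,5,4,6,7] 8 12,Same 8 13,Iso [1,2,3,4,7,5,6] 8 8,Iso [2,1,3,5,4,6,7] 8 13,Iso [1,2,3,4,5,7,6] 8 11],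
     [Iso [7,1,2,3,4,5,6] 4 7,Same 8 14,Same 8 15], [Iso [7,1,2,3,4,5,6] 4 8,Same 9 0,Same 9 1,Iso [1,2,3,4,5,7,
    6] 8 15,Same 9 2]]"

lemma check6_1: "check_step 6 level7 diagrams6_1 certs6_1"
  by code_simp

lemma check_level6: "\<exists>C. check_step 6 level7 (level6 a) C"
  unfolding level6_def using check_step_Nil check6_0 check6_1
  by (simp split: if_split) blast

definition certs7_0 :: "certificate list list" where "certs7_0 =
   [[Same 0 7], [], [Lin [4,6,7] [],Lin [5,6,7] []], [Lin [2,4] [3,5,8],Lin [2,5] [3,6,7],Lin [2,3] [4,5,8],Lin [2,3] [4,
    5,8],Lin [2,5] [4,6,7],Lin [2,5] [4,6,7],Lin [3,4] [5,6,7],Lin [3,4] [5,6,7]], [Lin [6,7,8] []], [Lin [4,6] [],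
    Iso [5,3,4,1,2,7,6,8] 0 6], [Lin [4,6,8] [],Lin [5,6,7] []], [Lin [2] [5,6],Lin [3] [4,6],Lin [2,3,7] [],Lin [2,3,
    7] []], [Lin [4,6] [],Lin [4,6] [],Lin [5,6] [],Lin [5,6] []], [Lin [2,3,8] [],Lin [2,3,8] []], [Lin [4,6] [],
    Lin [4,6,8] [],Lin [4,6] [],Lin [4,6,8] []], [Lin [4,6] [],Lin [5,6,7] [],Lin [3,4,5,7,8] [],Lin [4,6] [],Lin [5,
    6,7] [],Lin [2,4,5,7,8] []], [Lin [3,5,6] [],Lin [3,6] [5],Lin [2,7] [5],Lin [3] [5,6],Lin [3] [4,7],Lin [3,4,7,
    8] [],Lin [3,5,6,8] [],Lin [2,5,7,8] [],Lin [3,5,6,8] [],Lin [4,5,6,7] []], [Lin [2,5,7] [3,6],Lin [4,5,6,7] [],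
    Lin [2,7] [5],Lin [4,5,6,7] [],Lin [4,5,6,7] []], [Lin [6,7,8] [],Lin [5,6,7,8] []], [Lin [5,6,7,8] [],Lin [4,6,
    8] []]]"

lemma check7_0: "check_step 7 level8 diagrams7_0 certs7_0"
  by code_simp

definition certs7_1 :: "certificate list list" where "certs7_1 =
   [[Lin [5,6,7] [],Lin [4,5,7,8] [],Lin [5,6,7,8] []], [Lin [2,7] [],Lin [2,7,8] []], [Lin [4,5,7,8] [],Lin [4,5,
    7] [6]], [Lin [2,7] [],Lin [2,7] []], [Lin [2,7,8] [],Lin [2,6,7,8] [],Lin [4,5,8] [6]], [Lin [1,2,7] [],Lin [1,2,
    7] []], [Lin [1,7] [],Lin [2,7] []], [Lin [1,2,8] [],Lin [1,2,8] []], [], [Lin [1,2,8] [],Lin [1,2,8] []],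
     [Lin [3,8] [4,6,7],Lin [3,5,8] [],Lin [2,6,8] []], [Lin [3,5] [],Lin [3,5,8] [],Lin [2,6,8] [],Lin [3,5,8] []],
     [Iso [4,2,3,1,8,6,5,7] 0 6,Same 1 0,Lin [3,5,7] [],Lin [3,5,7] [],Lin [3,5,7] [],Lin [3] [4,6,8],Lin [3,5,7] [],
    Lin [2,6,7] []], [Lin [3,5] [],Lin [3,5] [],Lin [1,7] [],Lin [2,6] []], [Lin [3,5] [],Lin [2,6] [],Lin [3,5] [],
    Lin [3,5] []], [Lin [4,5,6,7] [],Lin [2,6] [],Lin [3,5] [],Lin [4,5,6,7] []]]"

lemma check7_1: "check_step 7 level8 diagrams7_1 certs7_1"
  by code_simp

definition certs7_2 :: "certificate list list" where "certs7_2 =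
   [[Lin [3,5,7,8] [],Lin [4,5,6,7] [],Lin [4,5,6,7] [],Lin [2,6,7] [],Lin [2,6] [3,5,8],Lin [2,6,7,8] [],Lin [3,5,7] [],
    Lin [4,5,6,7] [],Lin [4,5,6,7] [],Lin [2,6,8] [3,5]], [Lin [3,7] [4,6,8],Lin [3,7,8] [4,6],Iso [2,3,4,1,7,6,5,
    8] 0 5], [Lin [2,6,7] [],Lin [2,6,7] [],Lin [2] [3,5],Lin [3,5,8] [],Lin [4,5,6,8] []], [Lin [1,5] [4,6],
    Lin [1] [4,6],Lin [1,6] [4,5],Lin [1] [4,5],Lin [3,4,6,7,8] [],Lin [2,4,5,7,8] []], [Lin [2,6] [],Lin [2,6] [],
    Lin [1,7] [],Lin [2,6] []], [Lin [4,5,6,8] [],Lin [4,5,6,8] [],Lin [4,5,6,8] [],Lin [1] [3,5],Lin [1,3,5,8] [],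
    Lin [1,8] [3,5]], [Lin [2,6] [],Lin [4,5,6,8] [],Lin [1,3,5,8] [],Lin [1,8] [3,5],Lin [2,3,7,8] [4]], [Lin [2,
    6] [],Lin [2,6] [],Lin [2,6] [],Lin [2,6,8] [],Same 1 1,Lin [3,5,7] []], [Lin [2,6] [],Lin [2,6] [3,5,7],Lin [3,4,
    6,7,8] [],Lin [3,5,7] [],Lin [2,3,7,8] [4],Lin [1,1,4,6,7,8,8] [3]], [Lin [3,5,7] [],Lin [3,5,7,8] [],Same 1 2,
    Lin [4,5,6,7,8] [],Lin [3,5,7,8] [],Lin [4,5,6,7] []], [Same 1 3,Lin [1,2,6,7,8] [],Lin [4,5,6,7] [],Lin [1,3,5,7,
    8] [],Lin [4,5,6,7] []], [Lin [4,5,6] [],Lin [2,5,6,7,8] [],Lin [4,5,6,8] [],Lin [4,5,6,8] [],Lin [4,5,6,8] [],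
    Lin [4,5,6,8] []], [Lin [1,7,8] [],Lin [3,4,6,7,8] [],Lin [1,2,7,8] [],Lin [1,4,5,6,8] [],Lin [1,8] [4,5,6]],
     [Lin [4,5,6,8] [],Lin [3,5,7,8] [],Lin [3,4,6,7,8] [],Same 1 4], [Lin [1,7] [],Lin [1,7] [],Lin [3,5] [],Lin [1,
    7] [],Lin [1,7] [],Lin [2,2,3,6,8] [4,7],Lin [4,5,6] []], [Lin [4,5,6,8] [],Lin [1,7] [4,5,6]]]"

lemma check7_2: "check_step 7 level8 diagrams7_2 certs7_2"
  by code_simp

definition certs7_3 :: "certificate list list" where "certs7_3 =
   [[Same 1 5,Lin [2] [3,5,8],Lin [2,6,7] [],Lin [2,6] [4,5],Lin [2,8] [3,5],Lin [2,8] [3,5]], [Lin [1] [4,5],Lin [2] [3,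
    5,7],Lin [1,2,6,7] [],Lin [3,3,4,5,5,5,7] [1,1,2,2,2,6],Lin [1,2,6,7] [],Lin [1,2,6,7] []], [Lin [3,4,6,7,8] [],
    Lin [3,4,6,7,8] [],Lin [3,4,6,7,8] [],Lin [3,4,6,7,8] [],Lin [2,6] [4,5],Lin [2,6] [4,5],Lin [2,6] [4,5],Lin [1,
    7] [4,5],Lin [1,7] [4,5],Lin [1,7] [4,5],Lin [1,2,6,7] [],Lin [1,2,6,7] []], [Lin [3,4,6] [5],Lin [3,4,6] [5],
    Lin [2,7] [3],Lin [3,4,6] [5],Lin [3,4,6] [5],Lin [1,7] [4],Lin [3,6] [4],Lin [3] [4,6],Lin [2,7,8] [3,5],Lin [2,
    7] [3,5,8]], [Lin [1,2,6] [],Lin [1,6] [2],Lin [1,6] [2],Lin [2,7] [3,5],Lin [1,7] [4,5],Lin [1,7] [4,5,8],Lin [1,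
    2,6,8] [],Lin [3,4,6,8] [5],Lin [1,2,6,8] [],Lin [1,2,6,8] []], [Lin [3,4] [5],Lin [1,3,8] [2,4,7],Lin [2,6] [],
    Lin [4,5] [],Lin [3,4,8] [5],Lin [3,4,8] [5]], [Lin [3,5] [],Lin [1,3,7] [2,4,8],Lin [3,5] [],Lin [1,6] [],Lin [2,
    6,7] [3,5],Lin [4,5,7] [],Lin [3,5,8] [],Lin [2,3,3,5,5,6,7,8,8] []], [Lin [2,5] [4],Iso [3,4,1,2,5,6,7,8] 0 4,
    Lin [2,6,8] [3],Lin [2,5,8] [4],Lin [1,3,5,7,8] [],Lin [1,4,6,7,8] [],Lin [1,2,5,6,7,8] [],Lin [1,4,6,7,8] []],
     [Lin [2,3,6,7] [],Lin [1,3,5,7,8] [],Lin [2,3,6,7,8] [],Lin [3,4,5,6,7,8] [],Lin [1,3,5,7,8] [],Lin [2,3,6,7,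
    8] []], [Lin [3,4,5,6] [],Lin [2,4,5,7,8] [],Lin [1,4,6,7,8] [],Lin [3,4,5,6,8] [],Lin [3,4,5,6,8] [],Lin [1,4,6,
    7,8] [],Lin [1,4,6,7,8] [],Lin [1,4,6,7,8] [],Lin [2,4,5,7,8] [],Lin [2,4,5,7,8] [],Lin [2,4,5,7,8] [],Lin [3,4,5,
    6,8] [],Lin [3,4,5,6,8] [],Lin [3,4,5,6,8] [],Lin [3,4,5,6,8] [],Lin [3,4,5,6,8] [],Lin [3,4,5,6,8] []], [Lin [5,
    6,7,8] [],Lin [4,5,6,7,8] []], [Lin [5,6,7] [],Lin [5,6,7,8] [],Lin [3,4,8] [5]], [Lin [4,5,6,7,8] []], [Lin [4,5,
    6,7] [],Lin [3,4,7] [5],Lin [4,5,6,7,8] []], [Lin [1,7] [],Lin [1,7] [],Lin [1,7,8] []], [Lin [1,5,6,7,8] [],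
    Lin [1,5,6,7,8] []]]"

lemma check7_3: "check_step 7 level8 diagrams7_3 certs7_3"
  by code_simp

definition certs7_4 :: "certificate list list" where "certs7_4 =
   [[Lin [3,4,7,8] [5],Lin [2,4,5,6,8] []], [Lin [1,7] [],Lin [1,7] [],Lin [1,7] []], [Lin [1,7,8] [],Lin [1,5,6,7,8] [],
    Lin [2,4,5,6,7] []], [Lin [4,5,6,7] [],Lin [2,4,5,7,8] [],Lin [3,4,6,7,8] [],Lin [4,5,6,7,8] []], [Lin [3,5,7] [],
    Same 1 6,Iso [1,3,2,4,6,5,7,8] 1 6,Lin [2,6] [3,5,8],Lin [2,6,8] [3,5],Lin [4,5,6,7,8] []], [Lin [1,7] [],Lin [1,
    7] []], [Lin [3,4,6,7,8] [],Lin [3,4,6,7] [5]], [Lin [3,4,6,7] [],Lin [3,4,6,7,8,8] [],Iso [3,2,1,4,5,6,8,7] 0 1],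
     [Lin [4,5,6,7] [],Lin [4,5,6,7,8] [],Lin [2,6] [3,5,8],Iso [3,2,1,4,5,6,7,8] 0 1,Same 1 7], [Lin [1,7] [],Lin [1,
    7] [],Lin [1] [3,4,6],Lin [4,5,6] []], [Same 2 0], [Lin [1,7] [],Lin [1,7] [],Lin [3,4,6,8] [],Lin [4,5,6] []],
     [Same 2 1], [Lin [1,6] [7]], [Lin [1,5,5,7] [3,4,8],Lin [2,4,8] [],Lin [1,6,8] []], [Lin [1,5,5,8] [3,4,7],
    Lin [2] [4,5],Lin [2,4,5,8] [],Lin [2,4,5,8] [],Lin [2,4,5,8] []]]"

lemma check7_4: "check_step 7 level8 diagrams7_4 certs7_4"
  by code_simp

definition certs7_5 :: "certificate list list" where "certs7_5 =
   [[Lin [2,4,5,8] [],Lin [2,4,5,8] []], [Lin [1,6] [],Lin [1,6,8] [],Lin [1,6,8] []], [Lin [2,4,7] [],Same 2 2,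
    Lin [1] [3,4,8],Lin [1,6,7] [],Lin [1,6,7] []], [Lin [1,6,7] [],Lin [1,6,7,8] [],Lin [1,6,7,8] [],Lin [2,4,5,
    7] [],Lin [2,4,5,7] [],Lin [1,6,7,8] [],Lin [2,4,5,7] []], [Lin [1,6] [2,4,5,8]], [Lin [1,6,7] [],Lin [2,4,5,
    8] [],Lin [4,5,8] [],Lin [1,6,7] [],Lin [2,4,5,8] []], [Lin [1,6] [2],Lin [1,5,6,7,8] [],Lin [2,4,5,7,8,8] [],
    Lin [2,4,5,7] [],Lin [2,4,5,7] [],Lin [1,6,8] [],Lin [1,6,7,8] []], [Same 2 3,Iso [3,2,1,4,6,5,8,7] 0 2,Lin [3,4,
    5,5,6,7,7,8] [],Lin [1,1,2,6] [3,5,8],Lin [1,4,5,6,7,8] []], [Lin [3,4,6,7,8] [],Iso [3,2,1,4,6,5,7,8] 0 2,Lin [1,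
    6,7,8] [],Lin [3,4,6,7] [5]], [Lin [3,4,6,7] [],Lin [2,4,5,7,8] [],Lin [3,4,6,7,8] [],Lin [3,4,5,5,6,7,8,8] [],
    Lin [2,4,5,7,8] [],Lin [2,4,5,7,8] []], [Lin [3,4,6] [5],Lin [3,4,6] [5],Lin [3,4,5,5,6,8,8] []], [Lin [3,4,
    6] [5],Lin [3,4,6,8] [5],Lin [3,4,6] [5],Lin [1,4,5,6,7,8] [],Lin [3,4,6,8] [5],Lin [3,4,6,8] [5],Lin [3,4,6,
    8] [5]], [Lin [3,4] [5],Lin [3,4] [5],Lin [1,6] [7]], [Lin [3,4] [5],Lin [1,8] [2,4,5,7],Lin [1,6,8] [],Lin [1,5,
    6,7,8] [],Lin [3,4,8] [5]], [Lin [1,6] [],Lin [1,6,8] [],Lin [1,6,8] [],Lin [3,4,8] [5]], [Lin [1,7] [2,4,5,8]]]"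

lemma check7_5: "check_step 7 level8 diagrams7_5 certs7_5"
  by code_simp

definition certs7_6 :: "certificate list list" where "certs7_6 =
   [[Lin [1,6] [],Lin [1,6,8] [],Lin [1,6,8] []], [Lin [3,4,7,8] [],Lin [1,6,7] [],Lin [1,6,7] [],Same 2 4,Lin [1] [2,4,
    5],Lin [3,4,7,8] [],Lin [1,6,7] [],Lin [1,6,7,8] []], [Lin [1,6,7] [],Lin [4,5,8] [],Lin [1,6,7] [],Lin [1,6,7,
    8] []], [Lin [3,4,8] [5],Lin [3,4,8] [5]], [Lin [1,6,7] [],Lin [3,4,7] [5],Lin [1,6,7,8] [],Lin [2,4,5,6,7,8] [],
    Lin [1,5,6,7,8] [],Lin [3,4,7,8] [5]], [Lin [1,5,6,7] [],Lin [1,5,6,7,8] []], [Lin [2,7] [3,5,6],Lin [2] [3,5,6,7,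
    7,8],Lin [2,7] [3,5,6]], [Lin [2,4,7] [],Lin [2,4,7,8] [],Lin [1,5,7,8] [],Lin [2,8] [3,5,6],Lin [2,4,7,8] [],
    Lin [1,5,7,8] []], [Lin [1,5,7,8] [],Lin [1,3,6,8] [2],Lin [2,7,8] [],Lin [3,5,6] [],Lin [2,7,8] [3,5,6],Lin [2,4,
    7,8] [],Lin [2,4,7,8] []], [Lin [1,5,7] [],Lin [2,4,5,6,7,8] [],Lin [1,5,7,8] [],Lin [1,5,7,8] [],Lin [1,4,4,
    6] [2,2,3,7],Lin [1,5,7,8] [],Lin [1,5,7,8] [],Lin [1,5,7,8] []], [Lin [2,4,7] [],Lin [2,4,7,8] [],Lin [1,5,7,
    8] [],Lin [2,4,7,8] [],Lin [3,4,5,6,7,8] [],Lin [1,5,7,8] [],Lin [2,4,7,8] [],Lin [3,4,5,6,7,8] [],Lin [2,4,7,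
    8] [],Lin [1,5,7,8] [],Lin [2,4,7,8] []], [Lin [3,4,5,6] [],Lin [3,4,5,6] [],Lin [2,4,7,8] [],Lin [3,4,5,6] [],
    Lin [3,4,5,6] [],Lin [2,4,7,8] [],Lin [2,4,7,8] []], [Lin [1,5,7] [],Lin [1,5,7,8] [],Lin [1,5,7,8] [],Lin [1,5,7,
    8] [],Lin [1,5,7,8] []], [Iso [8,1,2,3,4,5,6,7] 1 0,Same 2 5,Iso [2,1,3,5,4,6,7,8] 2 5,Lin [2] [3,5,7],Lin [2] [3,
    5,7],Lin [1] [3,4,7],Lin [2,4,6,7] [],Lin [1] [3,4,7],Lin [2,4,6,7] [],Lin [2,4,6,7] [],Lin [2,4,6,7] [],Lin [1,5,
    6,7] []], [Lin [2,4,6,8] [],Lin [1,5,6,8] [],Lin [3,4,5,6] [],Lin [2,4,6] [],Lin [3,4,5,6] [],Lin [1,5,6] [],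
    Lin [3,4,5,6] [],Lin [2,7] [3,5,8],Lin [3,4,5,6] [],Lin [2,7,8] [3,5]], [Lin [2] [3,5,7],Lin [1] [3,4,7],
    Lin [2] [3,5,7],Lin [1] [3,4,7,8],Lin [1,5,6,7,8] [],Lin [2] [3,5,7,8],Lin [2,4,6,7] [],Lin [2,4,6,7,8] [],Lin [2,
    4,6,7] [],Lin [2,4,6,7] []]]"

lemma check7_6: "check_step 7 level8 diagrams7_6 certs7_6"
  by code_simp

definition certs7_7 :: "certificate list list" where "certs7_7 =
   [[Lin [2,4,6] [],Lin [2,4,6,8] [],Lin [2,4,6,8] [],Lin [1,5,6,7] [],Lin [1,5,6,7] []], [Lin [2,6] [3,5,7],Lin [1,5,
    8] [2,4,7],Lin [2,6] [3,5,7],Lin [2,6,8] [3,5,7],Lin [1,6,7] [3,4,8],Same 2 6,Lin [2,6] [3,5,7],Lin [2,6] [3,5,7],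
    Lin [2,6] [3,5,7]], [Iso [1,2,3,8,6,5,4,7] 0 5,Same 2 7,Iso [2,1,3,5,4,6,7,8] 2 7,Iso [3,1,2,6,4,5,7,8] 2 7,
    Lin [1,5] [2,4],Lin [1,5] [2,4],Lin [1,6] [3,4],Lin [3,4,5,7] [],Lin [3,4,5,7] [],Lin [1,6] [3,4],Lin [3,4,5,
    7] [],Lin [2,6] [3,5],Lin [3,4,5,7] [],Lin [3,4,5,7] [],Lin [2,4,6,7] [],Lin [2,6] [3,5,8],Lin [2,6] [3,5],Lin [3,
    4,5,7] [],Lin [2,4,6,7] [],Lin [2,6,8] [3,5],Lin [2,4,6,7] []], [Lin [2,4,6,7,8] [],Lin [1,5,6,7] [],Lin [3,4,5,7,
    8] [],Lin [1,5,6,7] []], [Lin [1] [2,4],Same 3 0,Lin [1,5,6,7] [],Lin [1,5,6,7] []], [Lin [3,4,5,7] [],Lin [2,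
    6] [3,5],Lin [1,5] [2,4],Same 3 1,Lin [2,4,6,7,8] [],Lin [1,5,6,7] [],Lin [3,4,5,7,8] [],Lin [1,5,6,7] []],
     [Lin [2,4,6,7] [],Lin [2] [3,5,7],Same 3 2,Lin [3,4,5,6,7,7,8] [],Lin [2,4,6,7,8] []], [Iso [8,1,2,3,4,5,6,
    7] 1 2,Same 3 3,Iso [1,2,3,4,5,6,8,7] 3 2,Lin [3,4,5,6,7,8] [],Lin [3,4,5,6,7,8,8] [],Lin [3,4,5,6,7] []],
     [Lin [3,4,5,6,7] [],Lin [3,4,5,6,7,8,8] [],Same 3 4,Lin [1,1,2,4,5,5,6,6,6,7,7,7,7,8,8,8] []], [Lin [2,4,6,7] [],
    Lin [1,5,6,7,8] [],Lin [3,4,5,6,7,7,8] [],Lin [1,1,2,3,3,3,4,4,4,4,5,5,5,5,5,6,6,6,6,6,6,7,7,7,7,7,7,7,7,7,8,8,8,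
    8,8,8,8] []], [Lin [3,4,5,6] [],Lin [2,4,6,7,8] [],Lin [2,4,6,7,8] [],Lin [3,4,5,6,7,7,8,8] [],Lin [3,4,5,6,
    8] []], [Lin [1,4,5,6,7] [],Lin [1,1,2,5,8] [3,6],Lin [1,4,5,6,7,8] [],Lin [1,1,3,6,8] [2,5],Lin [2,4,5,5,6,7,7,
    8] [],Lin [3,4,5,6,6,7,7,8] [],Iso [2,3,1,4,6,5,7,8] 0 3], [Lin [3,4,5,7] [],Lin [2,4,6,7,8] [],Lin [1,4,5,6,7,
    8] [],Lin [3,4,5,7,8] []], [Lin [3,4,5,7] [],Lin [3,4,5,7,8] [],Lin [2,4,6,7,8] [],Lin [2,4,6,7,8] [],Iso [2,3,1,
    4,6,5,8,7] 0 3,Lin [3,4,5,7,8] []], [Lin [5,6,7,8] [],Lin [4,5,6,7,8] [],Lin [3,4,5,6,7,8] []], [Lin [1,3,7,8] [],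
    Lin [2,3,8] [4,4,5,7]]]"

lemma check7_7: "check_step 7 level8 diagrams7_7 certs7_7"
  by code_simp

definition certs7_8 :: "certificate list list" where "certs7_8 =
   [[Lin [4,5,6,7] [],Lin [4,5,6,7,8] [],Lin [4,5,6,7,8] []], [Lin [3,4,5,6,7,8] []], [Lin [3,4,5,6,7] [],Lin [2,3,4,4,7,
    8] [5],Lin [2,3,7] [4,4,5,8],Lin [3,4,5,6,7,8] []], [Lin [4,5,6,7] [],Lin [1] [2,5,7],Same 3 5,Lin [4,5,6,7,8] [],
    Lin [1,1,3,6] [2,5,8],Lin [2,3,7,8] [4]], [Lin [2,3,7,8] [4],Lin [2,3,7,8] [4],Iso [2,1,3,4,7,5,8,6] 0 0],
     [Lin [2,3,7] [4],Lin [2,3,7,8] [4],Lin [2,3,7,8] [4],Lin [1,7] [2,4,5,5,6]], [Lin [3,4,5,6,7,8] []], [Lin [3,4,5,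
    6,7] [],Lin [1,3,4,5,7,8] [],Lin [2,3,6,7] [4],Lin [3,4,5,6,7,8] []], [Lin [1,5,5,6,8] [2,4],Lin [3,4,5,6,7,8] [],
    Lin [1,6,7,8] [],Iso [2,1,3,4,6,5,7,8] 0 0,Same 3 6], [Lin [3,4,5,6,7] [],Lin [1,5,5,6,8] [2,4],Lin [3,4,5,6,7,
    8] [],Lin [1,5,5,6] [2,4,8],Lin [1,6] [2,4,5,5,8],Lin [1,6] [2,4,5,5,8]], [Lin [1,3,4,6,7] [],Lin [2,3,5,6,7,7,
    8] [],Lin [1,5,6,6,7] [2,4]], [Lin [3,4,5,6,7] [],Lin [3,4,5,6,7,8] [],Lin [3,4,5,6,7,8] [],Lin [1,5,6,6,8] [2,4],
    Lin [1,5,6,6,8] [2,4],Lin [1,5,6,6,8] [2,4],Lin [1,5,6,6] [2,4,8],Lin [1,5] [2,4,6,6,8],Lin [1,5] [2,4,6,6,8]],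
     [Iso [8,1,2,3,4,5,6,7] 1 6,Same 3 7,Same 4 0,Lin [1,5,7] [2,4,8],Lin [1,5,7,8,8] [2,4]], [Lin [1,5] [2,4,7],
    Lin [1,5] [2,4,7],Lin [1,5,8] [2,4,7],Lin [1,2,2,3,3,3,4,4,4,4,4,5,5,5,5,6,6,6,6,6,6,7,7,7,7,7,7,7,7,8,8,8,8,8,8,
    8] []], [Lin [2,3,5,6,7,7] [],Lin [2,3,5,6,7,7,8,8] [],Same 4 1,Same 4 2], [Iso [2,1,8,3,4,5,7,6] 0 1,Iso [1,2,3,
    4,5,6,8,7] 4 2,Same 4 3]]"

lemma check7_8: "check_step 7 level8 diagrams7_8 certs7_8"
  by code_simp

definition certs7_9 :: "certificate list list" where "certs7_9 =
   [[Lin [3,4,5,6,7] [],Lin [3,4,5,6,7,8] [],Same 4 4], [Lin [1,5] [2,4,7],Lin [1,5] [2,4,7],Same 4 5], [Iso [8,1,2,3,4,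
    5,6,7] 1 7,Same 4 6,Same 4 7,Same 5 0]]"

lemma check7_9: "check_step 7 level8 diagrams7_9 certs7_9"
  by code_simp

lemma check_level7: "\<exists>C. check_step 7 level8 (level7 a) C"
  unfolding level7_def using check_step_Nil check7_0 check7_1 check7_2 check7_3 check7_4 check7_5 check7_6 check7_7 check7_8 check7_9
  by (simp split: if_split) blast

section \<open>From the empty diagram to dimension 8\<close>

definition has_diagram_in :: "(nat \<Rightarrow> diagram list) \<Rightarrow> nat \<Rightarrow> (nat \<Rightarrow> nat \<Rightarrow> nat \<Rightarrow> real) \<Rightarrow> bool" where
  "has_diagram_in Q n c \<longleftrightarrow> (\<exists>c'. nice_equiv 8 c c' \<and> nice_alg 8 c' \<and> sorted_alg c' \<and>
     (\<exists>a. \<exists>D\<in>set (Q a). brackets n c' = set D))"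

lemma has_diagram_in_Suc:
  assumes "has_diagram_in Q n c" "\<And>a. \<exists>C. check_step n Q' (Q a) C" "\<exists>g. balanced 8 c g" "n \<le> 7"
    and m: "m = Suc n"
  shows "has_diagram_in Q' m c"
proof -
  obtain c' a D where c': "nice_equiv 8 c c'" "nice_alg 8 c'" "sorted_alg c'"
      "D \<in> set (Q a)" "brackets n c' = set D"
    using assms(1) unfolding has_diagram_in_def by blast
  \<comment> \<open>Each step may replace the algebra by an equivalent one, so the metric has to
    follow before the next step can be excluded by node equations.\<close>
  obtain g where "balanced 8 c' g"
    using balanced_nice_equiv[OF nice_equiv_sym[OF c'(1)] assms(3)] by blast
  from check_step_sound[where Q = Q and Q' = Q', OF assms(2,4) c'(2,3) this c'(5,4)]
  show ?thesis
    using nice_equiv_trans[OF c'(1)] unfolding has_diagram_in_def m by blast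
qed

lemma has_diagram_in_level8:
  assumes c: "nice_alg 8 c" "sorted_alg c" and g: "\<exists>g. balanced 8 c g"
  shows "has_diagram_in level8 8 c"
proof -
  have "nice_equiv 8 c c" by (rule nice_equiv_refl)
  \<comment> \<open>In a sorted algebra a bracket into node 0 would need sources below 0.\<close>
  moreover have "brackets 0 c = {}"
    using c(2) unfolding brackets_def sorted_alg_def by fastforce
  moreover have "[] \<in> set (level0 0)" by (simp add: level0_def diagrams0_0_def)
  ultimately have "has_diagram_in level0 0 c"
    using c unfolding has_diagram_in_def by (metis list.set(1))
  then have "has_diagram_in level1 1 c"
    by (rule has_diagram_in_Suc[OF _ check_level0 g]) simp_all
  then have "has_diagram_in level2 2 c"
    by (rule has_diagram_in_Suc[OF _ check_level1 g]) simp_all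
  then have "has_diagram_in level3 3 c"
    by (rule has_diagram_in_Suc[OF _ check_level2 g]) simp_all
  then have "has_diagram_in level4 4 c"
    by (rule has_diagram_in_Suc[OF _ check_level3 g]) simp_all
  then have "has_diagram_in level5 5 c"
    by (rule has_diagram_in_Suc[OF _ check_level4 g]) simp_all
  then have "has_diagram_in level6 6 c"
    by (rule has_diagram_in_Suc[OF _ check_level5 g]) simp_all
  then have "has_diagram_in level7 7 c"
    by (rule has_diagram_in_Suc[OF _ check_level6 g]) simp_all
  then have "has_diagram_in level8 8 c"
    by (rule has_diagram_in_Suc[OF _ check_level7 g]) simp_all
  then show ?thesis .
qed

section \<open>Jacobi identities and Ricci weights\<close>

lemma bracketsD:
  assumes "brackets n c = set D" "(i, j, k) \<in> set D"
  shows "c i j k \<noteq> 0" "i < j" "k \<le> n"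
  using assms(2) unfolding assms(1)[symmetric] brackets_def by auto

lemma bracketsI:
  assumes c: "nice_alg n c" and D: "brackets n c = set D" and "c i j k \<noteq> 0" "i < j"
  shows "(i, j, k) \<in> set D"
  using assms(3,4) nice_alg_supported[OF c assms(3)] unfolding D[symmetric] brackets_def by simp

text \<open>The nodes and brackets are spelled out as explicit lists so that, for a concrete
  diagram, simplification yields eight linear equations that \<open>linarith\<close> can
  use.\<close>

lemma node_equations:
  assumes c: "nice_alg 8 c" and D: "brackets 8 c = set D" and g: "balanced 8 c g"
  shows "\<forall>v\<in>set [1,2,3,4,5,6,7,8]. (\<Sum>(i, j, k)\<leftarrow>remdups D.
    ricci_weight c g i j k * (of_bool (k = v) - of_bool (i = v) - of_bool (j = v))) = 0"
proof
  fix v :: nat assume "v \<in> set [1,2,3,4,5,6,7,8]"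
  then have v: "v \<in> {1..8}" by auto
  then have "balance 8 c g v = 0" using g by (simp add: balanced_def)
  then show "(\<Sum>(i, j, k)\<leftarrow>remdups D.
    ricci_weight c g i j k * (of_bool (k = v) - of_bool (i = v) - of_bool (j = v))) = 0"
    unfolding balance_eq_sum_brackets[OF nice_alg_imp_supported[OF c] nice_alg_antisym[OF c] v] D by (simp add: sum.set_conv_list)
qed

lemma weights_nonzero:
  assumes c: "nice_alg 8 c" and D: "brackets 8 c = set D" and g: "balanced 8 c g"
  shows "\<forall>(i, j, k)\<in>set D. ricci_weight c g i j k \<noteq> 0"
proof (clarify)
  fix i j k assume "(i, j, k) \<in> set D" and 0: "ricci_weight c g i j k = 0"
  then have "c i j k \<noteq> 0" using bracketsD[OF D] by blast
  then show False
    using 0 nice_alg_supported[OF c \<open>c i j k \<noteq> 0\<close>] g by (simp add: ricci_weight_def balanced_def diag_metric_def)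
qed

lemma sum_bracket_compose:
  assumes c: "nice_alg n c" and v: "c x y v \<noteq> 0"
  shows "(\<Sum>u\<in>{1..n}. c x y u * c z u m) = c x y v * c z v m"
proof -
  have "(\<Sum>u\<in>{1..n}. c x y u * c z u m) = (\<Sum>u\<in>{1..n}. if u = v then c x y v * c z v m else 0)"
    by (intro sum.cong refl) (use nice_alg_target_unique[OF c v] in auto)
  then show ?thesis using nice_alg_supported[OF c v] by simp
qed

text \<open>By target uniqueness every inner sum of the Jacobi identity collapses to one product;
  the terms are written cyclically as \<open>[[i, j], l]\<close>, \<open>[[j, l], i]\<close>,
  \<open>[[l, i], j]\<close>.\<close>

lemma jacobi_three:
  assumes c: "nice_alg n c"
    and p: "c i j p \<noteq> 0" and q: "c j l q \<noteq> 0" and r: "c l i r \<noteq> 0"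
  shows "c i j p * c p l m + c j l q * c q i m + c l i r * c r j m = 0"
proof -
  have "c j l q * c i q m + c l i r * c j r m + c i j p * c l p m = 0"
    using nice_alg_jacobi[OF c, of j l i m]
    by (simp only: sum.distrib sum_bracket_compose[OF c p] sum_bracket_compose[OF c q] sum_bracket_compose[OF c r])
  then show ?thesis
    using nice_alg_antisym[OF c, of p l m] nice_alg_antisym[OF c, of q i m] nice_alg_antisym[OF c, of r j m] by simp
qed

lemma jacobi_two:
  assumes c: "nice_alg n c"
    and p: "c i j p \<noteq> 0" and q: "c j l q \<noteq> 0" and r: "\<And>r. c l i r * c r j m = 0"
  shows "c i j p * c p l m + c j l q * c q i m = 0"
proof -
  have "c l i u * c j u m = 0" for u
    using r[of u] nice_alg_antisym[OF c, of j u m] by simp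
  then have "(\<Sum>u\<in>{1..n}. c l i u * c j u m) = 0" by (intro sum.neutral) blast
  then have "c j l q * c i q m + c i j p * c l p m = 0"
    using nice_alg_jacobi[OF c, of j l i m]
    by (simp only: sum.distrib sum_bracket_compose[OF c p] sum_bracket_compose[OF c q] add_0_right)
  then show ?thesis
    using nice_alg_antisym[OF c, of p l m] nice_alg_antisym[OF c, of q i m] by simp
qed

text \<open>The absence of the third term is expressed as a condition on the concrete diagram, which
  simplification decides.\<close>

lemma jacobi_two_diagram:
  assumes c: "nice_alg 8 c" and D: "brackets 8 c = set D"
    and nz: "c i j p \<noteq> 0" "c j l q \<noteq> 0"
    and third: "\<forall>(u, v, r)\<in>set D. {u, v} = {l, i} \<longrightarrow> (\<forall>(u, v, k)\<in>set D. \<not> ({u, v} = {r, j} \<and> k = m))"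
  shows "c i j p * c p l m + c j l q * c q i m = 0"
proof (rule jacobi_two[OF c nz])
  have anti: "c i j k = - c j i k" for i j k by (rule nice_alg_antisym[OF c])
  have ord: "\<exists>u v. (u, v, k) \<in> set D \<and> {u, v} = {x, y}" if "c x y k \<noteq> 0" for x y k
  proof -
    have "c y x k \<noteq> 0" using that anti[of x y k] by simp
    moreover have "x \<noteq> y" using that anti[of x x k] by auto
    ultimately show ?thesis
      using that bracketsI[OF c D, of x y k] bracketsI[OF c D, of y x k] by (metis insert_commute nat_neq_iff)
  qed
  fix r
  show "c l i r * c r j m = 0"
  proof (rule ccontr)
    assume "c l i r * c r j m \<noteq> 0"
    then have "c l i r \<noteq> 0" "c r j m \<noteq> 0" by auto
    then show False using ord[of l i r] ord[of r j m] third by fast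
  qed
qed

lemma structure_constants_nonzero:
  assumes "brackets n c = set D"
  shows "\<forall>(i, j, k)\<in>set D. c i j k \<noteq> 0"
  using bracketsD(1)[OF assms] by blast

lemma unordered_bracket:
  assumes c: "nice_alg n c" and "{a, b} = {i, j}"
  shows "(c a b k)\<^sup>2 = (c i j k)\<^sup>2" "ricci_weight c g a b k = ricci_weight c g i j k"
  using assms(2) nice_alg_antisym[OF c, of i j k]
  by (auto simp: doubleton_eq_iff ricci_weight_def mult.commute)

text \<open>Two Ricci weights along the composition \<open>[[i, j], l] \<rightarrow> m\<close> multiply to the square of the
  corresponding product of structure constants, times a factor that is symmetric in \<open>i, j, l\<close>.
  Hence a Jacobi identity with only two terms gives an equation between products of weights.\<close>
lemma jacobi_weights:
  assumes c: "nice_alg 8 c" and D: "brackets 8 c = set D" and g: "balanced 8 c g"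
    and t: "(a1, b1, p) \<in> set D" "(a2, b2, m) \<in> set D" "(a3, b3, q) \<in> set D" "(a4, b4, m) \<in> set D"
    and ij: "{a1, b1} = {i, j}" and pl: "{a2, b2} = {p, l}"
    and jl: "{a3, b3} = {j, l}" and qi: "{a4, b4} = {q, i}"
    and third: "\<forall>(u, v, r)\<in>set D. {u, v} = {l, i} \<longrightarrow> (\<forall>(u, v, k)\<in>set D. \<not> ({u, v} = {r, j} \<and> k = m))"
  shows "ricci_weight c g a1 b1 p * ricci_weight c g a2 b2 m = ricci_weight c g a3 b3 q * ricci_weight c g a4 b4 m"
proof -
  have nz: "c i j p \<noteq> 0" "c p l m \<noteq> 0" "c j l q \<noteq> 0" "c q i m \<noteq> 0"
    using bracketsD(1)[OF D t(1)] bracketsD(1)[OF D t(2)] bracketsD(1)[OF D t(3)] bracketsD(1)[OF D t(4)]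
      unordered_bracket(1)[OF c ij, of p] unordered_bracket(1)[OF c pl, of m]
      unordered_bracket(1)[OF c jl, of q] unordered_bracket(1)[OF c qi, of m]
    by auto
  have "c i j p * c p l m = - (c j l q * c q i m)"
    using jacobi_two_diagram[OF c D nz(1) nz(3) third] by simp
  then have "(c i j p * c p l m)\<^sup>2 = (c j l q * c q i m)\<^sup>2" by simp
  then have sq: "(c i j p)\<^sup>2 * (c p l m)\<^sup>2 = (c j l q)\<^sup>2 * (c q i m)\<^sup>2"
    by (simp add: power_mult_distrib)
  have gnz: "g i \<noteq> 0" "g j \<noteq> 0" "g l \<noteq> 0" "g p \<noteq> 0" "g q \<noteq> 0"
    using nice_alg_supported[OF c nz(1)] nice_alg_supported[OF c nz(3)] g
    by (auto simp: balanced_def diag_metric_def)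
  have "ricci_weight c g i j p * ricci_weight c g p l m = (c i j p)\<^sup>2 * (c p l m)\<^sup>2 * (g m / (g i * g j * g l))"
    using gnz by (simp add: ricci_weight_def)
  moreover have "ricci_weight c g j l q * ricci_weight c g q i m = (c j l q)\<^sup>2 * (c q i m)\<^sup>2 * (g m / (g i * g j * g l))"
    using gnz by (simp add: ricci_weight_def ac_simps)
  ultimately show ?thesis
    using sq unfolding unordered_bracket(2)[OF c ij] unordered_bracket(2)[OF c pl]
      unordered_bracket(2)[OF c jl] unordered_bracket(2)[OF c qi] by simp
qed

section \<open>Diagrams without a balanced metric\<close>

context
  fixes c :: "nat \<Rightarrow> nat \<Rightarrow> nat \<Rightarrow> real" and g :: "nat \<Rightarrow> real"
  assumes c: "nice_alg 8 c" and g: "balanced 8 c g"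
begin

private abbreviation (input) "x \<equiv> ricci_weight c g"

private lemmas node_equations_at = node_equations[OF c _ g]

private lemmas weights_nonzero_at = weights_nonzero[OF c _ g]

private lemmas jacobi_weights_at = jacobi_weights[OF c _ g]

text \<open>The first rule settles the side conditions on unordered pairs; the others cancel the
  weight that the two sides have in common up to sign.\<close>

private lemma pair_cancel:
  fixes r s t :: real
  shows "{u, v} = {w, y} \<longleftrightarrow> u = w \<and> v = y \<or> u = y \<and> v = w"
    and "r * s = r * t \<longleftrightarrow> r = 0 \<or> s = t" "s * r = r * t \<longleftrightarrow> r = 0 \<or> s = t"
    and "- (r * s) = r * t \<longleftrightarrow> r = 0 \<or> s = - t" "- (s * r) = r * t \<longleftrightarrow> r = 0 \<or> s = - t"
    and "- (r * s) = t * r \<longleftrightarrow> r = 0 \<or> s = - t" "- (s * r) = t * r \<longleftrightarrow> r = 0 \<or> s = - t"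
  using mult_cancel_left[of r "- s" t] by (auto simp: doubleton_eq_iff mult.commute)

text \<open>The pattern of most refutations below: the node equations make two weights opposite that
  stand on different sides of a two-term Jacobi relation. Cancelling them makes the remaining two
  weights opposite as well, a linear relation that, joined to the node equations, forces some weight
  to vanish.\<close>

lemma not_balanced_9: "brackets 8 c \<noteq> set [(3,4,5),(2,4,6),(3,5,6),(2,5,7),(3,6,7),(2,6,8),(3,7,8)]" (is "_ \<noteq> ?D")
proof
  assume D: "brackets 8 c = ?D"
  note N = node_equations_at[OF D, simplified, folded One_nat_def]
  note nz = weights_nonzero_at[OF D, simplified, folded One_nat_def]
  have "x 2 4 6 = - x 3 4 5" using N by linarith
  then have E: "x 3 6 7 = - x 2 5 7"
    using jacobi_weights_at[OF D, of 2 4 6 3 6 7 3 4 5 2 5 2 4 3] nz by (simp add: pair_cancel)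
  have "x 3 5 6 = 0" using N E by linarith
  with nz show False by simp
qed

lemma not_balanced_10: "brackets 8 c \<noteq> set [(3,4,5),(2,4,6),(3,5,6),(1,4,7),(2,5,7),(3,6,7),(1,5,8),(2,6,8),(3,7,8)]" (is "_ \<noteq> ?D")
proof
  assume D: "brackets 8 c = ?D"
  note N = node_equations_at[OF D, simplified, folded One_nat_def]
  note nz = weights_nonzero_at[OF D, simplified, folded One_nat_def]
  have "x 1 4 7 = - x 1 5 8" using N by linarith
  then have E: "x 3 7 8 = - x 3 4 5"
    using jacobi_weights_at[OF D, of 1 4 7 3 7 8 3 4 5 1 5 1 4 3] nz by (simp add: pair_cancel)
  have "x 2 5 7 = 0" using N E by linarith
  with nz show False by simp
qed

lemma not_balanced_12: "brackets 8 c \<noteq> set [(3,4,5),(2,3,6),(1,4,6),(2,5,7),(4,6,7),(1,5,8),(3,6,8)]" (is "_ \<noteq> ?D")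
proof
  assume D: "brackets 8 c = ?D"
  note N = node_equations_at[OF D, simplified, folded One_nat_def]
  note nz = weights_nonzero_at[OF D, simplified, folded One_nat_def]
  have "x 1 4 6 = - x 1 5 8" using N by linarith
  then have E: "x 3 6 8 = - x 3 4 5"
    using jacobi_weights_at[OF D, of 1 4 6 3 6 8 3 4 5 1 5 1 4 3] nz by (simp add: pair_cancel)
  have "x 2 3 6 = 0" using N E by linarith
  with nz show False by simp
qed

lemma not_balanced_13: "brackets 8 c \<noteq> set [(2,3,4),(3,4,5),(2,4,6),(2,5,7),(3,6,7),(4,6,8),(2,7,8)]" (is "_ \<noteq> ?D")
proof
  assume D: "brackets 8 c = ?D"
  note N = node_equations_at[OF D, simplified, folded One_nat_def]
  note nz = weights_nonzero_at[OF D, simplified, folded One_nat_def]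
  have "x 2 3 4 = - x 2 7 8" using N by linarith
  then have E: "x 4 6 8 = - x 3 6 7"
    using jacobi_weights_at[OF D, of 2 3 4 4 6 8 3 6 7 2 7 2 3 6] nz by (simp add: pair_cancel)
  have "x 3 4 5 = 0" using N E by linarith
  with nz show False by simp
qed

lemma not_balanced_14: "brackets 8 c \<noteq> set [(2,3,4),(3,4,5),(2,4,6),(3,5,6),(2,5,7),(3,6,7),(4,5,8),(2,6,8),(3,7,8)]" (is "_ \<noteq> ?D")
proof
  assume D: "brackets 8 c = ?D"
  note N = node_equations_at[OF D, simplified, folded One_nat_def]
  note nz = weights_nonzero_at[OF D, simplified, folded One_nat_def]
  have "x 2 4 6 = - x 3 4 5" using N by linarith
  then have E: "x 3 6 7 = - x 2 5 7"
    using jacobi_weights_at[OF D, of 2 4 6 3 6 7 3 4 5 2 5 2 4 3] nz by (simp add: pair_cancel)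
  have "x 3 7 8 = 0" using N E by linarith
  with nz show False by simp
qed

lemma not_balanced_15: "brackets 8 c \<noteq> set [(2,3,4),(3,4,5),(2,4,6),(3,5,6),(1,3,7),(4,5,7),(2,6,7),(1,2,8),(4,6,8),(3,7,8)]" (is "_ \<noteq> ?D")
proof
  assume D: "brackets 8 c = ?D"
  note N = node_equations_at[OF D, simplified, folded One_nat_def]
  note nz = weights_nonzero_at[OF D, simplified, folded One_nat_def]
  have "x 2 3 4 = - x 2 6 7" using N by linarith
  then have E: "x 4 5 7 = - x 3 5 6"
    using jacobi_weights_at[OF D, of 2 3 4 4 5 7 3 5 6 2 6 2 3 5] nz by (simp add: pair_cancel)
  have "x 3 4 5 = 0" using N E by linarith
  with nz show False by simp
qed

lemma not_balanced_16: "brackets 8 c \<noteq> set [(2,3,4),(3,4,5),(1,3,6),(3,6,7),(1,5,8),(4,6,8),(2,7,8)]" (is "_ \<noteq> ?D")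
proof
  assume D: "brackets 8 c = ?D"
  note N = node_equations_at[OF D, simplified, folded One_nat_def]
  note nz = weights_nonzero_at[OF D, simplified, folded One_nat_def]
  have "x 1 3 6 = - x 3 4 5" using N by linarith
  then have E: "x 4 6 8 = - x 1 5 8"
    using jacobi_weights_at[OF D, of 1 3 6 4 6 8 3 4 5 1 5 1 3 4] nz by (simp add: pair_cancel)
  have "x 2 3 4 = 0" using N E by linarith
  with nz show False by simp
qed

lemma not_balanced_17: "brackets 8 c \<noteq> set [(2,3,4),(3,4,5),(1,3,6),(1,4,7),(2,6,7),(1,5,8),(4,6,8),(3,7,8)]" (is "_ \<noteq> ?D")
proof
  assume D: "brackets 8 c = ?D"
  note N = node_equations_at[OF D, simplified, folded One_nat_def]
  note nz = weights_nonzero_at[OF D, simplified, folded One_nat_def]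
  have "x 2 6 7 = - x 2 3 4" using N by linarith
  then have E: "x 1 3 6 = - x 1 4 7"
    using jacobi_weights_at[OF D, of 1 3 6 2 6 7 2 3 4 1 4 1 3 2] nz by (simp add: pair_cancel)
  have "x 3 4 5 = 0" using N E by linarith
  with nz show False by simp
qed

lemma not_balanced_18: "brackets 8 c \<noteq> set [(2,3,4),(3,4,5),(1,3,6),(2,4,6),(2,5,7),(3,6,7),(1,5,8),(4,6,8),(2,7,8)]" (is "_ \<noteq> ?D")
proof
  assume D: "brackets 8 c = ?D"
  note N = node_equations_at[OF D, simplified, folded One_nat_def]
  note nz = weights_nonzero_at[OF D, simplified, folded One_nat_def]
  have "x 1 3 6 = - x 1 5 8" using N by linarith
  then have E: "x 4 6 8 = - x 3 4 5"
    using jacobi_weights_at[OF D, of 1 3 6 4 6 8 3 4 5 1 5 1 3 4] nz by (simp add: pair_cancel)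
  have "x 3 6 7 = 0" using N E by linarith
  with nz show False by simp
qed

lemma not_balanced_19: "brackets 8 c \<noteq> set [(2,3,4),(3,4,5),(1,2,6),(1,4,7),(3,6,7),(1,5,8),(3,7,8)]" (is "_ \<noteq> ?D")
proof
  assume D: "brackets 8 c = ?D"
  note N = node_equations_at[OF D, simplified, folded One_nat_def]
  note nz = weights_nonzero_at[OF D, simplified, folded One_nat_def]
  have "x 1 2 6 = - x 2 3 4" using N by linarith
  then have E: "x 3 6 7 = - x 1 4 7"
    using jacobi_weights_at[OF D, of 1 2 6 3 6 7 2 3 4 1 4 1 2 3] nz by (simp add: pair_cancel)
  have "x 3 4 5 = 0" using N E by linarith
  with nz show False by simp
qed

lemma not_balanced_20: "brackets 8 c \<noteq> set [(2,3,4),(1,3,5),(1,4,6),(2,5,6),(4,5,7),(3,6,7),(5,6,8),(1,7,8)]" (is "_ \<noteq> ?D")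
proof
  assume D: "brackets 8 c = ?D"
  note N = node_equations_at[OF D, simplified, folded One_nat_def]
  note nz = weights_nonzero_at[OF D, simplified, folded One_nat_def]
  have "x 2 5 6 = - x 2 3 4" using N by linarith
  then have E: "x 1 3 5 = - x 1 4 6"
    using jacobi_weights_at[OF D, of 1 3 5 2 5 6 2 3 4 1 4 1 3 2] nz by (simp add: pair_cancel)
  have "x 5 6 8 = 0" using N E by linarith
  with nz show False by simp
qed

lemma not_balanced_22: "brackets 8 c \<noteq> set [(2,3,4),(1,3,5),(1,2,6),(1,4,7),(2,5,7),(3,6,7),(5,6,8),(1,7,8)]" (is "_ \<noteq> ?D")
proof
  assume D: "brackets 8 c = ?D"
  note N = node_equations_at[OF D, simplified, folded One_nat_def]
  note nz = weights_nonzero_at[OF D, simplified, folded One_nat_def]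
  have "x 5 6 8 = - x 1 7 8" using N by linarith
  then have E: "x 1 2 6 = - x 2 5 7"
    using jacobi_weights_at[OF D, of 1 2 6 5 6 8 2 5 7 1 7 1 2 5] nz by (simp add: pair_cancel)
  have "x 2 3 4 = 0" using N E by linarith
  with nz show False by simp
qed

lemma not_balanced_23: "brackets 8 c \<noteq> set [(2,3,4),(1,3,5),(1,2,6),(3,5,6),(1,4,7),(3,6,7),(4,5,8),(2,6,8),(3,7,8)]" (is "_ \<noteq> ?D")
proof
  assume D: "brackets 8 c = ?D"
  note N = node_equations_at[OF D, simplified, folded One_nat_def]
  note nz = weights_nonzero_at[OF D, simplified, folded One_nat_def]
  have "x 1 3 5 = - x 3 7 8" using N by linarith
  then have E: "x 4 5 8 = - x 1 4 7"
    using jacobi_weights_at[OF D, of 1 3 5 4 5 8 1 4 7 3 7 3 1 4] nz by (simp add: pair_cancel)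
  have "x 2 3 4 = 0" using N E by linarith
  with nz show False by simp
qed

lemma not_balanced_25: "brackets 8 c \<noteq> set [(2,3,4),(1,3,5),(2,4,5),(1,4,6),(2,5,6),(4,5,7),(3,6,7),(1,5,8),(2,6,8)]" (is "_ \<noteq> ?D")
proof
  assume D: "brackets 8 c = ?D"
  note N = node_equations_at[OF D, simplified, folded One_nat_def]
  note nz = weights_nonzero_at[OF D, simplified, folded One_nat_def]
  have "x 2 5 6 = - x 2 3 4" using N by linarith
  then have E: "x 1 3 5 = - x 1 4 6"
    using jacobi_weights_at[OF D, of 1 3 5 2 5 6 2 3 4 1 4 1 3 2] nz by (simp add: pair_cancel)
  have "x 2 4 5 = 0" using N E by linarith
  with nz show False by simp
qed

lemma not_balanced_26: "brackets 8 c \<noteq> set [(2,3,4),(1,3,5),(2,4,5),(1,4,6),(2,5,6),(1,5,7),(2,6,7),(1,6,8),(2,7,8)]" (is "_ \<noteq> ?D")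
proof
  assume D: "brackets 8 c = ?D"
  note N = node_equations_at[OF D, simplified, folded One_nat_def]
  note nz = weights_nonzero_at[OF D, simplified, folded One_nat_def]
  have "x 1 3 5 = - x 2 3 4" using N by linarith
  then have E: "x 2 5 6 = - x 1 4 6"
    using jacobi_weights_at[OF D, of 1 3 5 2 5 6 2 3 4 1 4 1 3 2] nz by (simp add: pair_cancel)
  have "x 1 5 7 = 0" using N E by linarith
  with nz show False by simp
qed

lemma not_balanced_27: "brackets 8 c \<noteq> set [(2,3,4),(1,3,5),(2,4,5),(1,4,6),(2,5,6),(3,4,7),(1,5,7),(2,6,7),(3,5,8),(1,6,8),(2,7,8)]" (is "_ \<noteq> ?D")
proof
  assume D: "brackets 8 c = ?D"
  note N = node_equations_at[OF D, simplified, folded One_nat_def]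
  note nz = weights_nonzero_at[OF D, simplified, folded One_nat_def]
  have "x 1 3 5 = - x 2 3 4" using N by linarith
  then have E: "x 2 5 6 = - x 1 4 6"
    using jacobi_weights_at[OF D, of 1 3 5 2 5 6 2 3 4 1 4 1 3 2] nz by (simp add: pair_cancel)
  have "x 1 5 7 = 0" using N E by linarith
  with nz show False by simp
qed

lemma not_balanced_28: "brackets 8 c \<noteq> set [(1,2,3),(2,3,4),(2,4,5),(3,4,6),(1,5,6),(3,5,7),(2,6,7),(4,5,8),(2,7,8)]" (is "_ \<noteq> ?D")
proof
  assume D: "brackets 8 c = ?D"
  note N = node_equations_at[OF D, simplified, folded One_nat_def]
  note nz = weights_nonzero_at[OF D, simplified, folded One_nat_def]
  have "x 1 2 3 = - x 1 5 6" using N by linarith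
  then have E: "x 3 5 7 = - x 2 6 7"
    using jacobi_weights_at[OF D, of 1 2 3 3 5 7 1 5 6 2 6 2 1 5] nz by (simp add: pair_cancel)
  have "x 2 3 4 = 0" using N E by linarith
  with nz show False by simp
qed

lemma not_balanced_29: "brackets 8 c \<noteq> set [(1,2,3),(2,3,4),(2,4,5),(1,3,6),(1,4,7),(2,6,7),(3,4,8),(1,5,8),(2,7,8)]" (is "_ \<noteq> ?D")
proof
  assume D: "brackets 8 c = ?D"
  note N = node_equations_at[OF D, simplified, folded One_nat_def]
  note nz = weights_nonzero_at[OF D, simplified, folded One_nat_def]
  have "x 1 3 6 = - x 2 3 4" using N by linarith
  then have E: "x 2 6 7 = - x 1 4 7"
    using jacobi_weights_at[OF D, of 1 3 6 2 6 7 2 3 4 1 4 1 3 2] nz by (simp add: pair_cancel)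
  have "x 2 7 8 = 0" using N E by linarith
  with nz show False by simp
qed

lemma not_balanced_30: "brackets 8 c \<noteq> set [(1,2,3),(2,3,4),(1,3,5),(1,4,6),(2,5,6),(3,5,7),(1,6,7),(4,5,8),(3,6,8),(2,7,8)]" (is "_ \<noteq> ?D")
proof
  assume D: "brackets 8 c = ?D"
  note N = node_equations_at[OF D, simplified, folded One_nat_def]
  note nz = weights_nonzero_at[OF D, simplified, folded One_nat_def]
  have "x 1 2 3 = - x 1 6 7" using N by linarith
  then have E: "x 3 5 7 = - x 2 5 6"
    using jacobi_weights_at[OF D, of 1 2 3 3 5 7 2 5 6 1 6 1 2 5] nz by (simp add: pair_cancel)
  have "x 2 3 4 = 0" using N E by linarith
  with nz show False by simp
qed

lemma not_balanced_31: "brackets 8 c \<noteq> set [(1,2,3),(2,3,4),(1,3,5),(1,4,6),(2,5,6),(3,5,7),(1,6,7),(3,4,8),(2,6,8)]" (is "_ \<noteq> ?D")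
proof
  assume D: "brackets 8 c = ?D"
  note N = node_equations_at[OF D, simplified, folded One_nat_def]
  note nz = weights_nonzero_at[OF D, simplified, folded One_nat_def]
  have "x 3 5 7 = - x 1 6 7" using N by linarith
  then have E: "x 1 2 3 = - x 2 5 6"
    using jacobi_weights_at[OF D, of 1 2 3 3 5 7 2 5 6 1 6 1 2 5] nz by (simp add: pair_cancel)
  have "x 1 4 6 = 0" using N E by linarith
  with nz show False by simp
qed

lemma not_balanced_32: "brackets 8 c \<noteq> set [(1,2,3),(2,3,4),(1,3,5),(2,4,5),(3,4,6),(1,5,6),(3,5,7),(2,6,7),(4,5,8),(1,6,8),(2,7,8)]" (is "_ \<noteq> ?D")
proof
  assume D: "brackets 8 c = ?D"
  note N = node_equations_at[OF D, simplified, folded One_nat_def]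
  note nz = weights_nonzero_at[OF D, simplified, folded One_nat_def]
  have "x 1 2 3 = - x 1 5 6" using N by linarith
  then have E: "x 3 4 6 = - x 2 4 5"
    using jacobi_weights_at[OF D, of 1 2 3 3 4 6 2 4 5 1 5 1 2 4] nz by (simp add: pair_cancel)
  have "x 1 3 5 = 0" using N E by linarith
  with nz show False by simp
qed

lemma not_balanced_34: "brackets 8 c \<noteq> set [(1,2,3),(2,3,4),(1,3,5),(2,4,5),(3,4,6),(1,5,6),(1,4,7),(2,5,7),(3,5,8),(2,6,8),(1,7,8)]" (is "_ \<noteq> ?D")
proof
  assume D: "brackets 8 c = ?D"
  note N = node_equations_at[OF D, simplified, folded One_nat_def]
  note nz = weights_nonzero_at[OF D, simplified, folded One_nat_def]
  have "x 3 4 6 = - x 2 4 5" using N by linarith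
  then have E: "x 1 2 3 = - x 1 5 6"
    using jacobi_weights_at[OF D, of 1 2 3 3 4 6 2 4 5 1 5 1 2 4] nz by (simp add: pair_cancel)
  have "x 1 7 8 = 0" using N E by linarith
  with nz show False by simp
qed

lemma not_balanced_35: "brackets 8 c \<noteq> set [(1,2,3),(2,3,4),(1,3,5),(2,4,5),(1,4,6),(2,5,6),(1,5,7),(2,6,7),(4,5,8),(3,6,8),(1,7,8)]" (is "_ \<noteq> ?D")
proof
  assume D: "brackets 8 c = ?D"
  note N = node_equations_at[OF D, simplified, folded One_nat_def]
  note nz = weights_nonzero_at[OF D, simplified, folded One_nat_def]
  have "x 1 2 3 = - x 1 7 8" using N by linarith
  then have E: "x 3 6 8 = - x 2 6 7"
    using jacobi_weights_at[OF D, of 1 2 3 3 6 8 2 6 7 1 7 1 2 6] nz by (simp add: pair_cancel)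
  \<comment> \<open>The relation obtained joins the linear system for a second round with another
    two-term identity.\<close>
  note N = N E
  have "x 2 5 6 = - x 2 3 4" using N by linarith
  then have E: "x 1 3 5 = - x 1 4 6"
    using jacobi_weights_at[OF D, of 1 3 5 2 5 6 2 3 4 1 4 1 3 2] nz by (simp add: pair_cancel)
  have "x 2 4 5 = 0" using N E by linarith
  with nz show False by simp
qed

lemma not_balanced_36: "brackets 8 c \<noteq> set [(1,2,3),(2,3,4),(1,3,5),(2,4,5),(1,4,6),(2,5,6),(3,4,7),(2,6,7),(3,5,8),(1,6,8),(2,7,8)]" (is "_ \<noteq> ?D")
proof
  assume D: "brackets 8 c = ?D"
  note N = node_equations_at[OF D, simplified, folded One_nat_def]
  note nz = weights_nonzero_at[OF D, simplified, folded One_nat_def]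
  have "x 1 3 5 = - x 2 3 4" using N by linarith
  then have E: "x 2 5 6 = - x 1 4 6"
    using jacobi_weights_at[OF D, of 1 3 5 2 5 6 2 3 4 1 4 1 3 2] nz by (simp add: pair_cancel)
  have "x 1 2 3 = 0" using N E by linarith
  with nz show False by simp
qed

lemma not_balanced_37: "brackets 8 c \<noteq> set [(1,2,3),(2,3,4),(1,3,5),(2,4,5),(1,4,6),(2,5,6),(3,4,7),(1,5,7),(2,6,7),(4,5,8),(3,6,8),(1,7,8)]" (is "_ \<noteq> ?D")
proof
  assume D: "brackets 8 c = ?D"
  note N = node_equations_at[OF D, simplified, folded One_nat_def]
  note nz = weights_nonzero_at[OF D, simplified, folded One_nat_def]
  have "x 2 5 6 = - x 2 3 4" using N by linarith
  then have E: "x 1 3 5 = - x 1 4 6"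
    using jacobi_weights_at[OF D, of 1 3 5 2 5 6 2 3 4 1 4 1 3 2] nz by (simp add: pair_cancel)
  \<comment> \<open>Again two rounds: the first relation is added to the linear system before the
    second identity is used.\<close>
  note N = N E
  have "x 2 3 4 = - x 2 5 6" using N by linarith
  then have E: "x 4 5 8 = - x 3 6 8"
    using jacobi_weights_at[OF D, of 2 3 4 4 5 8 2 5 6 3 6 3 2 5] nz by (simp add: pair_cancel)
  have "x 2 6 7 = 0" using N E by linarith
  with nz show False by simp
qed

lemma not_balanced_38: "brackets 8 c \<noteq> set [(1,2,3),(2,3,4),(1,3,5),(2,4,5),(1,4,6),(2,5,6),(3,4,7),(1,5,7),(2,6,7),(3,5,8),(2,7,8)]" (is "_ \<noteq> ?D")
proof
  assume D: "brackets 8 c = ?D"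
  note N = node_equations_at[OF D, simplified, folded One_nat_def]
  note nz = weights_nonzero_at[OF D, simplified, folded One_nat_def]
  have "x 1 3 5 = - x 2 3 4" using N by linarith
  then have E: "x 2 5 6 = - x 1 4 6"
    using jacobi_weights_at[OF D, of 1 3 5 2 5 6 2 3 4 1 4 1 3 2] nz by (simp add: pair_cancel)
  have "x 2 6 7 = 0" using N E by linarith
  with nz show False by simp
qed

end

section \<open>Diagrams excluded by signs and by nonlinear relations\<close>

lemma not_balanced_7:
  assumes c: "nice_alg 8 c" and D: "brackets 8 c = set [(3,4,5),(2,4,6),(2,5,7),(3,6,7),(5,6,8),(4,7,8)]"
  shows False
proof -
  have anti: "c i j k = - c j i k" for i j k by (rule nice_alg_antisym[OF c])
  note nz = structure_constants_nonzero[OF D, simplified]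
  have J1: "c 3 4 5 * c 2 5 7 - c 2 4 6 * c 3 6 7 = 0"
    using jacobi_two_diagram[OF c D, of 3 4 5 2 6 7]
      anti[of 4 2 6] anti[of 5 2 7] anti[of 6 3 7] nz by (simp add: doubleton_eq_iff)
  have J2: "c 2 5 7 * c 4 7 8 - c 2 4 6 * c 5 6 8 = 0"
    using jacobi_two_diagram[OF c D, of 5 2 7 4 6 8]
      anti[of 5 2 7] anti[of 6 5 8] anti[of 7 4 8] nz by (simp add: doubleton_eq_iff)
  have J3: "c 3 6 7 * c 4 7 8 + c 3 4 5 * c 5 6 8 = 0"
    using jacobi_two_diagram[OF c D, of 6 3 7 4 5 8]
      anti[of 6 3 7] anti[of 7 4 8] nz by (simp add: doubleton_eq_iff)
  \<comment> \<open>J2 followed by J1 turns this product into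
    \<open>c 3 4 5 * c 2 5 7 * c 5 6 8\<close>, while J3 gives the negative of that. The Jacobi
    identities alone are contradictory.\<close>
  have "c 3 6 7 * c 4 7 8 * c 2 5 7 = 0" using J1 J2 J3 by algebra
  then show False using nz by simp
qed

lemma not_balanced_33:
  assumes c: "nice_alg 8 c" and D: "brackets 8 c = set [(1,2,3),(2,3,4),(1,3,5),(2,4,5),(3,4,6),(1,5,6),(3,5,7),(2,6,7),(1,4,8),(2,5,8)]"
  shows False
proof -
  have anti: "c i j k = - c j i k" for i j k by (rule nice_alg_antisym[OF c])
  note nz = structure_constants_nonzero[OF D, simplified]
  have J1: "c 2 3 4 * c 1 4 8 - c 1 3 5 * c 2 5 8 = 0"
    using jacobi_two_diagram[OF c D, of 2 3 4 1 5 8]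
      anti[of 3 1 5] anti[of 4 1 8] anti[of 5 2 8] nz by (simp add: doubleton_eq_iff)
  have J2: "c 1 2 3 * c 3 4 6 - c 2 4 5 * c 1 5 6 = 0"
    using jacobi_two_diagram[OF c D, of 1 2 3 4 5 6]
      anti[of 5 1 6] nz by (simp add: doubleton_eq_iff)
  have J3: "c 1 5 6 * c 2 6 7 + c 1 2 3 * c 3 5 7 = 0"
    using jacobi_two_diagram[OF c D, of 5 1 6 2 3 7]
      anti[of 5 1 6] anti[of 6 2 7] nz by (simp add: doubleton_eq_iff)
  have J4: "c 3 4 6 * c 2 6 7 - c 2 4 5 * c 3 5 7 = 0"
    using jacobi_two_diagram[OF c D, of 3 4 6 2 5 7]
      anti[of 4 2 5] anti[of 5 3 7] anti[of 6 2 7] nz by (simp add: doubleton_eq_iff)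
  \<comment> \<open>Rewriting the product by J2, J3 and J4 in turn returns it with the opposite
    sign.\<close>
  have "c 1 2 3 * c 3 4 6 * c 2 6 7 = 0" using J2 J3 J4 by algebra
  then show False using nz by simp
qed

text \<open>Both monomials have the metric factor
  \<open>g 7 * g 8 / (g 1 * g 2 * g 3 * (g 4)^2)\<close>, so their ratio is the square of a ratio of
  structure constants, whatever the signature.\<close>

lemma monomial_sign_a:
  assumes c: "nice_alg 8 c" and g: "balanced 8 c g"
    and nz: "c 2 4 6 \<noteq> 0" "c 1 3 7 \<noteq> 0" "c 4 6 8 \<noteq> 0" "c 3 4 5 \<noteq> 0" "c 4 5 7 \<noteq> 0" "c 1 2 8 \<noteq> 0"
  shows "\<exists>t>0. ricci_weight c g 2 4 6 * ricci_weight c g 1 3 7 * ricci_weight c g 4 6 8 = t * (ricci_weight c g 3 4 5 * ricci_weight c g 4 5 7 * ricci_weight c g 1 2 8)"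
proof -
  have gnz: "g i \<noteq> 0" if "i \<in> {1..8}" for i
    using g that by (simp add: balanced_def diag_metric_def)
  have "ricci_weight c g 2 4 6 * ricci_weight c g 1 3 7 * ricci_weight c g 4 6 8 =
     ((c 2 4 6 * c 1 3 7 * c 4 6 8) / (c 3 4 5 * c 4 5 7 * c 1 2 8))\<^sup>2 * (ricci_weight c g 3 4 5 * ricci_weight c g 4 5 7 * ricci_weight c g 1 2 8)"
    unfolding ricci_weight_def power_divide power_mult_distrib
    using nz gnz[of 1] gnz[of 2] gnz[of 3] gnz[of 4] gnz[of 5] gnz[of 6] gnz[of 7] gnz[of 8]
    by (simp add: field_simps power2_eq_square)
  moreover have "((c 2 4 6 * c 1 3 7 * c 4 6 8) / (c 3 4 5 * c 4 5 7 * c 1 2 8))\<^sup>2 > 0"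
    using nz by simp
  ultimately show ?thesis by blast
qed

lemma not_balanced_8:
  assumes c: "nice_alg 8 c" and D: "brackets 8 c = set [(3,4,5),(2,4,6),(1,3,7),(4,5,7),(1,2,8),(4,6,8)]"
    and g: "balanced 8 c g"
  shows False
proof -
  have anti: "c i j k = - c j i k" for i j k by (rule nice_alg_antisym[OF c])
  note nz = structure_constants_nonzero[OF D, simplified]
  let ?x = "ricci_weight c g"
  note N = node_equations[OF c D g, simplified, folded One_nat_def]
  note xnz = weights_nonzero[OF c D g, simplified, folded One_nat_def]
  have e: "?x 2 4 6 = - ?x 3 4 5" "?x 1 3 7 = - ?x 3 4 5" "?x 1 2 8 = ?x 3 4 5" "?x 4 6 8 = - ?x 4 5 7"
    using N by linarith+
  obtain t where t: "t > 0" "?x 2 4 6 * ?x 1 3 7 * ?x 4 6 8 = t * (?x 3 4 5 * ?x 4 5 7 * ?x 1 2 8)"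
    using monomial_sign_a[OF c g] nz by auto
  \<comment> \<open>The node equations turn the two monomials into \<open>- x^2 * y\<close> and
    \<open>x^2 * y\<close> with \<open>x\<close>, \<open>y\<close> the weights of (3,4,5) and
    (4,5,7), against the positive ratio \<open>t\<close>.\<close>
  have "(?x 3 4 5)\<^sup>2 * ?x 4 5 7 * (1 + t) = 0"
    using t(2) unfolding e by (simp add: algebra_simps power2_eq_square)
  then show False using xnz t(1) by simp
qed

lemma not_balanced_11:
  assumes c: "nice_alg 8 c" and D: "brackets 8 c = set [(3,4,5),(2,4,6),(3,5,6),(1,3,7),(4,5,7),(1,2,8),(4,6,8),(3,7,8)]"
    and g: "balanced 8 c g"
  shows False
proof -
  have anti: "c i j k = - c j i k" for i j k by (rule nice_alg_antisym[OF c])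
  note nz = structure_constants_nonzero[OF D, simplified]
  let ?x = "ricci_weight c g"
  note N = node_equations[OF c D g, simplified, folded One_nat_def]
  note xnz = weights_nonzero[OF c D g, simplified, folded One_nat_def]
  have e: "?x 2 4 6 = - ?x 3 4 5" "?x 1 3 7 = - ?x 3 4 5" "?x 1 2 8 = ?x 3 4 5" "?x 4 6 8 = - ?x 4 5 7"
    using N by linarith+
  obtain t where t: "t > 0" "?x 2 4 6 * ?x 1 3 7 * ?x 4 6 8 = t * (?x 3 4 5 * ?x 4 5 7 * ?x 1 2 8)"
    using monomial_sign_a[OF c g] nz by auto
  have "(?x 3 4 5)\<^sup>2 * ?x 4 5 7 * (1 + t) = 0"
    using t(2) unfolding e by (simp add: algebra_simps power2_eq_square)
  then show False using xnz t(1) by simp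
qed

text \<open>Here the common metric factor is
  \<open>g 7 * g 8 / ((g 1)^2 * g 2 * g 3 * g 4)\<close>.\<close>

lemma monomial_sign_b:
  assumes c: "nice_alg 8 c" and g: "balanced 8 c g"
    and nz: "c 1 2 6 \<noteq> 0" "c 3 4 7 \<noteq> 0" "c 1 6 8 \<noteq> 0" "c 1 3 5 \<noteq> 0" "c 1 5 7 \<noteq> 0" "c 2 4 8 \<noteq> 0"
  shows "\<exists>t>0. ricci_weight c g 1 2 6 * ricci_weight c g 3 4 7 * ricci_weight c g 1 6 8 = t * (ricci_weight c g 1 3 5 * ricci_weight c g 1 5 7 * ricci_weight c g 2 4 8)"
proof -
  have gnz: "g i \<noteq> 0" if "i \<in> {1..8}" for i
    using g that by (simp add: balanced_def diag_metric_def)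
  have "ricci_weight c g 1 2 6 * ricci_weight c g 3 4 7 * ricci_weight c g 1 6 8 =
     ((c 1 2 6 * c 3 4 7 * c 1 6 8) / (c 1 3 5 * c 1 5 7 * c 2 4 8))\<^sup>2 * (ricci_weight c g 1 3 5 * ricci_weight c g 1 5 7 * ricci_weight c g 2 4 8)"
    unfolding ricci_weight_def power_divide power_mult_distrib
    using nz gnz[of 1] gnz[of 2] gnz[of 3] gnz[of 4] gnz[of 5] gnz[of 6] gnz[of 7] gnz[of 8]
    by (simp add: field_simps power2_eq_square)
  moreover have "((c 1 2 6 * c 3 4 7 * c 1 6 8) / (c 1 3 5 * c 1 5 7 * c 2 4 8))\<^sup>2 > 0"
    using nz by simp
  ultimately show ?thesis by blast
qed

text \<open>Here the common metric factor is
  \<open>g 7 * g 8 / (g 1 * (g 2)^2 * g 3 * g 5)\<close>.\<close>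

lemma monomial_sign_c:
  assumes c: "nice_alg 8 c" and g: "balanced 8 c g"
    and nz: "c 1 2 6 \<noteq> 0" "c 2 6 7 \<noteq> 0" "c 3 5 8 \<noteq> 0" "c 2 3 4 \<noteq> 0" "c 1 5 7 \<noteq> 0" "c 2 4 8 \<noteq> 0"
  shows "\<exists>t>0. ricci_weight c g 1 2 6 * ricci_weight c g 2 6 7 * ricci_weight c g 3 5 8 = t * (ricci_weight c g 2 3 4 * ricci_weight c g 1 5 7 * ricci_weight c g 2 4 8)"
proof -
  have gnz: "g i \<noteq> 0" if "i \<in> {1..8}" for i
    using g that by (simp add: balanced_def diag_metric_def)
  have "ricci_weight c g 1 2 6 * ricci_weight c g 2 6 7 * ricci_weight c g 3 5 8 =
     ((c 1 2 6 * c 2 6 7 * c 3 5 8) / (c 2 3 4 * c 1 5 7 * c 2 4 8))\<^sup>2 * (ricci_weight c g 2 3 4 * ricci_weight c g 1 5 7 * ricci_weight c g 2 4 8)"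
    unfolding ricci_weight_def power_divide power_mult_distrib
    using nz gnz[of 1] gnz[of 2] gnz[of 3] gnz[of 4] gnz[of 5] gnz[of 6] gnz[of 7] gnz[of 8]
    by (simp add: field_simps power2_eq_square)
  moreover have "((c 1 2 6 * c 2 6 7 * c 3 5 8) / (c 2 3 4 * c 1 5 7 * c 2 4 8))\<^sup>2 > 0"
    using nz by simp
  ultimately show ?thesis by blast
qed

text \<open>The solutions of the node equations are parametrised by \<open>a\<close> and
  \<open>b\<close>. The two monomial comparisons force both \<open>a\<close> and \<open>b\<close> to
  have the sign opposite to that of \<open>a + b\<close>, which is impossible.\<close>

lemma not_balanced_21:
  assumes c: "nice_alg 8 c" and D: "brackets 8 c = set [(2,3,4),(1,3,5),(1,2,6),(3,4,7),(1,5,7),(2,6,7),(2,4,8),(3,5,8),(1,6,8)]"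
    and g: "balanced 8 c g"
  shows False
proof -
  have anti: "c i j k = - c j i k" for i j k by (rule nice_alg_antisym[OF c])
  note nz = structure_constants_nonzero[OF D, simplified]
  let ?x = "ricci_weight c g"
  note N = node_equations[OF c D g, simplified, folded One_nat_def]
  note xnz = weights_nonzero[OF c D g, simplified, folded One_nat_def]
  have e: "?x 1 3 5 = - ?x 1 6 8" "?x 3 4 7 = ?x 1 6 8" "?x 2 3 4 = - ?x 3 5 8" "?x 2 6 7 = ?x 3 5 8"
    "?x 1 5 7 = - (?x 1 6 8 + ?x 3 5 8)" "?x 2 4 8 = - (?x 1 6 8 + ?x 3 5 8)" "?x 1 2 6 = ?x 1 6 8 + ?x 3 5 8"
    using N by linarith+
  define a b where "a = ?x 1 6 8" and "b = ?x 3 5 8"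
  note e = e[folded a_def b_def]
  have ab: "a \<noteq> 0" "b \<noteq> 0" "a + b \<noteq> 0"
    using xnz e by (auto simp: a_def[symmetric] b_def[symmetric])
  obtain t where t: "t > 0" "?x 1 2 6 * ?x 3 4 7 * ?x 1 6 8 = t * (?x 1 3 5 * ?x 1 5 7 * ?x 2 4 8)"
    using monomial_sign_b[OF c g] nz by auto
  obtain u where u: "u > 0" "?x 1 2 6 * ?x 2 6 7 * ?x 3 5 8 = u * (?x 2 3 4 * ?x 1 5 7 * ?x 2 4 8)"
    using monomial_sign_c[OF c g] nz by auto
  have "(a + b) * a * (a + t * (a + b)) = 0"
    using t(2) unfolding e a_def[symmetric] by (simp add: algebra_simps)
  then have "a = - t * (a + b)" using ab by simp
  moreover have "(a + b) * b * (b + u * (a + b)) = 0"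
    using u(2) unfolding e b_def[symmetric] by (simp add: algebra_simps)
  then have "b = - u * (a + b)" using ab by simp
  ultimately have "(a + b) * (1 + t + u) = 0" by algebra
  then show False using ab t(1) u(1) by simp
qed

text \<open>The relation P is used like the ones above and yields a linear relation. In Q no factors
  are opposite; but after all weights are expressed by three of them, its quadratic terms cancel
  down to a single product of nonzero weights.\<close>

lemma not_balanced_39:
  assumes c: "nice_alg 8 c" and D: "brackets 8 c = set [(1,2,3),(2,3,4),(1,3,5),(2,4,5),(1,4,6),(2,5,6),(3,4,7),(1,5,7),(2,6,7),(3,5,8),(1,6,8),(2,7,8)]"
    and g: "balanced 8 c g"
  shows False
proof -
  let ?x = "ricci_weight c g"
  note N = node_equations[OF c D g, simplified, folded One_nat_def]
  note xnz = weights_nonzero[OF c D g, simplified, folded One_nat_def]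
  have P: "?x 1 3 5 * ?x 2 5 6 = ?x 2 3 4 * ?x 1 4 6"
    by (rule jacobi_weights[OF c D g, where i = 1 and j = 3 and l = 2]) (simp_all add: doubleton_eq_iff)
  have Q: "?x 2 4 5 * ?x 3 5 8 = ?x 3 4 7 * ?x 2 7 8"
    by (rule jacobi_weights[OF c D g, where i = 2 and j = 4 and l = 3]) (simp_all add: doubleton_eq_iff)
  have e: "?x 2 3 4 = - ?x 1 3 5" using N by linarith
  with P have "?x 1 3 5 * (?x 1 4 6 + ?x 2 5 6) = 0" by algebra
  then have "?x 1 4 6 = - ?x 2 5 6" using xnz by (simp add: eq_neg_iff_add_eq_0)
  then have f: "?x 3 4 7 = ?x 2 7 8 + ?x 1 6 8 - ?x 1 5 7" "?x 2 4 5 = ?x 1 5 7 - ?x 2 7 8"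
      "?x 3 5 8 = - ?x 2 7 8 - ?x 1 6 8"
    using N by linarith+
  have "?x 1 5 7 * ?x 1 6 8 = 0" using Q unfolding f by algebra
  then show False using xnz by simp
qed

text \<open>The hardest diagram: its Jacobi identities into nodes 7 and 8 include two with three
  terms, so they do not relate the weights directly. They are tied together by one ratio
  \<open>s\<close> of structure constants, which is then eliminated.\<close>

lemma not_balanced_24:
  assumes c: "nice_alg 8 c" and D: "brackets 8 c = set [(2,3,4),(1,3,5),(1,2,6),(3,5,6),(1,4,7),(2,5,7),(3,6,7),(4,5,8),(2,6,8),(3,7,8)]"
    and g: "balanced 8 c g"
  shows False
proof -
  have anti: "c i j k = - c j i k" for i j k by (rule nice_alg_antisym[OF c])
  note nz = structure_constants_nonzero[OF D, simplified]
  let ?x = "ricci_weight c g"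
  note N = node_equations[OF c D g, simplified, folded One_nat_def]
  note xnz = weights_nonzero[OF c D g, simplified, folded One_nat_def]
  have gnz: "g i \<noteq> 0" if "i \<in> {1..8}" for i
    using g that by (simp add: balanced_def diag_metric_def)
  have J1: "c 1 2 6 * c 3 6 7 + c 2 3 4 * c 1 4 7 - c 1 3 5 * c 2 5 7 = 0"
    using jacobi_three[OF c, of 1 2 6 3 4 5 7]
      anti[of 3 1 5] anti[of 4 1 7] anti[of 5 2 7] anti[of 6 3 7] nz by (simp add: doubleton_eq_iff)
  have J2: "c 1 4 7 * c 3 7 8 - c 1 3 5 * c 4 5 8 = 0"
    using jacobi_two_diagram[OF c D, of 4 1 7 3 5 8]
      anti[of 4 1 7] anti[of 5 4 8] anti[of 7 3 8] nz by (simp add: doubleton_eq_iff)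
  have J3: "c 2 3 4 * c 4 5 8 - c 3 5 6 * c 2 6 8 + c 2 5 7 * c 3 7 8 = 0"
    using jacobi_three[OF c, of 2 3 4 5 6 7 8]
      anti[of 5 2 7] anti[of 6 2 8] anti[of 7 3 8] nz by (simp add: doubleton_eq_iff)
  have e: "?x 2 3 4 = - ?x 2 6 8 - ?x 1 2 6 - ?x 2 5 7" "?x 1 3 5 = ?x 2 5 7 - ?x 3 7 8"
      "?x 3 5 6 = ?x 2 6 8" "?x 1 4 7 = ?x 3 7 8 - ?x 1 2 6 - ?x 2 5 7" "?x 3 6 7 = ?x 1 2 6"
      "?x 4 5 8 = - ?x 3 7 8 - ?x 2 6 8"
    using N by linarith+
  \<comment> \<open>The free parameters of the solution of the node equations displayed just
    before.\<close>
  define a b k e where "a = ?x 3 7 8" and "b = ?x 2 6 8" and "k = ?x 1 2 6" and "e = ?x 2 5 7"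
  note d = a_def[symmetric] b_def[symmetric] k_def[symmetric] e_def[symmetric]
  have abke: "a \<noteq> 0" "b \<noteq> 0" "e \<noteq> 0" "e - a \<noteq> 0"
    using xnz unfolding e d by auto
  \<comment> \<open>The common metric factors of the iterated brackets of nodes 1, 2, 3 into node 7
    and of nodes 2, 3, 5 into node 8.\<close>
  define p q where "p = g 7 / (g 1 * g 2 * g 3)" and "q = g 8 / (g 2 * g 3 * g 5)"
  have W: "?x 1 2 6 * ?x 3 6 7 = p * (c 1 2 6 * c 3 6 7)\<^sup>2" "?x 2 3 4 * ?x 1 4 7 = p * (c 2 3 4 * c 1 4 7)\<^sup>2"
    "?x 1 3 5 * ?x 2 5 7 = p * (c 1 3 5 * c 2 5 7)\<^sup>2"
    "?x 2 3 4 * ?x 4 5 8 = q * (c 2 3 4 * c 4 5 8)\<^sup>2" "?x 3 5 6 * ?x 2 6 8 = q * (c 3 5 6 * c 2 6 8)\<^sup>2"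
    "?x 2 5 7 * ?x 3 7 8 = q * (c 2 5 7 * c 3 7 8)\<^sup>2"
    using nz gnz[of 1] gnz[of 2] gnz[of 3] gnz[of 4] gnz[of 5] gnz[of 6] gnz[of 7]
    unfolding p_def q_def ricci_weight_def by (simp_all add: field_simps power2_eq_square)
  \<comment> \<open>Relative to its last product, the terms of J1 are \<open>1 - s\<close> and
    \<open>s\<close>; through J2 the same \<open>s\<close> governs J3, where the ratios are
    \<open>s\<close> and \<open>1 + s\<close>.\<close>
  define s where "s = (c 2 3 4 * c 1 4 7) / (c 1 3 5 * c 2 5 7)"
  have S: "c 2 3 4 * c 1 4 7 = s * (c 1 3 5 * c 2 5 7)" using nz by (simp add: s_def)
  then have S1: "c 1 2 6 * c 3 6 7 = (1 - s) * (c 1 3 5 * c 2 5 7)" using J1 by algebra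
  have "c 1 3 5 * (c 2 3 4 * c 4 5 8 - s * (c 2 5 7 * c 3 7 8)) = 0" using J2 S by algebra
  then have S2: "c 2 3 4 * c 4 5 8 = s * (c 2 5 7 * c 3 7 8)" using nz by simp
  then have S3: "c 3 5 6 * c 2 6 8 = (1 + s) * (c 2 5 7 * c 3 7 8)" using J3 by algebra
  then have s: "1 + s \<noteq> 0" using nz by auto
  have A: "k\<^sup>2 = (1 - s)\<^sup>2 * ((e - a) * e)"
    using W(1,3) unfolding S1 e d by (simp add: power2_eq_square algebra_simps)
  have B: "b\<^sup>2 = (1 + s)\<^sup>2 * (e * a)"
    using W(5,6) unfolding S3 e d by (simp add: power2_eq_square algebra_simps)
  have C: "(b + k + e) * (a + b) = s\<^sup>2 * (e * a)"
    using W(4,6) unfolding S2 e d by (simp add: power2_eq_square algebra_simps)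
  have "?x 1 4 7 * ?x 3 7 8 = ?x 1 3 5 * ?x 4 5 8"
    using jacobi_weights[OF c D g, where i = 4 and j = 1 and l = 3 and p = 7 and q = 5 and m = 8 and
      ?a1.0 = 1 and ?b1.0 = 4 and ?a2.0 = 3 and ?b2.0 = 7 and ?a3.0 = 1 and ?b3.0 = 3 and ?a4.0 = 4 and ?b4.0 = 5]
    by (simp add: doubleton_eq_iff)
  then have E: "a * k = b * (e - a)"
    unfolding e d by (simp add: algebra_simps)
  \<comment> \<open>Multiplying C by \<open>a\<close> and inserting E turns its left side into
    \<open>e * (a + b)^2\<close>, so that C becomes a difference of squares.\<close>
  have "e * ((a + b - s * a) * (a + b + s * a)) = 0" using C E by algebra
  then have "a + b - s * a = 0 \<or> a + b + s * a = 0" using abke(3) by (metis mult_eq_0_iff)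
  then show False
  proof
    assume "a + b - s * a = 0"
    then have 1: "b = (s - 1) * a" by algebra
    \<comment> \<open>Comparing A with B through the square of E. The result is incompatible with B
      in this branch, as the two differ by \<open>(1 + s)^2 * a\<close>.\<close>
    have "e * a * (e - a) * ((1 + s)\<^sup>2 * (e - a) - (1 - s)\<^sup>2 * a) = 0" using A B E by algebra
    then have F: "(1 + s)\<^sup>2 * (e - a) = (1 - s)\<^sup>2 * a" using abke by simp
    have "a * ((1 - s)\<^sup>2 * a - (1 + s)\<^sup>2 * e) = 0" using B 1 by algebra
    then have "(1 - s)\<^sup>2 * a = (1 + s)\<^sup>2 * e" using abke by simp
    then have "(1 + s)\<^sup>2 * a = 0" using F by algebra
    then show False using s abke by simp
  next
    assume "a + b + s * a = 0"
    then have 2: "b = - (1 + s) * a" by algebra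
    have "(1 + s)\<^sup>2 * a * (a - e) = 0" using B 2 by algebra
    then show False using s abke by simp
  qed
qed

section \<open>Balanced metrics on the listed Lie algebras\<close>

lemma lie_of_d_Nil: "lie_of_d [] i j k = 0"
  by (simp add: lie_of_d_def)

lemma lie_of_d_Cons:
  "lie_of_d ((a, p, q, r) # ts) i j k =
    (if p = i \<and> q = j \<and> r = k then - a else 0) + (if p = j \<and> q = i \<and> r = k then a else 0) + lie_of_d ts i j k"
  by (simp add: lie_of_d_def)

lemma lie_of_d_antisym: "lie_of_d ts i j k = - lie_of_d ts j i k"
proof (induction ts)
  case (Cons t ts)
  obtain a p q r where t: "t = (a, p, q, r)" by (rule prod_cases4)
  define P Q :: real where "P = (if p = i \<and> q = j \<and> r = k then a else 0)"
    and "Q = (if p = j \<and> q = i \<and> r = k then a else 0)"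
  have "lie_of_d (t # ts) i j k = - P + Q + lie_of_d ts i j k"
    "lie_of_d (t # ts) j i k = - Q + P + lie_of_d ts j i k"
    by (simp_all add: t lie_of_d_Cons P_def Q_def)
  then show ?case using Cons.IH by linarith
qed (simp add: lie_of_d_Nil)

abbreviation "entry_bracket \<equiv> (\<lambda>(a :: real, p :: nat, q :: nat, r :: nat). (p, q, r))"

text \<open>For such a list at most one entry contributes to each structure constant, so entries
  cannot cancel and the list displays the diagram.\<close>

definition reduced_entries :: "(real \<times> nat \<times> nat \<times> nat) list \<Rightarrow> bool" where
  "reduced_entries ts \<longleftrightarrow> distinct (map entry_bracket ts)
     \<and> (\<forall>(a, p, q, r)\<in>set ts. a \<noteq> 0 \<and> 1 \<le> p \<and> p < q \<and> q \<le> 8 \<and> 1 \<le> r \<and> r \<le> 8)"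

lemma in_entry_brackets: "(i, j, k) \<in> set (map entry_bracket ts) \<longleftrightarrow> (\<exists>a. (a, i, j, k) \<in> set ts)"
  by force

lemma lie_of_d_eq_0:
  "(i, j, k) \<notin> set (map entry_bracket ts) \<Longrightarrow> (j, i, k) \<notin> set (map entry_bracket ts) \<Longrightarrow> lie_of_d ts i j k = 0"
proof (induction ts)
  case (Cons t ts)
  obtain a p q r where t: "t = (a, p, q, r)" by (rule prod_cases4)
  have "\<not> (p = i \<and> q = j \<and> r = k)" "\<not> (p = j \<and> q = i \<and> r = k)"
    using Cons.prems unfolding t list.map list.set split_conv by blast+
  moreover have "lie_of_d ts i j k = 0"
    using Cons.IH Cons.prems unfolding list.map list.set by blast
  ultimately show ?case unfolding t lie_of_d_Cons by (simp only: if_False add_0)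
qed (simp add: lie_of_d_Nil)

lemma lie_of_d_entry:
  assumes "reduced_entries ts" "(a, p, q, r) \<in> set ts"
  shows "lie_of_d ts p q r = - a"
  using assms
proof (induction ts)
  case (Cons t ts)
  obtain b u v w where t: "t = (b, u, v, w)" by (rule prod_cases4)
  have red: "reduced_entries ts" and uv: "u < v" and pq: "p < q"
    and new: "(u, v, w) \<notin> set (map entry_bracket ts)"
    using Cons.prems unfolding t reduced_entries_def by auto
  have "(v, u, w) \<notin> set (map entry_bracket ts)"
    using red uv unfolding reduced_entries_def by fastforce
  with new have z: "lie_of_d ts u v w = 0" by (rule lie_of_d_eq_0)
  show ?case
  proof (cases "(a, p, q, r) = t")
    case True
    then show ?thesis using z uv by (simp add: t lie_of_d_Cons)
  next
    case False
    then have mem: "(a, p, q, r) \<in> set ts" using Cons.prems(2) by simp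
    then have "(p, q, r) \<in> set (map entry_bracket ts)" by force
    then have "(u, v, w) \<noteq> (p, q, r)" using new by metis
    then show ?thesis using Cons.IH[OF red mem] uv pq by (auto simp: t lie_of_d_Cons)
  qed
qed simp

lemma brackets_lie_of_d:
  assumes "reduced_entries ts"
  shows "supported 8 (lie_of_d ts)" "brackets 8 (lie_of_d ts) = set (map entry_bracket ts)"
proof -
  have nz: "(i, j, k) \<in> set (map entry_bracket ts) \<or> (j, i, k) \<in> set (map entry_bracket ts)"
    if "lie_of_d ts i j k \<noteq> 0" for i j k
    using that lie_of_d_eq_0 by blast
  have ok: "1 \<le> i \<and> i < j \<and> j \<le> 8 \<and> 1 \<le> k \<and> k \<le> 8 \<and> lie_of_d ts i j k \<noteq> 0"
    if mem: "(i, j, k) \<in> set (map entry_bracket ts)" for i j k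
  proof -
    obtain a where a: "(a, i, j, k) \<in> set ts" using mem unfolding in_entry_brackets by blast
    then show ?thesis
      using assms lie_of_d_entry[OF assms a] unfolding reduced_entries_def by fastforce
  qed
  show "supported 8 (lie_of_d ts)"
    unfolding supported_def
  proof (intro allI impI)
    fix i j k assume "lie_of_d ts i j k \<noteq> 0"
    from nz[OF this] show "i \<in> {1..8} \<and> j \<in> {1..8} \<and> k \<in> {1..8}"
    proof
      assume "(i, j, k) \<in> set (map entry_bracket ts)"
      from ok[OF this] show ?thesis by simp
    next
      assume "(j, i, k) \<in> set (map entry_bracket ts)"
      from ok[OF this] show ?thesis by simp
    qed
  qed
  show "brackets 8 (lie_of_d ts) = set (map entry_bracket ts)"
  proof (intro subset_antisym subsetI)
    fix t assume "t \<in> brackets 8 (lie_of_d ts)"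
    then obtain i j k where t: "t = (i, j, k)" "i < j" "lie_of_d ts i j k \<noteq> 0"
      unfolding brackets_def by blast
    moreover have "(j, i, k) \<notin> set (map entry_bracket ts)"
      using ok[of j i k] t(2) by linarith
    ultimately show "t \<in> set (map entry_bracket ts)" using nz by blast
  next
    fix t assume t: "t \<in> set (map entry_bracket ts)"
    obtain i j k where ijk: "t = (i, j, k)" by (rule prod_cases3)
    show "t \<in> brackets 8 (lie_of_d ts)"
      using ok[OF t[unfolded ijk]] unfolding ijk brackets_def by simp
  qed
qed

lemma atLeastAtMost_1_8: "{1..8::nat} = set [1, 2, 3, 4, 5, 6, 7, 8]"
  by auto

text \<open>The Ricci weights are supplied as a witness \<open>ys\<close>, tied to the metric by
  equations without division, so that a concrete list leaves only elementary computations.\<close>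

lemma balanced_lie_of_d:
  assumes ts: "reduced_entries ts" and g: "\<forall>i\<in>set [1, 2, 3, 4, 5, 6, 7, 8]. g i \<noteq> 0"
    and ys: "list_all2 (\<lambda>(a, p, q, r) y. a\<^sup>2 * g r = y * (g p * g q)) ts ys"
    and bal: "\<forall>v\<in>set [1, 2, 3, 4, 5, 6, 7, 8]. (\<Sum>((a, p, q, r), y)\<leftarrow>zip ts ys.
      y * (of_bool (r = v) - of_bool (p = v) - of_bool (q = v))) = 0"
  shows "balanced 8 (lie_of_d ts) g"
proof -
  have gnz: "g i \<noteq> 0" if "1 \<le> i" "i \<le> 8" for i
    using g that unfolding atLeastAtMost_1_8[symmetric] by simp
  have "balance 8 (lie_of_d ts) g v = 0" if v: "v \<in> {1..8}" for v
  proof -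
    let ?f = "\<lambda>(i, j, k). ricci_weight (lie_of_d ts) g i j k * (of_bool (k = v) - of_bool (i = v) - of_bool (j = v))"
    let ?h = "\<lambda>((a :: real, p, q, r), y). y * (of_bool (r = v) - of_bool (p = v) - of_bool (q = v))"
    have dist: "distinct (map entry_bracket ts)" using ts by (simp add: reduced_entries_def)
    have "balance 8 (lie_of_d ts) g v = 2 * (\<Sum>t\<in>set (map entry_bracket ts). ?f t)"
      unfolding balance_eq_sum_brackets[OF brackets_lie_of_d(1)[OF ts] lie_of_d_antisym v]
        brackets_lie_of_d(2)[OF ts] ..
    also have "(\<Sum>t\<in>set (map entry_bracket ts). ?f t) = (\<Sum>t\<leftarrow>map entry_bracket ts. ?f t)"
      using dist by (simp only: sum.distinct_set_conv_list)
    also have "map ?f (map entry_bracket ts) = map ?h (zip ts ys)"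
    proof (rule nth_equalityI)
      show len: "length (map ?f (map entry_bracket ts)) = length (map ?h (zip ts ys))"
        using list_all2_lengthD[OF ys] by simp
      fix n assume "n < length (map ?f (map entry_bracket ts))"
      then have n: "n < length ts" "n < length ys" using len by simp_all
      obtain a p q r where t: "ts ! n = (a, p, q, r)" by (rule prod_cases4)
      then have mem: "(a, p, q, r) \<in> set ts" using nth_mem[OF n(1)] by simp
      have "a\<^sup>2 * g r = ys ! n * (g p * g q)" using list_all2_nthD[OF ys n(1)] by (simp add: t)
      moreover have "g p \<noteq> 0" "g q \<noteq> 0"
        using mem ts gnz unfolding reduced_entries_def by fastforce+
      ultimately have "ricci_weight (lie_of_d ts) g p q r = ys ! n"
        using lie_of_d_entry[OF ts mem] by (simp add: ricci_weight_def field_simps)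
      then show "map ?f (map entry_bracket ts) ! n = map ?h (zip ts ys) ! n"
        using n by (simp add: t)
    qed
    also have "sum_list (map ?h (zip ts ys)) = 0"
      using bal v unfolding atLeastAtMost_1_8[symmetric] by blast
    finally show ?thesis by simp
  qed
  then show ?thesis using gnz by (simp add: balanced_def diag_metric_def)
qed

text \<open>The diagram has already been brought to the listed one, so a diagonal rescaling is
  enough, with one equation per entry. The minus sign is that of
  \<open>de^r(e_p, e_q) = - c p q r\<close>.\<close>

lemma nice_equiv_lie_of_d:
  assumes c: "nice_alg 8 c" and ts: "reduced_entries ts" and D: "brackets 8 c = set (map entry_bracket ts)"
    and lam: "\<forall>i\<in>set [1, 2, 3, 4, 5, 6, 7, 8]. lam i \<noteq> (0::real)"
    and eq: "\<forall>(a, p, q, r)\<in>set ts. - a * (lam p * lam q) = c p q r * lam r"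
  shows "nice_equiv 8 c (lie_of_d ts)"
proof -
  have ordered: "lam i * lam j * lie_of_d ts i j k = c i j k * lam k" if "i < j" for i j k
  proof (cases "(i, j, k) \<in> set (map entry_bracket ts)")
    case True
    then obtain a where a: "(a, i, j, k) \<in> set ts" unfolding in_entry_brackets by blast
    then have "- a * (lam i * lam j) = c i j k * lam k" using eq by fast
    then show ?thesis using lie_of_d_entry[OF ts a] by (simp add: algebra_simps)
  next
    case False
    then have "c i j k = 0" using bracketsI[OF c D] that by blast
    moreover have "(j, i, k) \<notin> set (map entry_bracket ts)"
      using ts that unfolding reduced_entries_def by fastforce
    ultimately show ?thesis using False lie_of_d_eq_0 by simp
  qed
  have "lam i * lam j * lie_of_d ts i j k = c i j k * lam k" for i j k
  proof (cases i j rule: linorder_cases)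
    case less
    then show ?thesis by (rule ordered)
  next
    case equal
    then show ?thesis
      using nice_alg_antisym[OF c, of i i k] lie_of_d_antisym[of ts i i k] by simp
  next
    case greater
    then show ?thesis
      using ordered[OF greater, of k] nice_alg_antisym[OF c, of i j k] lie_of_d_antisym[of ts i j k]
      by (simp add: mult.commute)
  qed
  then show ?thesis
    unfolding nice_equiv_def using lam unfolding atLeastAtMost_1_8[symmetric]
    by (intro exI[of _ id] exI[of _ lam]) simp
qed

section \<open>Explicit Ricci-flat metrics\<close>

lemma balanced_L1: "\<exists>g. balanced 8 L1 g"
  unfolding L1_def
  \<comment> \<open>All coefficients of \<open>L1\<close> are 1 or -1, so a metric with entries 1 or
    -1 has weights 1 or -1, and only signs have to be chosen to balance every node. The other lists
    without a parameter are treated in the same way.\<close>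
  by (rule exI[of _ "\<lambda>i. [1,1,1,1,-1,-1,1,1] ! (i - 1)"], rule balanced_lie_of_d[where ys = "[1,1,-1,-1,-1,1,-1,1]"])
    (simp_all add: reduced_entries_def)

lemma balanced_L2: "\<exists>g. balanced 8 L2 g"
  unfolding L2_def
  by (rule exI[of _ "\<lambda>i. [1,1,1,1,1,-1,1,1] ! (i - 1)"], rule balanced_lie_of_d[where ys = "[1,1,-1,-1,-1,1,-1,1]"])
    (simp_all add: reduced_entries_def)

lemma balanced_L3: "\<exists>g. balanced 8 L3 g"
  unfolding L3_def
  by (rule exI[of _ "\<lambda>i. [1,1,1,1,-1,1,1,1] ! (i - 1)"], rule balanced_lie_of_d[where ys = "[1,-1,-1,1,-1,1,-1,1]"])
    (simp_all add: reduced_entries_def)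

lemma balanced_L6: "\<exists>g. balanced 8 L6 g"
  unfolding L6_def
  by (rule exI[of _ "\<lambda>i. [1,1,1,1,1,-1,1,1] ! (i - 1)"], rule balanced_lie_of_d[where ys = "[1,1,-1,-1,-1,1,1,-1]"])
    (simp_all add: reduced_entries_def)

lemma balanced_L7: "\<exists>g. balanced 8 L7 g"
  unfolding L7_def
  by (rule exI[of _ "\<lambda>i. [1,1,1,1,1,-1,1,1] ! (i - 1)"], rule balanced_lie_of_d[where ys = "[1,1,-1,-1,-1,1,1,-1]"])
    (simp_all add: reduced_entries_def)

lemma balanced_L9: "\<exists>g. balanced 8 L9 g"
  unfolding L9_def
  by (rule exI[of _ "\<lambda>i. [1,1,1,1,1,1,-1,1] ! (i - 1)"], rule balanced_lie_of_d[where ys = "[1,-1,-1,1]"])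
    (simp_all add: reduced_entries_def)

text \<open>The metric is chosen to give the weights \<open>a - 1\<close>, \<open>- a\<close> and 1,
  each on two brackets. Their sum is zero, which is the equation at each of the nodes 1, 2, 3 and
  8.\<close>

lemma balanced_L8:
  assumes "a \<noteq> 0" "a \<noteq> 1"
  shows "\<exists>g. balanced 8 (L8 a) g"
proof -
  have "a - 1 \<noteq> 0" using assms by simp
  then show ?thesis
    unfolding L8_def using assms
    by (intro exI[of _ "\<lambda>i. [1, 1, 1, 1, 1 / (a - 1), - 1 / a, 1, 1] ! (i - 1)"]
        balanced_lie_of_d[where ys = "[a - 1, - a, 1, 1, - a, a - 1]"])
      (simp_all add: reduced_entries_def power2_eq_square)
qed

text \<open>One metric serves both families because the weights contain only squares of structure
  constants. It requires \<open>s * s = 1 / a\<close>, for instance at the bracket (2,4,5), which is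
  where a positive \<open>a\<close> is needed.\<close>

lemma balanced_L4_L5:
  assumes "a > 0" "a \<noteq> 1"
  shows "\<exists>g. balanced 8 (L4 a) g" "\<exists>g. balanced 8 (L5 a) g"
proof -
  define s b where "s = 1 / sqrt a" and "b = a - 1"
  have s: "s \<noteq> 0" "s * s = 1 / a" and b: "b \<noteq> 0" "a - 1 = b" and a: "a \<noteq> 0"
    using assms by (auto simp: s_def b_def)
  let ?g = "\<lambda>i. [1, s, 1, - s / b, 1 / a, - s, - b / a, s] ! (i - 1)"
  let ?ys = "[- b, a, - b, b, - 1, - b, b, - 1, a, - b]"
  have "balanced 8 (L4 a) ?g"
    unfolding L4_def b(2) using s b(1) a
    by (intro balanced_lie_of_d[where ys = ?ys])
      (simp_all add: reduced_entries_def power2_eq_square mult.assoc[symmetric], simp_all add: b_def mult.assoc)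
  then show "\<exists>g. balanced 8 (L4 a) g" by blast
  have "balanced 8 (L5 a) ?g"
    unfolding L5_def b(2) using s b(1) a
    by (intro balanced_lie_of_d[where ys = ?ys])
      (simp_all add: reduced_entries_def power2_eq_square mult.assoc[symmetric], simp_all add: b_def mult.assoc)
  then show "\<exists>g. balanced 8 (L5 a) g" by blast
qed

section \<open>Normal forms\<close>

text \<open>The scales of nodes 1 and 2 are set to 1, and each later scale is fixed by one bracket
  into its node. Nodes 7 and 8 receive a second bracket each; these match because of the two-term
  Jacobi identities.\<close>

lemma nice_equiv_L1:
  assumes c: "nice_alg 8 c" and D: "brackets 8 c = set [(1,2,3),(1,3,4),(2,3,5),(1,4,6),(1,5,7),(2,4,7),(2,6,8),(3,4,8)]"
  shows "nice_equiv 8 c L1"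
proof -
  have anti: "c i j k = - c j i k" for i j k by (rule nice_alg_antisym[OF c])
  note nz = structure_constants_nonzero[OF D, simplified, folded One_nat_def]
  have J1: "c 2 3 5 * c 1 5 7 - c 1 3 4 * c 2 4 7 = 0"
    using jacobi_two_diagram[OF c D, of 2 3 5 1 4 7]
      anti[of 3 1 4] anti[of 4 2 7] anti[of 5 1 7] nz by (simp add: doubleton_eq_iff)
  have J2: "c 1 4 6 * c 2 6 8 + c 1 2 3 * c 3 4 8 = 0"
    using jacobi_two_diagram[OF c D, of 4 1 6 2 3 8]
      anti[of 4 1 6] anti[of 6 2 8] nz by (simp add: doubleton_eq_iff)
  define l3 where "l3 = 1 / c 1 2 3"
  define l4 where "l4 = - l3 / c 1 3 4"
  define l5 where "l5 = - l3 / c 2 3 5"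
  define l6 where "l6 = - l4 / c 1 4 6"
  define l7 where "l7 = - l5 / c 1 5 7"
  define l8 where "l8 = - l6 / c 2 6 8"
  have lnz: "l3 \<noteq> 0" "l4 \<noteq> 0" "l5 \<noteq> 0" "l6 \<noteq> 0" "l7 \<noteq> 0" "l8 \<noteq> 0"
    using nz by (simp_all add: l3_def l4_def l5_def l6_def l7_def l8_def)
  have E123: "(1 * 1) = c 1 2 3 * l3"
    using nz by (simp add: l3_def l4_def l5_def l6_def l7_def l8_def field_simps)
  have E134: "- (1 * l3) = c 1 3 4 * l4"
    using nz by (simp add: l3_def l4_def l5_def l6_def l7_def l8_def field_simps)
  have E235: "- (1 * l3) = c 2 3 5 * l5"
    using nz by (simp add: l3_def l4_def l5_def l6_def l7_def l8_def field_simps)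
  have E146: "- (1 * l4) = c 1 4 6 * l6"
    using nz by (simp add: l3_def l4_def l5_def l6_def l7_def l8_def field_simps)
  have E157: "- (1 * l5) = c 1 5 7 * l7"
    using nz by (simp add: l3_def l4_def l5_def l6_def l7_def l8_def field_simps)
  have E247: "- (1 * l4) = c 2 4 7 * l7"
    using nz J1 J2 by (simp add: l3_def l4_def l5_def l6_def l7_def l8_def field_simps)
  have E268: "- (1 * l6) = c 2 6 8 * l8"
    using nz by (simp add: l3_def l4_def l5_def l6_def l7_def l8_def field_simps)
  have E348: "- (l3 * l4) = c 3 4 8 * l8"
    using nz J1 J2 by (simp add: l3_def l4_def l5_def l6_def l7_def l8_def field_simps)
  show ?thesis
    unfolding L1_def
    by (rule nice_equiv_lie_of_d[OF c, where lam = "\<lambda>i. [1, 1, l3, l4, l5, l6, l7, l8] ! (i - 1)"])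
      (use lnz E123 E134 E235 E146 E157 E247 E268 E348 in \<open>simp_all add: D reduced_entries_def\<close>)
qed

lemma nice_equiv_L2:
  assumes c: "nice_alg 8 c" and D: "brackets 8 c = set [(1,2,4),(1,4,5),(1,5,6),(2,4,6),(1,6,7),(2,5,7),(2,6,8),(4,5,8)]"
  shows "nice_equiv 8 c L2"
proof -
  have anti: "c i j k = - c j i k" for i j k by (rule nice_alg_antisym[OF c])
  note nz = structure_constants_nonzero[OF D, simplified, folded One_nat_def]
  have J1: "c 2 4 6 * c 1 6 7 - c 1 4 5 * c 2 5 7 = 0"
    using jacobi_two_diagram[OF c D, of 2 4 6 1 5 7]
      anti[of 4 1 5] anti[of 5 2 7] anti[of 6 1 7] nz by (simp add: doubleton_eq_iff)
  have J2: "c 1 5 6 * c 2 6 8 + c 1 2 4 * c 4 5 8 = 0"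
    using jacobi_two_diagram[OF c D, of 5 1 6 2 4 8]
      anti[of 5 1 6] anti[of 6 2 8] nz by (simp add: doubleton_eq_iff)
  \<comment> \<open>The scale of node 2 is determined by requiring that the brackets (1,5,6) and
    (2,4,6) impose the same scale on node 6.\<close>
  define w where "w = - c 2 4 6 / (c 1 4 5 * c 1 5 6)"
  define l4 where "l4 = w / c 1 2 4"
  define l5 where "l5 = - l4 / c 1 4 5"
  define l6 where "l6 = - l5 / c 1 5 6"
  define l7 where "l7 = - l6 / c 1 6 7"
  define l8 where "l8 = - (w * l6) / c 2 6 8"
  have lnz: "w \<noteq> 0" "l4 \<noteq> 0" "l5 \<noteq> 0" "l6 \<noteq> 0" "l7 \<noteq> 0" "l8 \<noteq> 0"
    using nz by (simp_all add: w_def l4_def l5_def l6_def l7_def l8_def)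
  have E124: "(1 * w) = c 1 2 4 * l4"
    using nz by (simp add: w_def l4_def l5_def l6_def l7_def l8_def field_simps)
  have E145: "- (1 * l4) = c 1 4 5 * l5"
    using nz by (simp add: w_def l4_def l5_def l6_def l7_def l8_def field_simps)
  have E156: "- (1 * l5) = c 1 5 6 * l6"
    using nz by (simp add: w_def l4_def l5_def l6_def l7_def l8_def field_simps)
  have E246: "- (w * l4) = c 2 4 6 * l6"
    using nz by (simp add: w_def l4_def l5_def l6_def l7_def l8_def field_simps)
  have E167: "- (1 * l6) = c 1 6 7 * l7"
    using nz by (simp add: w_def l4_def l5_def l6_def l7_def l8_def field_simps)
  have E257: "- (w * l5) = c 2 5 7 * l7"
    using nz J1 J2 by (simp add: w_def l4_def l5_def l6_def l7_def l8_def field_simps)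
  have E268: "- (w * l6) = c 2 6 8 * l8"
    using nz by (simp add: w_def l4_def l5_def l6_def l7_def l8_def field_simps)
  have E458: "- (l4 * l5) = c 4 5 8 * l8"
    using nz J1 J2 by (simp add: w_def l4_def l5_def l6_def l7_def l8_def field_simps) algebra
  show ?thesis
    unfolding L2_def
    by (rule nice_equiv_lie_of_d[OF c, where lam = "\<lambda>i. [1, w, 1, l4, l5, l6, l7, l8] ! (i - 1)"])
      (use lnz E124 E145 E156 E246 E167 E257 E268 E458 in \<open>simp_all add: D reduced_entries_def\<close>)
qed

lemma nice_equiv_L3:
  assumes c: "nice_alg 8 c" and D: "brackets 8 c = set [(1,2,4),(1,3,5),(2,4,5),(1,4,6),(2,5,7),(3,4,7),(1,5,8),(2,6,8)]"
  shows "nice_equiv 8 c L3"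
proof -
  have anti: "c i j k = - c j i k" for i j k by (rule nice_alg_antisym[OF c])
  note nz = structure_constants_nonzero[OF D, simplified, folded One_nat_def]
  have J1: "c 1 3 5 * c 2 5 7 - c 1 2 4 * c 3 4 7 = 0"
    using jacobi_two_diagram[OF c D, of 3 1 5 2 4 7]
      anti[of 3 1 5] anti[of 4 3 7] anti[of 5 2 7] nz by (simp add: doubleton_eq_iff)
  have J2: "c 2 4 5 * c 1 5 8 - c 1 4 6 * c 2 6 8 = 0"
    using jacobi_two_diagram[OF c D, of 2 4 5 1 6 8]
      anti[of 4 1 6] anti[of 5 1 8] anti[of 6 2 8] nz by (simp add: doubleton_eq_iff)
  \<comment> \<open>The scale of node 3 is determined by requiring that (1,3,5) and (2,4,5) agree on
    the scale of node 5.\<close>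
  define u where "u = - c 1 3 5 / (c 1 2 4 * c 2 4 5)"
  define l4 where "l4 = - 1 / c 1 2 4"
  define l5 where "l5 = - u / c 1 3 5"
  define l6 where "l6 = - l4 / c 1 4 6"
  define l7 where "l7 = - l5 / c 2 5 7"
  define l8 where "l8 = - l5 / c 1 5 8"
  have lnz: "u \<noteq> 0" "l4 \<noteq> 0" "l5 \<noteq> 0" "l6 \<noteq> 0" "l7 \<noteq> 0" "l8 \<noteq> 0"
    using nz by (simp_all add: u_def l4_def l5_def l6_def l7_def l8_def)
  have E124: "- (1 * 1) = c 1 2 4 * l4"
    using nz by (simp add: u_def l4_def l5_def l6_def l7_def l8_def field_simps)
  have E135: "- (1 * u) = c 1 3 5 * l5"
    using nz by (simp add: u_def l4_def l5_def l6_def l7_def l8_def field_simps)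
  have E245: "- (1 * l4) = c 2 4 5 * l5"
    using nz by (simp add: u_def l4_def l5_def l6_def l7_def l8_def field_simps)
  have E146: "- (1 * l4) = c 1 4 6 * l6"
    using nz by (simp add: u_def l4_def l5_def l6_def l7_def l8_def field_simps)
  have E257: "- (1 * l5) = c 2 5 7 * l7"
    using nz by (simp add: u_def l4_def l5_def l6_def l7_def l8_def field_simps)
  have E347: "- (u * l4) = c 3 4 7 * l7"
    using nz J1 J2 by (simp add: u_def l4_def l5_def l6_def l7_def l8_def field_simps)
  have E158: "- (1 * l5) = c 1 5 8 * l8"
    using nz by (simp add: u_def l4_def l5_def l6_def l7_def l8_def field_simps)
  have E268: "- (1 * l6) = c 2 6 8 * l8"
    using nz J1 J2 by (simp add: u_def l4_def l5_def l6_def l7_def l8_def field_simps)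
  show ?thesis
    unfolding L3_def
    by (rule nice_equiv_lie_of_d[OF c, where lam = "\<lambda>i. [1, 1, u, l4, l5, l6, l7, l8] ! (i - 1)"])
      (use lnz E124 E135 E245 E146 E257 E347 E158 E268 in \<open>simp_all add: D reduced_entries_def\<close>)
qed

lemma nice_equiv_L9:
  assumes c: "nice_alg 8 c" and D: "brackets 8 c = set [(1,2,6),(1,3,7),(2,7,8),(3,6,8)]"
  shows "nice_equiv 8 c L9"
proof -
  have anti: "c i j k = - c j i k" for i j k by (rule nice_alg_antisym[OF c])
  note nz = structure_constants_nonzero[OF D, simplified, folded One_nat_def]
  have J1: "c 1 3 7 * c 2 7 8 - c 1 2 6 * c 3 6 8 = 0"
    using jacobi_two_diagram[OF c D, of 3 1 7 2 6 8]
      anti[of 3 1 7] anti[of 6 3 8] anti[of 7 2 8] nz by (simp add: doubleton_eq_iff)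
  define l6 where "l6 = - 1 / c 1 2 6"
  define l7 where "l7 = - 1 / c 1 3 7"
  define l8 where "l8 = - l7 / c 2 7 8"
  have lnz: "l6 \<noteq> 0" "l7 \<noteq> 0" "l8 \<noteq> 0"
    using nz by (simp_all add: l6_def l7_def l8_def)
  have E126: "- (1 * 1) = c 1 2 6 * l6"
    using nz by (simp add: l6_def l7_def l8_def field_simps)
  have E137: "- (1 * 1) = c 1 3 7 * l7"
    using nz by (simp add: l6_def l7_def l8_def field_simps)
  have E278: "- (1 * l7) = c 2 7 8 * l8"
    using nz by (simp add: l6_def l7_def l8_def field_simps)
  have E368: "- (1 * l6) = c 3 6 8 * l8"
    using nz J1 by (simp add: l6_def l7_def l8_def field_simps)
  show ?thesis
    unfolding L9_def
    by (rule nice_equiv_lie_of_d[OF c, where lam = "\<lambda>i. [1, 1, 1, 1, 1, l6, l7, l8] ! (i - 1)"])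
      (use lnz E126 E137 E278 E368 in \<open>simp_all add: D reduced_entries_def\<close>)
qed

text \<open>Normalising the four brackets into nodes 5 and 6 leaves the condition
  \<open>w * w = s * K\<close> on the scale \<open>w\<close> of node 2, where \<open>s\<close> is
  the coefficient at (1,4,5). A real \<open>w\<close> exists only for \<open>s\<close> the sign of
  \<open>K\<close>, which decides between the two forms.\<close>

lemma nice_equiv_L6_L7:
  assumes c: "nice_alg 8 c" and D: "brackets 8 c = set [(1,4,5),(2,3,5),(1,3,6),(2,4,6),(1,6,7),(2,5,7),(1,5,8),(2,6,8)]"
  shows "nice_equiv 8 c L6 \<or> nice_equiv 8 c L7"
proof -
  have anti: "c i j k = - c j i k" for i j k by (rule nice_alg_antisym[OF c])
  note nz = structure_constants_nonzero[OF D, simplified, folded One_nat_def]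
  have J1: "c 2 3 5 * c 1 5 8 - c 1 3 6 * c 2 6 8 = 0"
    using jacobi_two_diagram[OF c D, of 2 3 5 1 6 8]
      anti[of 3 1 6] anti[of 5 1 8] anti[of 6 2 8] nz by (simp add: doubleton_eq_iff)
  have J2: "c 2 4 6 * c 1 6 7 - c 1 4 5 * c 2 5 7 = 0"
    using jacobi_two_diagram[OF c D, of 2 4 6 1 5 7]
      anti[of 4 1 5] anti[of 5 2 7] anti[of 6 1 7] nz by (simp add: doubleton_eq_iff)
  define K where "K = c 2 3 5 * c 2 4 6 / (c 1 3 6 * c 1 4 5)"
  define s w where "s = sgn K" and "w = sqrt \<bar>K\<bar>"
  have K: "K \<noteq> 0" using nz by (simp add: K_def)
  then have s: "s = 1 \<or> s = - 1" and w: "w \<noteq> 0" by (auto simp: s_def w_def sgn_if)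
  have "w * w = s * K" by (simp add: w_def s_def sgn_if)
  then have W: "w * w * (c 1 3 6 * c 1 4 5) = s * (c 2 3 5 * c 2 4 6)"
    using nz by (simp add: K_def)
  \<comment> \<open>J2 carries the condition on \<open>w\<close> over to the brackets into node 7,
    so the same sign \<open>s\<close> appears at (1,6,7).\<close>
  have "c 1 4 5 * (w * w * (c 1 3 6 * c 1 6 7) - s * (c 2 3 5 * c 2 5 7)) = 0" using W J2 by algebra
  then have W2: "w * w * (c 1 3 6 * c 1 6 7) = s * (c 2 3 5 * c 2 5 7)" using nz by simp
  define v l5 l6 l7 l8 where "v = c 2 4 6 / (c 1 3 6 * w)" and "l5 = - w / c 2 3 5" and "l6 = - 1 / c 1 3 6"
    and "l7 = s / (c 1 3 6 * c 1 6 7)" and "l8 = w / (c 2 3 5 * c 1 5 8)"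
  note l_defs = v_def l5_def l6_def l7_def l8_def
  have lnz: "v \<noteq> 0" "l5 \<noteq> 0" "l6 \<noteq> 0" "l7 \<noteq> 0" "l8 \<noteq> 0"
    using nz w s by (auto simp: l_defs)
  have E145: "- s * (1 * v) = c 1 4 5 * l5"
    using nz w W by (simp add: l_defs field_simps)
  have E235: "- 1 * (w * 1) = c 2 3 5 * l5"
    using nz w by (simp add: l_defs field_simps)
  have E136: "- 1 * (1 * 1) = c 1 3 6 * l6"
    using nz w by (simp add: l_defs field_simps)
  have E246: "- 1 * (w * v) = c 2 4 6 * l6"
    using nz w by (simp add: l_defs field_simps)
  have E167: "- s * (1 * l6) = c 1 6 7 * l7"
    using nz w by (simp add: l_defs field_simps)
  have E257: "- 1 * (w * l5) = c 2 5 7 * l7"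
    using nz w W2 by (simp add: l_defs field_simps)
  have E158: "- 1 * (1 * l5) = c 1 5 8 * l8"
    using nz w by (simp add: l_defs field_simps)
  have E268: "- 1 * (w * l6) = c 2 6 8 * l8"
    using nz w J1 by (simp add: l_defs field_simps)
  have "nice_equiv 8 c (lie_of_d [(s, 1, 4, 5), (1, 2, 3, 5), (1, 1, 3, 6), (1, 2, 4, 6), (s, 1, 6, 7), (1, 2, 5, 7), (1, 1, 5, 8), (1, 2, 6, 8)])"
    by (rule nice_equiv_lie_of_d[OF c, where lam = "\<lambda>i. [1, w, 1, v, l5, l6, l7, l8] ! (i - 1)"])
      (use s w lnz E145[symmetric] E235[symmetric] E136[symmetric] E246[symmetric] E167[symmetric] E257[symmetric] E158[symmetric] E268[symmetric] in \<open>auto simp: D reduced_entries_def\<close>)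
  then show ?thesis using s unfolding L6_def L7_def by auto
qed

text \<open>The parameter is the ratio of two terms of a three-term Jacobi identity; the third term
  is then \<open>a - 1\<close> in the same unit. Both values 0 and 1 are excluded since all three
  terms are nonzero.\<close>

lemma nice_equiv_L8:
  assumes c: "nice_alg 8 c" and D: "brackets 8 c = set [(1,2,5),(1,3,6),(2,3,7),(1,7,8),(2,6,8),(3,5,8)]"
  shows "\<exists>a. a \<noteq> 0 \<and> a \<noteq> 1 \<and> nice_equiv 8 c (L8 a)"
proof -
  have anti: "c i j k = - c j i k" for i j k by (rule nice_alg_antisym[OF c])
  note nz = structure_constants_nonzero[OF D, simplified, folded One_nat_def]
  have J1: "c 1 2 5 * c 3 5 8 + c 2 3 7 * c 1 7 8 - c 1 3 6 * c 2 6 8 = 0"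
    using jacobi_three[OF c, of 1 2 5 3 7 6 8]
      anti[of 3 1 6] anti[of 5 3 8] anti[of 6 2 8] anti[of 7 1 8] nz by (simp add: doubleton_eq_iff)
  define a where "a = c 1 3 6 * c 2 6 8 / (c 2 3 7 * c 1 7 8)"
  have a1: "a - 1 = c 1 2 5 * c 3 5 8 / (c 2 3 7 * c 1 7 8)"
    using J1 nz by (simp add: a_def field_simps)
  have a: "a \<noteq> 0" "a - 1 \<noteq> 0" using nz unfolding a1 by (simp_all add: a_def)
  define l5 l6 l7 l8 where "l5 = - (a - 1) / c 1 2 5" and "l6 = - a / c 1 3 6" and "l7 = - 1 / c 2 3 7"
    and "l8 = 1 / (c 2 3 7 * c 1 7 8)"
  note l_defs = l5_def l6_def l7_def l8_def
  have lnz: "l5 \<noteq> 0" "l6 \<noteq> 0" "l7 \<noteq> 0" "l8 \<noteq> 0" using nz a by (auto simp: l_defs)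
  have E125: "- (a - 1) * (1 * 1) = c 1 2 5 * l5" and E136: "- a * (1 * 1) = c 1 3 6 * l6"
    and E237: "- 1 * (1 * 1) = c 2 3 7 * l7" and E178: "- 1 * (1 * l7) = c 1 7 8 * l8"
    using nz by (simp_all add: l_defs)
  have E268: "- 1 * (1 * l6) = c 2 6 8 * l8" using nz by (simp add: l_defs a_def)
  have E358: "- 1 * (1 * l5) = c 3 5 8 * l8" using nz unfolding l_defs a1 by simp
  have "nice_equiv 8 c (L8 a)"
    unfolding L8_def
    by (rule nice_equiv_lie_of_d[OF c, where lam = "\<lambda>i. [1, 1, 1, 1, l5, l6, l7, l8] ! (i - 1)"])
      (use a lnz E125[symmetric] E136[symmetric] E237[symmetric] E178[symmetric] E268[symmetric] E358[symmetric] in \<open>simp_all add: D reduced_entries_def\<close>)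
  then show ?thesis using a by auto
qed

text \<open>As for \<open>L8\<close>, the parameter comes from the three-term Jacobi identity into
  node 8, and as for \<open>L6\<close> and \<open>L7\<close> a sign \<open>s\<close> remains after
  rescaling. The positivity of \<open>a\<close> does not follow from the Jacobi identities and is
  extracted from the metric.\<close>

lemma nice_equiv_L4_L5:
  assumes c: "nice_alg 8 c" and D: "brackets 8 c = set [(1,2,4),(1,3,5),(2,4,5),(1,4,6),(2,3,6),(1,5,7),(2,6,7),(1,6,8),(2,5,8),(3,4,8)]"
    and g: "balanced 8 c g"
  shows "\<exists>a. a > 0 \<and> a \<noteq> 1 \<and> (nice_equiv 8 c (L4 a) \<or> nice_equiv 8 c (L5 a))"
proof -
  have anti: "c i j k = - c j i k" for i j k by (rule nice_alg_antisym[OF c])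
  note nz = structure_constants_nonzero[OF D, simplified, folded One_nat_def]
  have J1: "c 1 2 4 * c 3 4 8 + c 2 3 6 * c 1 6 8 - c 1 3 5 * c 2 5 8 = 0"
    using jacobi_three[OF c, of 1 2 4 3 6 5 8]
      anti[of 3 1 5] anti[of 4 3 8] anti[of 5 2 8] anti[of 6 1 8] nz by (simp add: doubleton_eq_iff)
  have J2: "c 2 4 5 * c 1 5 7 - c 1 4 6 * c 2 6 7 = 0"
    using jacobi_two_diagram[OF c D, of 2 4 5 1 6 7]
      anti[of 4 1 6] anti[of 5 1 7] anti[of 6 2 7] nz by (simp add: doubleton_eq_iff)
  have gnz: "g i \<noteq> 0" if "i \<in> {1..8}" for i
    using g that by (simp add: balanced_def diag_metric_def)
  define a where "a = c 1 3 5 * c 2 5 8 / (c 2 3 6 * c 1 6 8)"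
  have A: "a * (c 2 3 6 * c 1 6 8) = c 1 3 5 * c 2 5 8" using nz by (simp add: a_def)
  have B: "(a - 1) * (c 2 3 6 * c 1 6 8) = c 1 2 4 * c 3 4 8" using A J1 by algebra
  have a0: "a \<noteq> 0" using A nz by auto
  have a1: "a - 1 \<noteq> 0"
  proof
    assume "a - 1 = 0"
    then show False using B nz by simp
  qed
  have "a > 0"
  proof -
    let ?x = "ricci_weight c g"
    note N = node_equations[OF c D g, simplified, folded One_nat_def]
    note xnz = weights_nonzero[OF c D g, simplified, folded One_nat_def]
    have e: "?x 1 4 6 = - ?x 2 4 5" "?x 1 6 8 = ?x 2 3 6" "?x 2 5 8 = ?x 1 3 5" "?x 3 4 8 = ?x 1 2 4"
      "?x 1 2 4 = - ?x 1 3 5 - ?x 2 3 6"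
      using N by linarith+
    \<comment> \<open>The four metric factors multiply to a square, so the product is positive.
      Since the last two weights are opposite, the first two have opposite signs.\<close>
    have "?x 1 3 5 * ?x 2 3 6 * (?x 1 4 6 * ?x 2 4 5)
      = (c 1 3 5 * c 2 3 6 * c 1 4 6 * c 2 4 5 * g 5 * g 6 / (g 1 * g 2 * g 3 * g 4))\<^sup>2"
      using gnz[of 1] gnz[of 2] gnz[of 3] gnz[of 4] unfolding ricci_weight_def
      by (simp add: field_simps power2_eq_square)
    also have "\<dots> > 0" using nz gnz[of 1] gnz[of 2] gnz[of 3] gnz[of 4] gnz[of 5] gnz[of 6] by simp
    finally have "0 < ?x 1 3 5 * ?x 2 3 6 * - (?x 2 4 5 * ?x 2 4 5)" unfolding e by simp
    moreover have "?x 2 4 5 * ?x 2 4 5 > 0" using xnz by (metis not_real_square_gt_zero)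
    ultimately have neg: "?x 1 3 5 * ?x 2 3 6 < 0"
      by (simp add: mult_less_0_iff zero_less_mult_iff)
    define p where "p = g 8 / (g 1 * g 2 * g 3)"
    have W: "?x 1 3 5 * ?x 2 5 8 = p * (c 1 3 5 * c 2 5 8)\<^sup>2" "?x 2 3 6 * ?x 1 6 8 = p * (c 2 3 6 * c 1 6 8)\<^sup>2"
      "?x 1 2 4 * ?x 3 4 8 = p * (c 1 2 4 * c 3 4 8)\<^sup>2"
      using gnz[of 1] gnz[of 2] gnz[of 3] gnz[of 4] gnz[of 5] gnz[of 6]
      unfolding p_def ricci_weight_def by (simp_all add: field_simps power2_eq_square)
    \<comment> \<open>Square the relation between the weights of (1,2,4), (1,3,5) and (2,3,6): by W
      the three squares are in the ratio \<open>(a - 1)^2\<close>, \<open>a^2\<close>, 1, so the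
      mixed term is \<open>- a\<close> in that unit.\<close>
    have "?x 1 3 5 * ?x 2 3 6 = - a * (p * (c 2 3 6 * c 1 6 8)\<^sup>2)"
      using W unfolding A[symmetric] B[symmetric] e by algebra
    also have "p * (c 2 3 6 * c 1 6 8)\<^sup>2 = (?x 2 3 6)\<^sup>2"
      using W(2) unfolding e by (simp add: power2_eq_square)
    finally have "0 < a * (?x 2 3 6)\<^sup>2" using neg by simp
    then show ?thesis by (simp add: zero_less_mult_iff)
  qed
  \<comment> \<open>Solving the entries (1,2,4), (1,3,5), (2,4,5), (1,4,6) for the scales of nodes
    4, 5, 3, 6 leaves at (2,3,6) the condition \<open>w * w = s * K\<close>, which forces
    \<open>s\<close> to be the sign of \<open>K\<close>.\<close>
  define K where "K = a * (c 2 4 5 * c 2 3 6) / (c 1 3 5 * c 1 4 6)"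
  define s w where "s = sgn K" and "w = sqrt \<bar>K\<bar>"
  have K: "K \<noteq> 0" using nz a0 by (simp add: K_def)
  then have s: "s = 1 \<or> s = - 1" and w: "w \<noteq> 0" by (auto simp: s_def w_def sgn_if)
  have "w * w = s * K" by (simp add: w_def s_def sgn_if)
  then have W: "w * w * (c 1 3 5 * c 1 4 6) = s * a * (c 2 4 5 * c 2 3 6)"
    using nz by (simp add: K_def)
  have "c 1 3 5 * (w * w * (c 1 4 6 * c 1 6 8) - s * (c 2 4 5 * c 2 5 8)) = 0" using W A by algebra
  then have W2: "w * w * (c 1 4 6 * c 1 6 8) = s * (c 2 4 5 * c 2 5 8)" using nz by simp
  define b where "b = a - 1"
  note B = B[folded b_def] and a1 = a1[folded b_def]
  define u l4 l5 l6 l7 l8 where "u = - b * w * w * c 1 3 5 / (a * c 1 2 4 * c 2 4 5)" and "l4 = - b * w / c 1 2 4"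
    and "l5 = b * w * w / (c 1 2 4 * c 2 4 5)" and "l6 = s * b * w / (c 1 2 4 * c 1 4 6)"
    and "l7 = - s * b * w * w / (c 1 2 4 * c 2 4 5 * c 1 5 7)" and "l8 = - s * b * w / (c 1 2 4 * c 1 4 6 * c 1 6 8)"
  note l_defs = u_def l4_def l5_def l6_def l7_def l8_def
  have lnz: "u \<noteq> 0" "l4 \<noteq> 0" "l5 \<noteq> 0" "l6 \<noteq> 0" "l7 \<noteq> 0" "l8 \<noteq> 0"
    using nz w s a0 a1 by (auto simp: l_defs)
  have E124: "- b * (1 * w) = c 1 2 4 * l4"
    using nz w by (simp add: l_defs field_simps)
  have E135: "- a * (1 * u) = c 1 3 5 * l5"
    using nz w a0 by (simp add: l_defs field_simps)
  have E245: "- 1 * (w * l4) = c 2 4 5 * l5"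
    using nz w by (simp add: l_defs field_simps)
  have E146: "- s * (1 * l4) = c 1 4 6 * l6"
    using nz w by (simp add: l_defs field_simps)
  have E236: "- 1 * (w * u) = c 2 3 6 * l6"
    using nz w a0 a1 W by (simp add: l_defs field_simps; algebra)
  have E157: "- s * (1 * l5) = c 1 5 7 * l7"
    using nz w by (simp add: l_defs field_simps)
  have E267: "- 1 * (w * l6) = c 2 6 7 * l7"
    using nz w J2 by (simp add: l_defs field_simps; algebra)
  have E168: "- 1 * (1 * l6) = c 1 6 8 * l8"
    using nz w by (simp add: l_defs field_simps)
  have E258: "- 1 * (w * l5) = c 2 5 8 * l8"
    using nz w a1 W2 by (simp add: l_defs field_simps; algebra)
  \<comment> \<open>W and B together give a second expression for \<open>u\<close>, without
    \<open>w\<close>, from which the last bracket (3,4,8) is immediate.\<close>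
  have "b * (w * w * (c 1 3 5 * c 1 4 6)) * c 1 6 8 = s * a * c 2 4 5 * (b * (c 2 3 6 * c 1 6 8))"
    unfolding W by simp
  then have "b * w * w * c 1 3 5 * (c 1 4 6 * c 1 6 8) = s * c 3 4 8 * (a * c 1 2 4 * c 2 4 5)"
    unfolding B by (simp add: ac_simps)
  then have "b * w * w * c 1 3 5 / (a * c 1 2 4 * c 2 4 5) = s * c 3 4 8 / (c 1 4 6 * c 1 6 8)"
    using nz a0 by (simp add: frac_eq_eq)
  then have u: "u = - s * c 3 4 8 / (c 1 4 6 * c 1 6 8)" unfolding u_def by simp
  have E348: "- 1 * (u * l4) = c 3 4 8 * l8"
    unfolding u l4_def l8_def using nz by (simp add: field_simps)
  have "nice_equiv 8 c (lie_of_d [(b, 1, 2, 4), (a, 1, 3, 5), (1, 2, 4, 5), (s, 1, 4, 6), (1, 2, 3, 6), (s, 1, 5, 7), (1, 2, 6, 7), (1, 1, 6, 8), (1, 2, 5, 8), (1, 3, 4, 8)])"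
    by (rule nice_equiv_lie_of_d[OF c, where lam = "\<lambda>i. [1, w, u, l4, l5, l6, l7, l8] ! (i - 1)"])
      (use s w a0 a1 lnz E124[symmetric] E135[symmetric] E245[symmetric] E146[symmetric] E236[symmetric] E157[symmetric] E267[symmetric] E168[symmetric] E258[symmetric] E348[symmetric] in \<open>auto simp: D reduced_entries_def\<close>)
  then have "nice_equiv 8 c (L4 a) \<or> nice_equiv 8 c (L5 a)"
    using s unfolding L4_def L5_def b_def by auto
  then show ?thesis using \<open>a > 0\<close> a1 unfolding b_def by auto
qed

section \<open>The classification\<close>

lemma level8_balanced:
  assumes c: "nice_alg 8 c" and g: "balanced 8 c g" and D: "brackets 8 c = set D"
    and lev: "D \<in> set (level8 a)"
  shows "D \<in> set diagrams8_0"
proof -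
  have "D \<in> set diagrams8_0 \<or> D \<in> set diagrams8_1 \<or> D \<in> set diagrams8_2 \<or> D \<in> set diagrams8_3 \<or> D \<in> set diagrams8_4 \<or> D \<in> set diagrams8_5"
    using lev unfolding level8_def by (simp split: if_splits)
  \<comment> \<open>The refutations speak of the set of brackets; \<open>arg_cong\<close> transfers
    the equality of lists to one of sets.\<close>
  moreover have "D \<notin> set diagrams8_1"
    unfolding diagrams8_1_def list.set insert_iff empty_iff
    by (intro notI) (elim disjE
        not_balanced_7[OF c, unfolded D, OF arg_cong[of _ _ set]]
        not_balanced_8[OF c _ g, unfolded D, OF arg_cong[of _ _ set]]
        not_balanced_9[OF c g, unfolded D, THEN notE, OF arg_cong[of _ _ set]]
        not_balanced_10[OF c g, unfolded D, THEN notE, OF arg_cong[of _ _ set]]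
        not_balanced_11[OF c _ g, unfolded D, OF arg_cong[of _ _ set]]
        not_balanced_12[OF c g, unfolded D, THEN notE, OF arg_cong[of _ _ set]]
        not_balanced_13[OF c g, unfolded D, THEN notE, OF arg_cong[of _ _ set]]
        not_balanced_14[OF c g, unfolded D, THEN notE, OF arg_cong[of _ _ set]])
  moreover have "D \<notin> set diagrams8_2"
    unfolding diagrams8_2_def list.set insert_iff empty_iff
    by (intro notI) (elim disjE
        not_balanced_15[OF c g, unfolded D, THEN notE, OF arg_cong[of _ _ set]]
        not_balanced_16[OF c g, unfolded D, THEN notE, OF arg_cong[of _ _ set]]
        not_balanced_17[OF c g, unfolded D, THEN notE, OF arg_cong[of _ _ set]]
        not_balanced_18[OF c g, unfolded D, THEN notE, OF arg_cong[of _ _ set]]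
        not_balanced_19[OF c g, unfolded D, THEN notE, OF arg_cong[of _ _ set]]
        not_balanced_20[OF c g, unfolded D, THEN notE, OF arg_cong[of _ _ set]]
        not_balanced_21[OF c _ g, unfolded D, OF arg_cong[of _ _ set]]
        not_balanced_22[OF c g, unfolded D, THEN notE, OF arg_cong[of _ _ set]])
  moreover have "D \<notin> set diagrams8_3"
    unfolding diagrams8_3_def list.set insert_iff empty_iff
    by (intro notI) (elim disjE
        not_balanced_23[OF c g, unfolded D, THEN notE, OF arg_cong[of _ _ set]]
        not_balanced_24[OF c _ g, unfolded D, OF arg_cong[of _ _ set]]
        not_balanced_25[OF c g, unfolded D, THEN notE, OF arg_cong[of _ _ set]]
        not_balanced_26[OF c g, unfolded D, THEN notE, OF arg_cong[of _ _ set]]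
        not_balanced_27[OF c g, unfolded D, THEN notE, OF arg_cong[of _ _ set]]
        not_balanced_28[OF c g, unfolded D, THEN notE, OF arg_cong[of _ _ set]]
        not_balanced_29[OF c g, unfolded D, THEN notE, OF arg_cong[of _ _ set]]
        not_balanced_30[OF c g, unfolded D, THEN notE, OF arg_cong[of _ _ set]])
  moreover have "D \<notin> set diagrams8_4"
    unfolding diagrams8_4_def list.set insert_iff empty_iff
    by (intro notI) (elim disjE
        not_balanced_31[OF c g, unfolded D, THEN notE, OF arg_cong[of _ _ set]]
        not_balanced_32[OF c g, unfolded D, THEN notE, OF arg_cong[of _ _ set]]
        not_balanced_33[OF c, unfolded D, OF arg_cong[of _ _ set]]
        not_balanced_34[OF c g, unfolded D, THEN notE, OF arg_cong[of _ _ set]]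
        not_balanced_35[OF c g, unfolded D, THEN notE, OF arg_cong[of _ _ set]]
        not_balanced_36[OF c g, unfolded D, THEN notE, OF arg_cong[of _ _ set]]
        not_balanced_37[OF c g, unfolded D, THEN notE, OF arg_cong[of _ _ set]]
        not_balanced_38[OF c g, unfolded D, THEN notE, OF arg_cong[of _ _ set]])
  moreover have "D \<notin> set diagrams8_5"
    unfolding diagrams8_5_def list.set insert_iff empty_iff
    by (intro notI) (elim disjE
        not_balanced_39[OF c _ g, unfolded D, OF arg_cong[of _ _ set]])
  ultimately show ?thesis by blast
qed

text \<open>Excludes the empty diagram at the end of the first block, the only surviving one that is
  not a normal form.\<close>

lemma brackets_nonempty:
  assumes c: "nice_alg 8 c" and "nice_equiv 8 c0 c" and nab: "\<not> abelian_la 8 c0"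
  shows "brackets 8 c \<noteq> {}"
proof
  assume e: "brackets 8 c = {}"
  have "c i j k = 0" for i j k
  proof (rule ccontr)
    assume nz: "c i j k \<noteq> 0"
    then have "c j i k \<noteq> 0" using nice_alg_antisym[OF c, of i j k] by simp
    moreover have "i \<noteq> j" using nz nice_alg_antisym[OF c, of i i k] by auto
    ultimately have "(i, j, k) \<in> brackets 8 c \<or> (j, i, k) \<in> brackets 8 c"
      using nz nice_alg_supported[OF c nz] by (auto simp: brackets_def)
    with e show False by simp
  qed
  moreover obtain \<sigma> lam where lam: "\<forall>i\<in>{1..8}. lam i \<noteq> (0::real)"
    and eq: "\<forall>i\<in>{1..8}. \<forall>j\<in>{1..8}. \<forall>k\<in>{1..8}. lam i * lam j * c (\<sigma> i) (\<sigma> j) (\<sigma> k) = c0 i j k * lam k"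
    using assms(2) unfolding nice_equiv_def by blast
  ultimately have "c0 i j k * lam k = 0" if "i \<in> {1..8}" "j \<in> {1..8}" "k \<in> {1..8}" for i j k
    using that by (metis mult_zero_right)
  then have "c0 i j k = 0" if "i \<in> {1..8}" "j \<in> {1..8}" "k \<in> {1..8}" for i j k
    using that lam by (metis mult_eq_0_iff)
  then show False using nab unfolding abelian_la_def by blast
qed

lemma nice_equiv_normal_form:
  assumes c: "nice_alg 8 c" and g: "balanced 8 c g" and D: "brackets 8 c = set D"
    and lev: "D \<in> set (level8 a)" and "brackets 8 c \<noteq> {}"
  shows "nice_equiv 8 c L1 \<or> nice_equiv 8 c L2 \<or> nice_equiv 8 c L3
    \<or> (\<exists>a. a > 0 \<and> a \<noteq> 1 \<and> nice_equiv 8 c (L4 a)) \<or> (\<exists>a. a > 0 \<and> a \<noteq> 1 \<and> nice_equiv 8 c (L5 a))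
    \<or> nice_equiv 8 c L6 \<or> nice_equiv 8 c L7
    \<or> (\<exists>a. a \<noteq> 0 \<and> a \<noteq> 1 \<and> nice_equiv 8 c (L8 a)) \<or> nice_equiv 8 c L9"
proof -
  have "D \<noteq> []" using assms(5) D by auto
  note n1 = nice_equiv_L1[OF c, unfolded D, OF arg_cong[of _ _ set]]
    and n2 = nice_equiv_L2[OF c, unfolded D, OF arg_cong[of _ _ set]]
    and n3 = nice_equiv_L3[OF c, unfolded D, OF arg_cong[of _ _ set]]
    and n45 = nice_equiv_L4_L5[OF c _ g, unfolded D, OF arg_cong[of _ _ set]]
    and n67 = nice_equiv_L6_L7[OF c, unfolded D, OF arg_cong[of _ _ set]]
    and n8 = nice_equiv_L8[OF c, unfolded D, OF arg_cong[of _ _ set]]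
    and n9 = nice_equiv_L9[OF c, unfolded D, OF arg_cong[of _ _ set]]
  from level8_balanced[OF c g D lev] \<open>D \<noteq> []\<close> show ?thesis
    unfolding diagrams8_0_def list.set insert_iff empty_iff
    by (elim disjE) (drule n1, blast | drule n2, blast | drule n3, blast | drule n45, blast
      | drule n67, blast | drule n8, blast | drule n9, blast | simp)+
qed

theorem theorem4p4:
  fixes c :: "nat \<Rightarrow> nat \<Rightarrow> nat \<Rightarrow> real"
  assumes "nice_nilpotent 8 c"
    and "\<not> abelian_la 8 c"
  shows "admits_diag_ricci_flat 8 c \<longleftrightarrow>
     (nice_equiv 8 c L1
      \<or> nice_equiv 8 c L2
      \<or> nice_equiv 8 c L3
      \<or> (\<exists>a. a > 0 \<and> a \<noteq> 1 \<and> nice_equiv 8 c (L4 a))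
      \<or> (\<exists>a. a > 0 \<and> a \<noteq> 1 \<and> nice_equiv 8 c (L5 a))
      \<or> nice_equiv 8 c L6
      \<or> nice_equiv 8 c L7
      \<or> (\<exists>a. a \<noteq> 0 \<and> a \<noteq> 1 \<and> nice_equiv 8 c (L8 a))
      \<or> nice_equiv 8 c L9)"
proof
  have c: "nice_alg 8 c" by (rule nice_nilpotent_imp_nice_alg[OF assms(1)])
  obtain r where r: "graded_by r c" using nice_nilpotent_graded[OF assms(1)] by blast
  \<comment> \<open>Curvature is translated for \<open>c\<close> alone; along equivalences only
    \<open>balanced\<close> is transported, so no grading has to be found for the other
    algebras.\<close>
  note flat_iff = admits_diag_ricci_flat_iff_balanced[OF c r]
  {
    assume "admits_diag_ricci_flat 8 c"
    then have g: "\<exists>g. balanced 8 c g" using flat_iff by blast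
    obtain c1 where c1: "nice_equiv 8 c c1" "nice_alg 8 c1" "sorted_alg c1"
      using ex_sorted_alg[OF c r] by blast
    have "\<exists>g. balanced 8 c1 g" by (rule balanced_nice_equiv[OF nice_equiv_sym[OF c1(1)] g])
    then have "has_diagram_in level8 8 c1" by (rule has_diagram_in_level8[OF c1(2,3)])
    then obtain c2 a D where c2: "nice_equiv 8 c1 c2" "nice_alg 8 c2" "D \<in> set (level8 a)" "brackets 8 c2 = set D"
      unfolding has_diagram_in_def by blast
    have eq: "nice_equiv 8 c c2" by (rule nice_equiv_trans[OF c1(1) c2(1)])
    obtain g2 where g2: "balanced 8 c2 g2"
      using balanced_nice_equiv[OF nice_equiv_sym[OF eq] g] by blast
    show "(nice_equiv 8 c L1
      \<or> nice_equiv 8 c L2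
      \<or> nice_equiv 8 c L3
      \<or> (\<exists>a. a > 0 \<and> a \<noteq> 1 \<and> nice_equiv 8 c (L4 a))
      \<or> (\<exists>a. a > 0 \<and> a \<noteq> 1 \<and> nice_equiv 8 c (L5 a))
      \<or> nice_equiv 8 c L6
      \<or> nice_equiv 8 c L7
      \<or> (\<exists>a. a \<noteq> 0 \<and> a \<noteq> 1 \<and> nice_equiv 8 c (L8 a))
      \<or> nice_equiv 8 c L9)"
      using nice_equiv_normal_form[OF c2(2) g2 c2(4) c2(3) brackets_nonempty[OF c2(2) eq assms(2)]]
        nice_equiv_trans[OF eq] by blast
  }
  assume "(nice_equiv 8 c L1
      \<or> nice_equiv 8 c L2
      \<or> nice_equiv 8 c L3
      \<or> (\<exists>a. a > 0 \<and> a \<noteq> 1 \<and> nice_equiv 8 c (L4 a))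
      \<or> (\<exists>a. a > 0 \<and> a \<noteq> 1 \<and> nice_equiv 8 c (L5 a))
      \<or> nice_equiv 8 c L6
      \<or> nice_equiv 8 c L7
      \<or> (\<exists>a. a \<noteq> 0 \<and> a \<noteq> 1 \<and> nice_equiv 8 c (L8 a))
      \<or> nice_equiv 8 c L9)"
  then obtain c' where "nice_equiv 8 c c'" "\<exists>g. balanced 8 c' g"
    using balanced_L1 balanced_L2 balanced_L3 balanced_L4_L5 balanced_L6 balanced_L7 balanced_L8 balanced_L9
    by metis
  then show "admits_diag_ricci_flat 8 c"
    using flat_iff balanced_nice_equiv by blast
qed

end
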